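(* The covariantly twisted algebra $\mathbb{C}_F[\widetilde{\mathbb{CM}^\#}]$ has the deformed product \[ x^{\mu\nu}\bullet x^{\alpha\beta}=x^{\mu\nu}x^{\alpha\beta}+\tfrac{\imath}{2}\left(\theta^{\mu\beta}_{ad}x^{a\nu}x^{\alpha d}+\theta^{\mu\alpha}_{ac}x^{a\nu}x^{c\beta}+\theta^{\nu\beta}_{bd}x^{\mu b}x^{\alpha d}+\theta^{\nu\alpha}_{bc}x^{\mu b}x^{c\beta}\right)-\tfrac14\left(\theta^{\nu\alpha}_{bc}\theta^{\mu\beta}_{ad}+\theta^{\nu\beta}_{bd}\theta^{\mu\alpha}_{ac}\right)x^{ab}x^{cd} \] and is isomorphic to the subalgebra $\mathbb{C}_F[\mathrm{GL}_4]^{\mathbb{C}_F[\tilde H]}$ of $\mathbb{C}_F[\mathrm{GL}_4]$, where $F$ is pulled back to $\mathbb{C}[\tilde H]$. Products of generators with $t=x^{34}$ are undeformed.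
   Context: $\mathbb{C}[\mathrm{GL}_4]$ is the commutative Hopf algebra with generators $a^\mu_\nu$ ($\mu,\nu=1,\dots,4$), matrix coproduct $\Delta a^\mu_\nu=a^\mu_\alpha\otimes a^\alpha_\nu$, and the determinant inverted. Repeated indices are summed. $\mathbb{C}[\widetilde{\mathbb{CM}^\#}]$ is the commutative algebra generated by $x^{\mu\nu}=-x^{\nu\mu}$ ($\mu,\nu=1,\dots,4$) modulo the quadric relation $x^{12}x^{34}-x^{13}x^{24}+x^{14}x^{23}=0$ (with $s=x^{12}$, $w=-x^{13}$, $\tilde z=x^{14}$, $z=-x^{23}$, $\tilde w=x^{24}$, $t=x^{34}$ this reads $st=z\tilde z-w\tilde w$). It is a left $\mathbb{C}[\mathrm{GL}_4]$-comodule algebra by $\Delta_L(x^{\mu\nu})=a^\mu_\alpha a^\nu_\beta\otimes x^{\alpha\beta}$. $\mathbb{C}[\tilde H]=\mathbb{C}[\mathrm{GL}_4]/\langle a^3_1=a^3_2=a^4_1=a^4_2=0,\ a^1_1a^2_2-a^2_1a^1_2=1\rangle$, a quotient Hopf algebra with projection $\pi$. Let $\theta^{AB}_{A'B'}$ ($A,B\in\{1,2\}$, $A',B'\in\{3,4\}$) be complex parameters; extend to $\theta^{\mu\alpha}_{\nu\beta}$, set to zero unless $\mu,\alpha\in\{1,2\}$ and $\nu,\beta\in\{3,4\}$. Let $\mathbb{C}[\mathbb{C}^4]$ be the polynomial Hopf algebra on $t^A_{A'}$ with additive coproduct and $\partial^{A'}_A$ the dual translation generators (differentiation and evaluation at zero).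 The 2-cocycle $F(h,g)=\langle\exp(\frac{\imath}{2}\theta^{AB}_{A'B'}\partial^{A'}_A\otimes\partial^{B'}_B),h\otimes g\rangle$ is pulled back to $\mathbb{C}[\mathrm{GL}_4]$ and to $\mathbb{C}[\tilde H]$ along the Hopf algebra map sending $a^A_{A'}\mapsto t^A_{A'}$ for $A\in\{1,2\},A'\in\{3,4\}$, and $a^\mu_\nu\mapsto\delta^\mu_\nu$ for all other entries (this map factors through $\mathbb{C}[\tilde H]$). For $K$ one of these Hopf algebras, $K_F$ (written $\mathbb{C}_F[\cdot]$) has the same coalgebra and product $h\bullet g=F(h_{(1)},g_{(1)})h_{(2)}g_{(2)}F^{-1}(h_{(3)},g_{(3)})$. For a left comodule algebra with coaction $a\mapsto a_{(1)}\otimes a_{(2)}$, the twisted algebra is the same vector space with $a\bullet b=F(a_{(1)},b_{(1)})a_{(2)}b_{(2)}$; this defines $\mathbb{C}_F[\widetilde{\mathbb{CM}^\#}]$. $\mathbb{C}_F[\mathrm{GL}_4]^{\mathbb{C}_F[\tilde H]}$ denotes the subalgebra of elements invariant under the right coaction $(\mathrm{id}\otimes\pi)\Delta$. Products without $\bullet$ are in the original commutative algebra. *)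

theory Defs
  imports "HOL-Analysis.Cartesian_Space" "HOL-Analysis.Determinants" "HOL-Library.Poly_Mapping"
begin

section \<open>Complex vector spaces and commutative complex algebras\<close>

class cvec = ab_group_add +
  fixes scaleC :: "complex \<Rightarrow> 'a \<Rightarrow> 'a"  (infixr \<open>*\<^sub>C\<close> 75)
  assumes scaleC_add_right: "c *\<^sub>C (x + y) = c *\<^sub>C x + c *\<^sub>C y"
    and scaleC_add_left: "(c + d) *\<^sub>C x = c *\<^sub>C x + d *\<^sub>C x"
    and scaleC_scaleC: "c *\<^sub>C (d *\<^sub>C x) = (c * d) *\<^sub>C x"
    and scaleC_one: "1 *\<^sub>C x = x"

class calg = cvec + comm_ring_1 +
  assumes scaleC_mult_left: "(c *\<^sub>C x) * y = c *\<^sub>C (x * y)"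

global_interpretation cvec: vector_space "scaleC :: complex \<Rightarrow> 'a::cvec \<Rightarrow> 'a"
  by standard (rule scaleC_add_right scaleC_add_left scaleC_scaleC scaleC_one)+

abbreviation clinear :: "('a::cvec \<Rightarrow> 'b::cvec) \<Rightarrow> bool"
  where "clinear \<equiv> Vector_Spaces.linear scaleC scaleC"

lemma clinearI:
  assumes "\<And>x y. f (x + y) = f x + f y" and "\<And>c x. f (c *\<^sub>C x) = c *\<^sub>C f x"
  shows "clinear f"
  by (simp add: linear_iff_module_hom module_hom_iff cvec.module_axioms assms)

lemma clinearD:
  assumes "clinear f"
  shows "f (x + y) = f x + f y" "f (c *\<^sub>C x) = c *\<^sub>C f x"
  using assms by (simp_all add: linear_iff_module_hom module_hom_iff)

lemma scaleC_mult_right: "x * (c *\<^sub>C y) = c *\<^sub>C (x * y :: 'a::calg)"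
  by (metis mult.commute scaleC_mult_left)

definition bilin :: "('a::cvec \<Rightarrow> 'b::cvec \<Rightarrow> 'c::cvec) \<Rightarrow> bool"
  where "bilin B \<longleftrightarrow> (\<forall>a. clinear (B a)) \<and> (\<forall>b. clinear (\<lambda>a. B a b))"

lemma bilinI:
  assumes "\<And>a b b'. B a (b + b') = B a b + B a b'" "\<And>a c b. B a (c *\<^sub>C b) = c *\<^sub>C B a b"
    and "\<And>a a' b. B (a + a') b = B a b + B a' b" "\<And>a c b. B (c *\<^sub>C a) b = c *\<^sub>C B a b"
  shows "bilin B"
  using assms by (auto simp: bilin_def intro!: clinearI)

lemma bilinD:
  assumes "bilin B"
  shows "B a (b + b') = B a b + B a b'" "B a (c *\<^sub>C b) = c *\<^sub>C B a b"
    and "B (a + a') b = B a b + B a' b" "B (c *\<^sub>C a) b = c *\<^sub>C B a b"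
  using assms unfolding bilin_def
  by (simp_all add: linear_iff_module_hom module_hom_iff)

instantiation complex :: calg
begin
definition "scaleC_complex = ((*) :: complex \<Rightarrow> complex \<Rightarrow> complex)"
instance by standard (simp_all add: scaleC_complex_def algebra_simps)
end

lemma ex_clinear_functional: "\<exists>f :: 'a::calg \<Rightarrow> complex. clinear f \<and> f 1 = 1"
proof -
  interpret vector_space_pair "scaleC :: complex \<Rightarrow> 'a \<Rightarrow> 'a" "scaleC :: complex \<Rightarrow> complex \<Rightarrow> complex" ..
  show ?thesis
    using linear_independent_extend[of "{1}" "\<lambda>_. 1"] by (auto simp: cvec.dependent_single)
qed

instantiation poly_mapping :: (type, cvec) cvec
begin
definition "scaleC_poly_mapping (c::complex) = Poly_Mapping.map (scaleC c :: 'b \<Rightarrow> 'b)"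

lemma lookup_scaleC: "Poly_Mapping.lookup (c *\<^sub>C p) k = c *\<^sub>C Poly_Mapping.lookup (p :: 'a \<Rightarrow>\<^sub>0 'b) k"
  unfolding scaleC_poly_mapping_def by transfer (simp add: when_def)

instance
  by standard (auto intro!: poly_mapping_eqI
      simp: lookup_scaleC lookup_add scaleC_add_right scaleC_add_left scaleC_scaleC scaleC_one)
end

lemma scaleC_poly_mapping_eq_mult: "c *\<^sub>C p = Poly_Mapping.single 0 (c *\<^sub>C 1) * (p :: 'a::comm_monoid_add \<Rightarrow>\<^sub>0 'b::calg)"
proof -
  have "scaleC c = ((*) (c *\<^sub>C 1) :: 'b \<Rightarrow> 'b)"
    by (simp add: scaleC_mult_left fun_eq_iff)
  from arg_cong[OF this, of "\<lambda>h. Poly_Mapping.map h p"] show ?thesis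
    unfolding scaleC_poly_mapping_def by (rule trans[OF _ mult_map_scale_conv_mult])
qed

instance poly_mapping :: (comm_monoid_add, calg) calg
  by standard (simp add: scaleC_poly_mapping_eq_mult mult.assoc)

text \<open>Linear extension from the basis \<open>'k\<close> of the free vector space \<open>'k \<Rightarrow>\<^sub>0 complex\<close>.\<close>

definition lin_ext :: "('k \<Rightarrow> 'c::cvec) \<Rightarrow> ('k \<Rightarrow>\<^sub>0 complex) \<Rightarrow> 'c"
  where "lin_ext \<phi> f = (\<Sum>k\<in>Poly_Mapping.keys f. Poly_Mapping.lookup f k *\<^sub>C \<phi> k)"

lemma lin_ext_superset:
  assumes "finite S" "Poly_Mapping.keys f \<subseteq> S"
  shows "lin_ext \<phi> f = (\<Sum>k\<in>S. Poly_Mapping.lookup f k *\<^sub>C \<phi> k)"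
  unfolding lin_ext_def
  by (rule sum.mono_neutral_left) (use assms in \<open>auto simp: in_keys_iff\<close>)

lemma clinear_lin_ext: "clinear (lin_ext \<phi>)"
proof (rule clinearI)
  fix f g :: "'a \<Rightarrow>\<^sub>0 complex"
  have "lin_ext \<phi> (f + g) = (\<Sum>k\<in>Poly_Mapping.keys f \<union> Poly_Mapping.keys g. Poly_Mapping.lookup (f + g) k *\<^sub>C \<phi> k)"
    by (rule lin_ext_superset) (auto simp: keys_add)
  also have "\<dots> = (\<Sum>k\<in>Poly_Mapping.keys f \<union> Poly_Mapping.keys g. Poly_Mapping.lookup f k *\<^sub>C \<phi> k) + (\<Sum>k\<in>Poly_Mapping.keys f \<union> Poly_Mapping.keys g. Poly_Mapping.lookup g k *\<^sub>C \<phi> k)"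
    by (simp add: lookup_add scaleC_add_left sum.distrib)
  also have "\<dots> = lin_ext \<phi> f + lin_ext \<phi> g"
    by (simp add: lin_ext_superset[of "Poly_Mapping.keys f \<union> Poly_Mapping.keys g"])
  finally show "lin_ext \<phi> (f + g) = lin_ext \<phi> f + lin_ext \<phi> g" .
next
  fix c and f :: "'a \<Rightarrow>\<^sub>0 complex"
  have "lin_ext \<phi> (c *\<^sub>C f) = (\<Sum>k\<in>Poly_Mapping.keys f. Poly_Mapping.lookup (c *\<^sub>C f) k *\<^sub>C \<phi> k)"
    by (rule lin_ext_superset) (auto simp: in_keys_iff lookup_scaleC)
  then show "lin_ext \<phi> (c *\<^sub>C f) = c *\<^sub>C lin_ext \<phi> f"
    by (simp add: lin_ext_def lookup_scaleC cvec.scale_sum_right scaleC_scaleC scaleC_complex_def)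
qed

lemma lin_ext_single: "lin_ext \<phi> (Poly_Mapping.single k c) = c *\<^sub>C \<phi> k"
  by (cases "c = 0") (simp_all add: lin_ext_def)

lemmas lin_ext_simps =
  module_hom.add[OF clinear_lin_ext[unfolded linear_iff_module_hom]]
  module_hom.diff[OF clinear_lin_ext[unfolded linear_iff_module_hom]]
  module_hom.scale[OF clinear_lin_ext[unfolded linear_iff_module_hom]]
  module_hom.zero[OF clinear_lin_ext[unfolded linear_iff_module_hom]]
  lin_ext_single


section \<open>The algebraic tensor product\<close>

text \<open>The free vector space on pairs modulo the bilinearity relations.\<close>

inductive_set tensor_relators :: "('a::cvec \<times> 'b::cvec \<Rightarrow>\<^sub>0 complex) set" where
  add_left: "Poly_Mapping.single (a + a', b) 1 - (Poly_Mapping.single (a, b) 1 + Poly_Mapping.single (a', b) 1)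
    \<in> tensor_relators"
| add_right: "Poly_Mapping.single (a, b + b') 1 - (Poly_Mapping.single (a, b) 1 + Poly_Mapping.single (a, b') 1)
    \<in> tensor_relators"
| scale_left: "Poly_Mapping.single (c *\<^sub>C a, b) 1 - c *\<^sub>C Poly_Mapping.single (a, b) 1 \<in> tensor_relators"
| scale_right: "Poly_Mapping.single (a, c *\<^sub>C b) 1 - c *\<^sub>C Poly_Mapping.single (a, b) 1 \<in> tensor_relators"

definition tensor_eq :: "('a::cvec \<times> 'b::cvec \<Rightarrow>\<^sub>0 complex) \<Rightarrow> ('a \<times> 'b \<Rightarrow>\<^sub>0 complex) \<Rightarrow> bool"
  where "tensor_eq f g \<longleftrightarrow> f - g \<in> cvec.span tensor_relators"

quotient_type (overloaded) ('a, 'b) tensor = "'a::cvec \<times> 'b::cvec \<Rightarrow>\<^sub>0 complex" / tensor_eq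
proof (rule equivpI)
  show "reflp tensor_eq" by (simp add: reflp_def tensor_eq_def cvec.span_zero)
  show "symp tensor_eq"
    unfolding symp_def tensor_eq_def using cvec.span_neg by fastforce
  show "transp tensor_eq"
    unfolding transp_def tensor_eq_def using cvec.span_add by fastforce
qed

instantiation tensor :: (cvec, cvec) cvec
begin

lift_definition zero_tensor :: "('a, 'b) tensor" is 0 .
lift_definition plus_tensor :: "('a, 'b) tensor \<Rightarrow> ('a, 'b) tensor \<Rightarrow> ('a, 'b) tensor" is "(+)"
  unfolding tensor_eq_def by (simp only: add_diff_add cvec.span_add)
lift_definition minus_tensor :: "('a, 'b) tensor \<Rightarrow> ('a, 'b) tensor \<Rightarrow> ('a, 'b) tensor" is "(-)"
  unfolding tensor_eq_def
proof -
  fix a b c d :: "'a \<times> 'b \<Rightarrow>\<^sub>0 complex"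
  assume "a - b \<in> cvec.span tensor_relators" "c - d \<in> cvec.span tensor_relators"
  then have "(a - b) - (c - d) \<in> cvec.span tensor_relators" by (rule cvec.span_diff)
  then show "a - c - (b - d) \<in> cvec.span tensor_relators" by (simp add: algebra_simps)
qed
lift_definition uminus_tensor :: "('a, 'b) tensor \<Rightarrow> ('a, 'b) tensor" is uminus
  unfolding tensor_eq_def using cvec.span_neg by fastforce
lift_definition scaleC_tensor :: "complex \<Rightarrow> ('a, 'b) tensor \<Rightarrow> ('a, 'b) tensor" is scaleC
  unfolding tensor_eq_def by (metis cvec.scale_right_diff_distrib cvec.span_scale)

instance
  by standard
    (transfer, simp add: tensor_eq_def cvec.span_zero algebra_simps
       scaleC_add_right scaleC_add_left scaleC_scaleC scaleC_one)+

end

lift_definition tens :: "'a::cvec \<Rightarrow> 'b::cvec \<Rightarrow> ('a, 'b) tensor"  (infixr \<open>\<otimes>\<close> 72)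
  is "\<lambda>a b. Poly_Mapping.single (a, b) 1" .

lemma tensor_eq_relator: "f - g \<in> tensor_relators \<Longrightarrow> tensor_eq f g"
  unfolding tensor_eq_def by (rule cvec.span_base)

lemma scaleC_single: "c *\<^sub>C Poly_Mapping.single k d = Poly_Mapping.single k (c * d :: complex)"
  by (rule poly_mapping_eqI) (simp add: lookup_scaleC lookup_single when_def scaleC_complex_def)

lemma bilin_tens: "bilin (\<otimes>)"
proof (rule bilinI)
  show "a \<otimes> (b + b') = a \<otimes> b + a \<otimes> b'" for a :: 'a and b b' :: 'b
    by transfer (rule tensor_eq_relator, rule tensor_relators.add_right)
  show "(a + a') \<otimes> b = a \<otimes> b + a' \<otimes> b" for a a' :: 'a and b :: 'b
    by transfer (rule tensor_eq_relator, rule tensor_relators.add_left)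
  show "a \<otimes> (c *\<^sub>C b) = c *\<^sub>C (a \<otimes> b)" for a :: 'a and b :: 'b and c
    by transfer (rule tensor_eq_relator, rule tensor_relators.scale_right)
  show "(c *\<^sub>C a) \<otimes> b = c *\<^sub>C (a \<otimes> b)" for a :: 'a and b :: 'b and c
    by transfer (rule tensor_eq_relator, rule tensor_relators.scale_left)
qed

text \<open>The linear map induced by \<open>B\<close>. The representative of a tensor is irrelevant when \<open>B\<close> is
  bilinear, which is the only case of interest.\<close>

definition tensor_ext :: "('a::cvec \<Rightarrow> 'b::cvec \<Rightarrow> 'c::cvec) \<Rightarrow> ('a, 'b) tensor \<Rightarrow> 'c"
  where "tensor_ext B t = lin_ext (\<lambda>(a, b). B a b) (rep_tensor t)"

lemma poly_mapping_sum_monomials: "(\<Sum>k\<in>Poly_Mapping.keys f. Poly_Mapping.single k (Poly_Mapping.lookup f k)) = f"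
  by (rule poly_mapping_eqI) (auto simp: lookup_sum lookup_single when_def in_keys_iff)

lemma tensor_ext_abs:
  assumes "bilin B"
  shows "tensor_ext B (abs_tensor f) = lin_ext (\<lambda>(a, b). B a b) f"
proof -
  have "lin_ext (\<lambda>(a, b). B a b) r = 0" if "r \<in> cvec.span tensor_relators" for r
    using that
  proof (induction rule: cvec.span_induct_alt)
    case base show ?case by (simp add: lin_ext_simps)
  next
    case (step c x y)
    then have "lin_ext (\<lambda>(a, b). B a b) x = 0"
      by (auto elim!: tensor_relators.cases simp: lin_ext_simps bilinD[OF assms] scaleC_one)
    with step show ?case by (simp add: lin_ext_simps)
  qed
  moreover have "tensor_eq (rep_tensor (abs_tensor f)) f"
    using Quotient_rep_abs[OF Quotient_tensor] Quotient_tensor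
    by (metis (mono_tags, lifting) Quotient_abs_rep tensor.abs_eq_iff)
  ultimately have "lin_ext (\<lambda>(a, b). B a b) (rep_tensor (abs_tensor f) - f) = 0"
    by (auto simp: tensor_eq_def)
  then show ?thesis by (simp add: lin_ext_simps tensor_ext_def)
qed

lemma tensor_ext_tens: "bilin B \<Longrightarrow> tensor_ext B (a \<otimes> b) = B a b"
  by (simp add: tens.abs_eq tensor_ext_abs lin_ext_simps scaleC_one)

lemma clinear_tensor_ext: "bilin B \<Longrightarrow> clinear (tensor_ext B)"
proof (rule clinearI)
  assume B: "bilin B"
  show "tensor_ext B (x + y) = tensor_ext B x + tensor_ext B y" for x y
    by (induction x; induction y) (simp add: plus_tensor.abs_eq tensor_ext_abs[OF B] lin_ext_simps)
  show "tensor_ext B (c *\<^sub>C x) = c *\<^sub>C tensor_ext B x" for c x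
    by (induction x) (simp add: scaleC_tensor.abs_eq tensor_ext_abs[OF B] lin_ext_simps)
qed

lemmas tensor_ext_add = module_hom.add[OF clinear_tensor_ext[unfolded linear_iff_module_hom]]
lemmas tensor_ext_scale = module_hom.scale[OF clinear_tensor_ext[unfolded linear_iff_module_hom]]

lemma tensor_ext_zero: "bilin B \<Longrightarrow> tensor_ext B 0 = 0"
  using tensor_ext_scale[of B 0 0] by simp

lemma tensor_ext_add_fun: "tensor_ext (\<lambda>a b. B a b + B' a b) t = tensor_ext B t + tensor_ext B' t"
  by (simp add: tensor_ext_def lin_ext_def split_def scaleC_add_right sum.distrib)

lemma tensor_ext_scale_fun: "tensor_ext (\<lambda>a b. c *\<^sub>C B a b) t = c *\<^sub>C tensor_ext B t"
  by (simp add: tensor_ext_def lin_ext_def split_def cvec.scale_sum_right mult.commute)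

lemma tensor_induct [case_names zero tens add]:
  assumes "P 0" and tens: "\<And>a b. P (a \<otimes> b)" and add: "\<And>t u. P t \<Longrightarrow> P u \<Longrightarrow> P (t + u)"
  shows "P t"
proof -
  have "P (abs_tensor (\<Sum>k\<in>S. Poly_Mapping.single k (Poly_Mapping.lookup f k)))" if "finite S" for S and f :: "'a \<times> 'b \<Rightarrow>\<^sub>0 complex"
    using that
  proof induction
    case empty
    then show ?case using \<open>P 0\<close> by (simp add: zero_tensor.abs_eq)
  next
    case (insert k S)
    obtain a b where [simp]: "k = (a, b)" by force
    have "abs_tensor (Poly_Mapping.single k (Poly_Mapping.lookup f k)) = (Poly_Mapping.lookup f k *\<^sub>C a) \<otimes> b"
      by (simp add: bilinD[OF bilin_tens])
         (simp add: tens.abs_eq scaleC_tensor.abs_eq scaleC_single)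
    then have "P (abs_tensor (Poly_Mapping.single k (Poly_Mapping.lookup f k)))" using tens by simp
    then show ?case using insert add by (simp add: plus_tensor.abs_eq[symmetric])
  qed
  from this[of "Poly_Mapping.keys f" f for f] show ?thesis
    by (induction t) (simp add: poly_mapping_sum_monomials)
qed

definition map_tensor ::
  "('a::cvec \<Rightarrow> 'c::cvec) \<Rightarrow> ('b::cvec \<Rightarrow> 'd::cvec) \<Rightarrow> ('a, 'b) tensor \<Rightarrow> ('c, 'd) tensor"
  where "map_tensor f g = tensor_ext (\<lambda>a b. f a \<otimes> g b)"

instantiation tensor :: (calg, calg) calg
begin

definition one_tensor :: "('a, 'b) tensor" where "one_tensor = 1 \<otimes> 1"

definition times_tensor :: "('a, 'b) tensor \<Rightarrow> ('a, 'b) tensor \<Rightarrow> ('a, 'b) tensor"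
  where "times_tensor t u = tensor_ext (\<lambda>a b. tensor_ext (\<lambda>a' b'. (a * a') \<otimes> (b * b')) u) t"

lemma tensor_mult_bilin1: "bilin (\<lambda>a' b'. (a * a' :: 'a) \<otimes> (b * b' :: 'b))"
  by (rule bilinI) (simp_all add: distrib_left scaleC_mult_right bilinD[OF bilin_tens])

lemma tensor_mult_bilin2: "bilin (\<lambda>a b. tensor_ext (\<lambda>a' b'. (a * a' :: 'a) \<otimes> (b * b' :: 'b)) u)"
  by (rule bilinI) (simp_all add: distrib_right scaleC_mult_left bilinD[OF bilin_tens]
        tensor_ext_add_fun tensor_ext_scale_fun)

lemma tensor_mult_tens: "(a \<otimes> b) * (a' \<otimes> b') = (a * a' :: 'a) \<otimes> (b * b' :: 'b)"
  unfolding times_tensor_def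
  by (rule trans[OF tensor_ext_tens[OF tensor_mult_bilin2] tensor_ext_tens[OF tensor_mult_bilin1]])

lemma bilin_tensor_mult: "bilin ((*) :: ('a, 'b) tensor \<Rightarrow> _)"
proof (rule bilinI)
  fix t u v :: "('a, 'b) tensor" and c
  show "(t + u) * v = t * v + u * v" "(c *\<^sub>C t) * v = c *\<^sub>C (t * v)"
    by (simp_all add: times_tensor_def tensor_ext_add[OF tensor_mult_bilin2]
          tensor_ext_scale[OF tensor_mult_bilin2])
  show "t * (u + v) = t * u + t * v" "t * (c *\<^sub>C v) = c *\<^sub>C (t * v)"
    by (simp_all add: times_tensor_def tensor_ext_add[OF tensor_mult_bilin1]
          tensor_ext_scale[OF tensor_mult_bilin1] tensor_ext_add_fun tensor_ext_scale_fun)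
qed

instance
proof
  fix t u v :: "('a, 'b) tensor" and c
  note d = bilinD[OF bilin_tensor_mult]
  have z: "0 * t = 0" "t * 0 = 0" for t :: "('a, 'b) tensor"
    using d(4)[of 0 0 t] d(2)[of t 0 0] by simp_all
  show "(t + u) * v = t * v + u * v" "(c *\<^sub>C t) * v = c *\<^sub>C (t * v)" by (rule d)+
  show "1 * t = t"
    by (induction t rule: tensor_induct) (simp_all add: one_tensor_def tensor_mult_tens d z[unfolded one_tensor_def])
  show "t * u = u * t"
  proof (induction t rule: tensor_induct)
    case (tens a b)
    then show ?case
      by (induction u rule: tensor_induct) (simp_all add: tensor_mult_tens d z mult.commute)
  qed (simp_all add: d z)
  show "t * u * v = t * (u * v)"
  proof (induction t rule: tensor_induct)
    case 1: (tens a b)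
    show ?case
    proof (induction u rule: tensor_induct)
      case 2: (tens a' b')
      show ?case
        by (induction v rule: tensor_induct) (simp_all add: tensor_mult_tens d z mult.assoc)
    qed (simp_all add: d z)
  qed (simp_all add: d z)
  obtain f :: "'a \<Rightarrow> complex" where f: "clinear f" "f 1 = 1" using ex_clinear_functional by blast
  obtain g :: "'b \<Rightarrow> complex" where g: "clinear g" "g 1 = 1" using ex_clinear_functional by blast
  have fg: "bilin (\<lambda>a b. f a * g b)"
    by (rule bilinI) (simp_all add: clinearD[OF f(1)] clinearD[OF g(1)] scaleC_complex_def algebra_simps)
  show "(0 :: ('a, 'b) tensor) \<noteq> 1"
  proof
    assume "(0 :: ('a, 'b) tensor) = 1"
    then have "tensor_ext (\<lambda>a b. f a * g b) (1 \<otimes> 1) = tensor_ext (\<lambda>a b. f a * g b) 0"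
      by (simp add: one_tensor_def)
    then show False using f g by (simp add: tensor_ext_tens[OF fg] tensor_ext_zero[OF fg])
  qed
qed

end


section \<open>Finitely presented commutative algebras\<close>

type_synonym 'v mpoly = "('v \<Rightarrow>\<^sub>0 nat) \<Rightarrow>\<^sub>0 complex"

definition var :: "'v \<Rightarrow> 'v mpoly"
  where "var v = Poly_Mapping.single (Poly_Mapping.single v 1) 1"

definition aeval :: "('v \<Rightarrow> 'b::calg) \<Rightarrow> 'v mpoly \<Rightarrow> 'b"
  where "aeval f = lin_ext (\<lambda>m. \<Prod>v\<in>Poly_Mapping.keys m. f v ^ Poly_Mapping.lookup m v)"

lemma poly_mapping_add_induct:
  fixes p :: "'k \<Rightarrow>\<^sub>0 'b::comm_monoid_add"
  assumes "P 0" "\<And>k c. P (Poly_Mapping.single k c)" "\<And>p q. P p \<Longrightarrow> P q \<Longrightarrow> P (p + q)"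
  shows "P p"
proof -
  have "P (\<Sum>k\<in>S. Poly_Mapping.single k (Poly_Mapping.lookup p k))" if "finite S" for S
    using that by induction (use assms in auto)
  then show ?thesis by (metis finite_keys poly_mapping_sum_monomials)
qed

lemma aeval_add: "aeval f (p + q) = aeval f p + aeval f q"
  and aeval_diff: "aeval f (p - q) = aeval f p - aeval f q"
  and aeval_scaleC: "aeval f (c *\<^sub>C p) = c *\<^sub>C aeval f p"
  and aeval_0: "aeval f 0 = 0"
  and aeval_var: "aeval f (var v) = f v"
  by (simp_all add: aeval_def lin_ext_simps var_def scaleC_one)

lemma aeval_1: "aeval f 1 = 1"
  using lin_ext_single[of "\<lambda>m. \<Prod>v\<in>Poly_Mapping.keys m. f v ^ Poly_Mapping.lookup m v" 0 1]
  by (simp add: aeval_def scaleC_one)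

lemma aeval_mult: "aeval f (p * q) = aeval f p * aeval f q"
proof -
  let ?ev = "\<lambda>m. \<Prod>v\<in>Poly_Mapping.keys m. f v ^ Poly_Mapping.lookup m v"
  have ev: "?ev m = (\<Prod>v\<in>S. f v ^ Poly_Mapping.lookup m v)" if "finite S" "Poly_Mapping.keys m \<subseteq> S" for m S
    by (rule prod.mono_neutral_left) (use that in \<open>auto simp: in_keys_iff\<close>)
  have add: "?ev (m + n) = ?ev m * ?ev n" for m n
    using ev[of "Poly_Mapping.keys m \<union> Poly_Mapping.keys n" m] ev[of "Poly_Mapping.keys m \<union> Poly_Mapping.keys n" n]
      ev[of "Poly_Mapping.keys m \<union> Poly_Mapping.keys n" "m + n"] keys_add[of m n]
    by (simp add: lookup_add power_add prod.distrib)
  have single: "aeval f (Poly_Mapping.single m c * Poly_Mapping.single n d) =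
      aeval f (Poly_Mapping.single m c) * aeval f (Poly_Mapping.single n d)" for m n c d
    by (simp add: aeval_def mult_single lin_ext_single add scaleC_mult_left scaleC_mult_right scaleC_scaleC)
  have mono: "aeval f (Poly_Mapping.single m c * q) = aeval f (Poly_Mapping.single m c) * aeval f q" for m c
    by (induction q rule: poly_mapping_add_induct)
       (simp_all add: aeval_0 aeval_add single distrib_left)
  show ?thesis
    by (induction p rule: poly_mapping_add_induct)
       (simp_all add: aeval_0 aeval_add mono distrib_right)
qed

text \<open>A type \<open>'v\<close> of generators comes with a set of relations. \<open>module.span (*) S\<close> is the ideal
  generated by \<open>S\<close>; it is required to be proper because \<open>comm_ring_1\<close> includes \<open>0 \<noteq> 1\<close>.\<close>

interpretation ring_ideal: module "(*) :: 'a::comm_ring_1 \<Rightarrow> 'a \<Rightarrow> 'a"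
  by standard (simp_all add: algebra_simps)

class presentation =
  fixes relations :: "'a mpoly set"
  assumes relations_proper: "1 \<notin> module.span (*) relations"

lemma relations_properI:
  assumes "\<And>r. r \<in> R \<Longrightarrow> aeval (f :: 'v \<Rightarrow> complex) r = 0"
  shows "1 \<notin> module.span (*) R"
proof
  assume "1 \<in> module.span (*) R"
  then have "aeval f 1 = 0"
    by (induction rule: ring_ideal.span_induct_alt) (simp_all add: aeval_0 aeval_add aeval_mult assms)
  then show False by (simp add: aeval_1)
qed

definition presented_eq :: "'v::presentation mpoly \<Rightarrow> 'v mpoly \<Rightarrow> bool"
  where "presented_eq p q \<longleftrightarrow> p - q \<in> module.span (*) relations"

quotient_type (overloaded) 'v presented = "'v::presentation mpoly" / presented_eq
proof (rule equivpI)
  show "reflp presented_eq" by (simp add: reflp_def presented_eq_def ring_ideal.span_zero)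
  show "symp presented_eq"
    unfolding symp_def presented_eq_def using ring_ideal.span_neg by fastforce
  show "transp presented_eq"
    unfolding transp_def presented_eq_def using ring_ideal.span_add by fastforce
qed

lemma presented_eqI: "p = q \<Longrightarrow> presented_eq p q"
  by (simp add: presented_eq_def ring_ideal.span_zero)

instantiation presented :: (presentation) calg
begin

lift_definition zero_presented :: "'a presented" is 0 .
lift_definition one_presented :: "'a presented" is 1 .
lift_definition plus_presented :: "'a presented \<Rightarrow> 'a presented \<Rightarrow> 'a presented" is "(+)"
  unfolding presented_eq_def by (simp only: add_diff_add ring_ideal.span_add)
lift_definition minus_presented :: "'a presented \<Rightarrow> 'a presented \<Rightarrow> 'a presented" is "(-)"
  unfolding presented_eq_def
proof -
  fix a b c d :: "'a mpoly"
  assume "a - b \<in> module.span (*) relations" "c - d \<in> module.span (*) relations"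
  then have "(a - b) - (c - d) \<in> module.span (*) relations" by (rule ring_ideal.span_diff)
  then show "a - c - (b - d) \<in> module.span (*) relations" by (simp add: algebra_simps)
qed
lift_definition uminus_presented :: "'a presented \<Rightarrow> 'a presented" is uminus
  unfolding presented_eq_def using ring_ideal.span_neg by fastforce
lift_definition times_presented :: "'a presented \<Rightarrow> 'a presented \<Rightarrow> 'a presented" is "(*)"
  unfolding presented_eq_def
proof -
  fix a b c d :: "'a mpoly"
  assume "a - b \<in> module.span (*) relations" "c - d \<in> module.span (*) relations"
  then have "c * (a - b) + b * (c - d) \<in> module.span (*) relations"
    by (intro ring_ideal.span_add ring_ideal.span_scale)
  then show "a * c - b * d \<in> module.span (*) relations" by (simp add: algebra_simps)
qed
lift_definition scaleC_presented :: "complex \<Rightarrow> 'a presented \<Rightarrow> 'a presented" is scaleC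
  unfolding presented_eq_def
proof -
  fix c and a b :: "'a mpoly"
  assume "a - b \<in> module.span (*) relations"
  then have "Poly_Mapping.single 0 (c *\<^sub>C 1) * (a - b) \<in> module.span (*) relations"
    by (rule ring_ideal.span_scale)
  then show "c *\<^sub>C a - c *\<^sub>C b \<in> module.span (*) relations"
    by (simp only: scaleC_poly_mapping_eq_mult[of c a] scaleC_poly_mapping_eq_mult[of c b] right_diff_distrib)
qed

instance
proof
  fix p q r :: "'a presented" and c d :: complex
  show "p + q + r = p + (q + r)" by transfer (rule presented_eqI, rule add.assoc)
  show "p + q = q + p" by transfer (rule presented_eqI, rule add.commute)
  show "0 + p = p" by transfer (rule presented_eqI, simp)
  show "- p + p = 0" by transfer (rule presented_eqI, simp)
  show "p - q = p + - q" by transfer (rule presented_eqI, simp)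
  show "c *\<^sub>C (p + q) = c *\<^sub>C p + c *\<^sub>C q" by transfer (rule presented_eqI, rule scaleC_add_right)
  show "(c + d) *\<^sub>C p = c *\<^sub>C p + d *\<^sub>C p" by transfer (rule presented_eqI, rule scaleC_add_left)
  show "c *\<^sub>C d *\<^sub>C p = (c * d) *\<^sub>C p" by transfer (rule presented_eqI, rule scaleC_scaleC)
  show "1 *\<^sub>C p = p" by transfer (rule presented_eqI, rule scaleC_one)
  show "p * q * r = p * (q * r)" by transfer (rule presented_eqI, rule mult.assoc)
  show "p * q = q * p" by transfer (rule presented_eqI, rule mult.commute)
  show "1 * p = p" by transfer (rule presented_eqI, simp)
  show "(p + q) * r = p * r + q * r" by transfer (rule presented_eqI, rule distrib_right)
  show "(c *\<^sub>C p) * q = c *\<^sub>C (p * q)" by transfer (rule presented_eqI, rule scaleC_mult_left)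
  show "(0 :: 'a presented) \<noteq> 1"
  proof (transfer, unfold presented_eq_def)
    show "\<not> 0 - 1 \<in> module.span (*) (relations :: 'a mpoly set)"
      using relations_proper ring_ideal.span_neg by fastforce
  qed
qed

end

lift_definition gen :: "'v::presentation \<Rightarrow> 'v presented" is var .

text \<open>The algebra homomorphism with prescribed values on the generators. The representative is
  irrelevant when those values satisfy the relations (lemma \<open>hom_ext_abs\<close>).\<close>

definition hom_ext :: "('v::presentation \<Rightarrow> 'b::calg) \<Rightarrow> 'v presented \<Rightarrow> 'b"
  where "hom_ext f x = aeval f (rep_presented x)"

lemma hom_ext_abs:
  assumes "\<And>r. r \<in> relations \<Longrightarrow> aeval f r = 0"
  shows "hom_ext f (abs_presented p) = aeval f p"
proof -
  have "aeval f r = 0" if "r \<in> module.span (*) relations" for r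
    using that
    by (induction rule: ring_ideal.span_induct_alt) (simp_all add: aeval_0 aeval_add aeval_mult assms)
  moreover have "presented_eq (rep_presented (abs_presented p)) p"
    by (metis (mono_tags, lifting) Quotient_presented Quotient_abs_rep presented.abs_eq_iff)
  ultimately have "aeval f (rep_presented (abs_presented p) - p) = 0"
    by (auto simp: presented_eq_def)
  then show ?thesis by (simp add: hom_ext_def aeval_diff)
qed

lemma hom_ext_simps:
  assumes "\<And>r. r \<in> relations \<Longrightarrow> aeval f r = 0"
  shows "hom_ext f (gen v) = f v" "hom_ext f 1 = 1" "hom_ext f (x * y) = hom_ext f x * hom_ext f y"
    and "hom_ext f (x + y) = hom_ext f x + hom_ext f y" "hom_ext f (c *\<^sub>C x) = c *\<^sub>C hom_ext f x"
proof -
  note h = hom_ext_abs[OF assms]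
  show "hom_ext f (gen v) = f v" by (simp add: gen.abs_eq h aeval_var)
  show "hom_ext f 1 = 1" by (simp add: one_presented.abs_eq h aeval_1)
  show "hom_ext f (x * y) = hom_ext f x * hom_ext f y"
    by (induction x; induction y) (simp add: times_presented.abs_eq h aeval_mult)
  show "hom_ext f (x + y) = hom_ext f x + hom_ext f y"
    by (induction x; induction y) (simp add: plus_presented.abs_eq h aeval_add)
  show "hom_ext f (c *\<^sub>C x) = c *\<^sub>C hom_ext f x"
    by (induction x) (simp add: scaleC_presented.abs_eq h aeval_scaleC)
qed


section \<open>The coordinate algebras\<close>

text \<open>Indices range over the type \<open>4\<close>, whose elements are \<open>1, 2, 3, 4\<close> (with \<open>4 = 0\<close>).
  In all matrices the first index is the upper one: \<open>GL_a \<mu> \<nu>\<close> stands for \<open>a\<close> with upper index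
  \<open>\<mu>\<close> and lower index \<open>\<nu>\<close>.\<close>

lemma aeval_det: "aeval f (det (\<chi> i j. A i j)) = det (\<chi> i j. aeval f (A i j))"
proof -
  have sum: "aeval f (sum g S) = (\<Sum>x\<in>S. aeval f (g x))" for g :: "'x \<Rightarrow> _" and S
    by (induction S rule: infinite_finite_induct) (simp_all add: aeval_0 aeval_add)
  have prod: "aeval f (prod g S) = (\<Prod>x\<in>S. aeval f (g x))" for g :: "'x \<Rightarrow> _" and S
    by (induction S rule: infinite_finite_induct) (simp_all add: aeval_1 aeval_mult)
  have neg: "aeval f (- p) = - aeval f p" for p
    using aeval_diff[of f 0 p] by (simp add: aeval_0)
  have sign: "aeval f (of_int (sign p)) = of_int (sign p)" for p :: "'x \<Rightarrow> 'x"
    by (simp add: sign_def aeval_1 neg)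
  show ?thesis by (simp add: det_def sum prod aeval_mult sign)
qed

lemma det_delta: "det (\<chi> i j. if i = j then (1 :: 'a::comm_ring_1) else 0) = 1"
  using det_I by (simp add: mat_def)

datatype GL_gen = GL_a 4 4 | GL_det_inv

instantiation GL_gen :: presentation
begin
definition relations_GL_gen :: "GL_gen mpoly set" where
  "relations = {det (\<chi> \<mu> \<nu>. var (GL_a \<mu> \<nu>)) * var GL_det_inv - 1}"
instance
proof
  show "1 \<notin> module.span (*) (relations :: GL_gen mpoly set)"
    by (rule relations_properI[where f = "case_GL_gen (\<lambda>\<mu> \<nu>. if \<mu> = \<nu> then 1 else 0) 1"])
       (simp add: relations_GL_gen_def aeval_diff aeval_mult aeval_det aeval_var aeval_1 det_delta)
qed
end

text \<open>The quotient of the algebra of \<open>GL_gen\<close> presented by adding relations; \<open>proj_H\<close> below is the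
  projection.\<close>

datatype H_gen = H_a 4 4 | H_det_inv

instantiation H_gen :: presentation
begin
definition relations_H_gen :: "H_gen mpoly set" where
  "relations =
    {det (\<chi> \<mu> \<nu>. var (H_a \<mu> \<nu>)) * var H_det_inv - 1,
     var (H_a 3 1), var (H_a 3 2), var (H_a 4 1), var (H_a 4 2),
     var (H_a 1 1) * var (H_a 2 2) - var (H_a 2 1) * var (H_a 1 2) - 1}"
instance
proof
  show "1 \<notin> module.span (*) (relations :: H_gen mpoly set)"
    by (rule relations_properI[where f = "case_H_gen (\<lambda>\<mu> \<nu>. if \<mu> = \<nu> then 1 else 0) 1"])
       (auto simp: relations_H_gen_def aeval_diff aeval_mult aeval_det aeval_var aeval_1 det_delta)
qed
end

datatype CM_gen = CM_x 4 4

instantiation CM_gen :: presentation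
begin
definition relations_CM_gen :: "CM_gen mpoly set" where
  "relations =
    (\<Union>\<mu> \<nu>. {var (CM_x \<mu> \<nu>) + var (CM_x \<nu> \<mu>)}) \<union>
    {var (CM_x 1 2) * var (CM_x 3 4) - var (CM_x 1 3) * var (CM_x 2 4) + var (CM_x 1 4) * var (CM_x 2 3)}"
instance
proof
  show "1 \<notin> module.span (*) (relations :: CM_gen mpoly set)"
    by (rule relations_properI[where f = "\<lambda>_. 0"])
       (auto simp: relations_CM_gen_def aeval_add aeval_diff aeval_mult aeval_var)
qed
end

abbreviation a_GL :: "4 \<Rightarrow> 4 \<Rightarrow> GL_gen presented" where "a_GL \<mu> \<nu> \<equiv> gen (GL_a \<mu> \<nu>)"
abbreviation a_H :: "4 \<Rightarrow> 4 \<Rightarrow> H_gen presented" where "a_H \<mu> \<nu> \<equiv> gen (H_a \<mu> \<nu>)"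
abbreviation x_CM :: "4 \<Rightarrow> 4 \<Rightarrow> CM_gen presented" where "x_CM \<mu> \<nu> \<equiv> gen (CM_x \<mu> \<nu>)"


section \<open>Hopf algebras, comodule algebras and cocycle twists\<close>

text \<open>Structures on the vector space given by the type; the product need not be the one of the type
  class. The antipode is not recorded, since neither the twist nor the invariants involve it.\<close>

record 'a alg =
  amult :: "'a \<Rightarrow> 'a \<Rightarrow> 'a"
  aunit :: 'a

record (overloaded) ('a::cvec) hopf = "'a alg" +
  comult :: "'a \<Rightarrow> ('a, 'a) tensor"
  counit :: "'a \<Rightarrow> complex"

text \<open>In Sweedler notation \<open>tensor_ext (\<lambda>h1 h2. E h1 h2) (comult K h)\<close> is \<open>E\<close> applied to the
  legs of the coproduct of \<open>h\<close>.\<close>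

definition comult2 :: "('a::cvec) hopf \<Rightarrow> 'a \<Rightarrow> (('a, 'a) tensor, 'a) tensor"
  where "comult2 K h = map_tensor (comult K) id (comult K h)"

definition convolution ::
  "('a::cvec) hopf \<Rightarrow> ('a \<Rightarrow> 'a \<Rightarrow> complex) \<Rightarrow> ('a \<Rightarrow> 'a \<Rightarrow> complex) \<Rightarrow> 'a \<Rightarrow> 'a \<Rightarrow> complex" where
  "convolution K F G h g =
     tensor_ext (\<lambda>h1 h2. tensor_ext (\<lambda>g1 g2. F h1 g1 * G h2 g2) (comult K g)) (comult K h)"

definition conv_inverse :: "('a::cvec) hopf \<Rightarrow> ('a \<Rightarrow> 'a \<Rightarrow> complex) \<Rightarrow> 'a \<Rightarrow> 'a \<Rightarrow> complex" where
  "conv_inverse K F = (THE G. bilin G \<and>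
     convolution K F G = (\<lambda>h g. counit K h * counit K g) \<and>
     convolution K G F = (\<lambda>h g. counit K h * counit K g))"

definition twist :: "('a::cvec) hopf \<Rightarrow> ('a \<Rightarrow> 'a \<Rightarrow> complex) \<Rightarrow> 'a hopf" where
  "twist K F = K\<lparr>amult := \<lambda>h g.
     tensor_ext (\<lambda>h12 h3. tensor_ext (\<lambda>h1 h2.
       tensor_ext (\<lambda>g12 g3. tensor_ext (\<lambda>g1 g2.
         (F h1 g1 * conv_inverse K F h3 g3) *\<^sub>C amult K h2 g2)
       g12) (comult2 K g))
     h12) (comult2 K h)\<rparr>"

definition twist_comodule_algebra ::
  "('k::cvec \<Rightarrow> 'k \<Rightarrow> complex) \<Rightarrow> ('b::cvec \<Rightarrow> ('k, 'b) tensor) \<Rightarrow> 'b alg \<Rightarrow> 'b alg" where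
  "twist_comodule_algebra F \<rho> A = A\<lparr>amult := \<lambda>a b.
     tensor_ext (\<lambda>a1 a2. tensor_ext (\<lambda>b1 b2. F a1 b1 *\<^sub>C amult A a2 b2) (\<rho> b)) (\<rho> a)\<rparr>"

text \<open>Elements of \<open>K\<close> invariant under the right coaction of the quotient \<open>\<pi> : K \<rightarrow> L\<close>. Twisting
  changes neither coalgebras nor units, so the coaction of the twisted \<open>L\<close> on the twisted \<open>K\<close> is
  the original one.\<close>

definition right_invariants :: "('k::cvec) hopf \<Rightarrow> ('l::cvec) hopf \<Rightarrow> ('k \<Rightarrow> 'l) \<Rightarrow> 'k set"
  where "right_invariants K L \<pi> = {h. map_tensor id \<pi> (comult K h) = h \<otimes> aunit L}"

definition is_subalgebra :: "('a::cvec, 'more) alg_scheme \<Rightarrow> 'a set \<Rightarrow> bool" where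
  "is_subalgebra A S \<longleftrightarrow> cvec.subspace S \<and> aunit A \<in> S \<and> (\<forall>a\<in>S. \<forall>b\<in>S. amult A a b \<in> S)"

definition isomorphic_to_subalgebra ::
  "('a::cvec, 'm) alg_scheme \<Rightarrow> ('b::cvec, 'n) alg_scheme \<Rightarrow> 'b set \<Rightarrow> bool" where
  "isomorphic_to_subalgebra A B S \<longleftrightarrow> is_subalgebra B S \<and>
     (\<exists>\<phi>. clinear \<phi> \<and> bij_betw \<phi> UNIV S \<and> \<phi> (aunit A) = aunit B \<and>
       (\<forall>a b. \<phi> (amult A a b) = amult B (\<phi> a) (\<phi> b)))"


section \<open>The Hopf algebras and the coaction\<close>

definition GL4 :: "GL_gen presented hopf" where
  "GL4 = \<lparr>amult = (*), aunit = 1,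
     comult = hom_ext (\<lambda>v. case v of
         GL_a \<mu> \<nu> \<Rightarrow> \<Sum>\<alpha>\<in>UNIV. a_GL \<mu> \<alpha> \<otimes> a_GL \<alpha> \<nu>
       | GL_det_inv \<Rightarrow> gen GL_det_inv \<otimes> gen GL_det_inv),
     counit = hom_ext (\<lambda>v. case v of GL_a \<mu> \<nu> \<Rightarrow> if \<mu> = \<nu> then 1 else 0 | GL_det_inv \<Rightarrow> 1)\<rparr>"

definition H4 :: "H_gen presented hopf" where
  "H4 = \<lparr>amult = (*), aunit = 1,
     comult = hom_ext (\<lambda>v. case v of
         H_a \<mu> \<nu> \<Rightarrow> \<Sum>\<alpha>\<in>UNIV. a_H \<mu> \<alpha> \<otimes> a_H \<alpha> \<nu>
       | H_det_inv \<Rightarrow> gen H_det_inv \<otimes> gen H_det_inv),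
     counit = hom_ext (\<lambda>v. case v of H_a \<mu> \<nu> \<Rightarrow> if \<mu> = \<nu> then 1 else 0 | H_det_inv \<Rightarrow> 1)\<rparr>"

definition proj_H :: "GL_gen presented \<Rightarrow> H_gen presented" where
  "proj_H = hom_ext (\<lambda>v. case v of GL_a \<mu> \<nu> \<Rightarrow> a_H \<mu> \<nu> | GL_det_inv \<Rightarrow> gen H_det_inv)"

definition CM :: "CM_gen presented alg"
  where "CM = \<lparr>amult = (*), aunit = 1\<rparr>"

definition coact_CM :: "CM_gen presented \<Rightarrow> (GL_gen presented, CM_gen presented) tensor" where
  "coact_CM = hom_ext (\<lambda>v. case v of
     CM_x \<mu> \<nu> \<Rightarrow> \<Sum>\<alpha>\<in>UNIV. \<Sum>\<beta>\<in>UNIV. (a_GL \<mu> \<alpha> * a_GL \<nu> \<beta>) \<otimes> x_CM \<alpha> \<beta>)"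


section \<open>The translation cocycle\<close>

text \<open>Generators \<open>t\<close> of the polynomial algebra on \<open>\<complex>\<^sup>4\<close>, indexed by \<open>(A, A')\<close>.\<close>

typedef C4_gen = "{1, 2} \<times> {3, 4} :: (4 \<times> 4) set" by auto

abbreviation t_gen :: "4 \<Rightarrow> 4 \<Rightarrow> C4_gen" where "t_gen A A' \<equiv> Abs_C4_gen (A, A')"

definition partial_deriv :: "'v \<Rightarrow> 'v mpoly \<Rightarrow> 'v mpoly" where
  "partial_deriv v = lin_ext (\<lambda>m. Poly_Mapping.single (m - Poly_Mapping.single v 1)
     (of_nat (Poly_Mapping.lookup m v)))"

definition eval_zero :: "'v mpoly \<Rightarrow> complex"
  where "eval_zero = aeval (\<lambda>_. 0)"

text \<open>\<open>\<theta> A B A' B'\<close> has upper indices \<open>A, B\<close> and lower indices \<open>A', B'\<close>.\<close>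

definition theta_op :: "(4 \<Rightarrow> 4 \<Rightarrow> 4 \<Rightarrow> 4 \<Rightarrow> complex) \<Rightarrow>
    (C4_gen mpoly, C4_gen mpoly) tensor \<Rightarrow> (C4_gen mpoly, C4_gen mpoly) tensor" where
  "theta_op \<theta> u = (\<Sum>A\<in>{1, 2}. \<Sum>B\<in>{1, 2}. \<Sum>A'\<in>{3, 4}. \<Sum>B'\<in>{3, 4}.
     (\<i> / 2 * \<theta> A B A' B') *\<^sub>C
       map_tensor (partial_deriv (t_gen A A')) (partial_deriv (t_gen B B')) u)"

text \<open>The exponential series; \<open>theta_op \<theta>\<close> is locally nilpotent, so only finitely many terms
  are nonzero. Pairing with a polynomial in the translation generators is differentiation
  followed by evaluation at zero.\<close>

definition F_C4 :: "(4 \<Rightarrow> 4 \<Rightarrow> 4 \<Rightarrow> 4 \<Rightarrow> complex) \<Rightarrow> C4_gen mpoly \<Rightarrow> C4_gen mpoly \<Rightarrow> complex" where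
  "F_C4 \<theta> h g = suminf (\<lambda>n.
     tensor_ext (\<lambda>u v. eval_zero u * eval_zero v) ((theta_op \<theta> ^^ n) (h \<otimes> g)) / fact n)"

definition translation_part :: "4 \<Rightarrow> 4 \<Rightarrow> C4_gen mpoly" where
  "translation_part \<mu> \<nu> =
     (if \<mu> \<in> {1, 2} \<and> \<nu> \<in> {3, 4} then var (t_gen \<mu> \<nu>) else if \<mu> = \<nu> then 1 else 0)"

text \<open>The inverse determinant is sent to \<open>1\<close>, as is forced by the images of the other generators.\<close>

definition F_GL :: "(4 \<Rightarrow> 4 \<Rightarrow> 4 \<Rightarrow> 4 \<Rightarrow> complex) \<Rightarrow> GL_gen presented \<Rightarrow> GL_gen presented \<Rightarrow> complex" where
  "F_GL \<theta> h g =
     (let p = hom_ext (\<lambda>v. case v of GL_a \<mu> \<nu> \<Rightarrow> translation_part \<mu> \<nu> | GL_det_inv \<Rightarrow> 1)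
      in F_C4 \<theta> (p h) (p g))"

definition F_H :: "(4 \<Rightarrow> 4 \<Rightarrow> 4 \<Rightarrow> 4 \<Rightarrow> complex) \<Rightarrow> H_gen presented \<Rightarrow> H_gen presented \<Rightarrow> complex" where
  "F_H \<theta> h g =
     (let p = hom_ext (\<lambda>v. case v of H_a \<mu> \<nu> \<Rightarrow> translation_part \<mu> \<nu> | H_det_inv \<Rightarrow> 1)
      in F_C4 \<theta> (p h) (p g))"

definition GL4_F :: "(4 \<Rightarrow> 4 \<Rightarrow> 4 \<Rightarrow> 4 \<Rightarrow> complex) \<Rightarrow> GL_gen presented hopf"
  where "GL4_F \<theta> = twist GL4 (F_GL \<theta>)"

definition H4_F :: "(4 \<Rightarrow> 4 \<Rightarrow> 4 \<Rightarrow> 4 \<Rightarrow> complex) \<Rightarrow> H_gen presented hopf"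
  where "H4_F \<theta> = twist H4 (F_H \<theta>)"

definition CM_F :: "(4 \<Rightarrow> 4 \<Rightarrow> 4 \<Rightarrow> 4 \<Rightarrow> complex) \<Rightarrow> CM_gen presented alg"
  where "CM_F \<theta> = twist_comodule_algebra (F_GL \<theta>) coact_CM CM"

end

theory Submission
  imports Defs "HOL-Computational_Algebra.Polynomial"
begin

text \<open>The isomorphism sends \<open>x\<^sup>\<mu>\<^sup>\<nu>\<close> to the minor \<open>a\<^sup>\<mu>\<^sub>1 a\<^sup>\<nu>\<^sub>2 - a\<^sup>\<mu>\<^sub>2 a\<^sup>\<nu>\<^sub>1\<close>. It is injective because \<open>x12\<close> is not a zero
  divisor modulo the quadric and the five coordinates other than \<open>x34\<close> are free where \<open>x12\<close> is invertible.
  An invariant \<open>f\<close> is constant on cosets of the block triangular matrices, and where \<open>x12 \<noteq> 0\<close> each coset has a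
  representative that is rational in the minors, with powers of \<open>x12\<close> as denominators; so \<open>x12\<^sup>n f\<close> is a polynomial
  in the minors, and likewise \<open>x34\<^sup>m f\<close>. As \<open>x12, x34\<close> is a regular sequence, \<open>f\<close> itself is one.

  The cocycle on \<open>\<complex>\<^sup>4\<close> satisfies \<open>F (t\<^sub>k p, q) = F (p, D\<^sub>k q)\<close> for a constant coefficient vector field \<open>D\<^sub>k\<close>. This
  recursion makes it a bicharacter, whose convolution inverse comes from the antipode \<open>t \<mapsto> - t\<close>, and yields the
  deformed product of the generators. On invariants the third legs of the coproducts project to \<open>1\<close>, so \<open>F\<^sup>-\<^sup>1\<close>
  drops out of the twisted product, which becomes the twisted product of the comodule algebra.\<close>

text \<open>Left as a simplification rule, \<open>a * (b * x) = (a * b) * x\<close> loops against \<open>mult.assoc\<close>.\<close>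

declare ring_ideal.scale_scale [simp del]

section \<open>Algebra homomorphisms and tensors\<close>

text \<open>The map \<open>minors\<close> does not depend on \<theta>: the isomorphism is the
  undeformed one, and the deformation enters only when the two twisted products are compared. The
  minors themselves, and not only their ratios, are invariant because the upper left block of H has
  determinant one. Two charts are used because dividing by x12 alone could leave a pole along x12 =
  0; x34 controls that pole, since x12 and x34 vanish together only in codimension two. Two features
  of the definitions fix the order of work. \<open>hom_ext\<close> and \<open>tensor_ext\<close>
  compute on representatives, so they acquire their meaning only after a check of the relations or
  of bilinearity. For the coaction this check says that the quadric is preserved, which is drawn
  from the injectivity of \<open>minors\<close>; hence the geometry of the cone comes before the
  coaction. And \<open>conv_inverse\<close> is a definite description: an inverse must also be shown
  to be unique, which rests on the coassociativity and counit laws of \<open>GL4\<close>. Identities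
  between functions on GL4 are tested at complex matrices off a hypersurface, after a power of the
  determinant has been cleared.\<close>

definition calg_hom :: "('a::calg \<Rightarrow> 'b::calg) \<Rightarrow> bool"
  where "calg_hom f \<longleftrightarrow> clinear f \<and> f 1 = 1 \<and> (\<forall>x y. f (x * y) = f x * f y)"

lemma calg_homI:
  assumes "\<And>x y. f (x + y) = f x + f y" "\<And>c x. f (c *\<^sub>C x) = c *\<^sub>C f x"
    and "f 1 = 1" "\<And>x y. f (x * y) = f x * f y"
  shows "calg_hom f"
  using assms by (simp add: calg_hom_def clinearI)

lemma calg_hom_clinear: "calg_hom f \<Longrightarrow> clinear f"
  by (simp add: calg_hom_def)

lemma clinear_0: "clinear f \<Longrightarrow> f 0 = 0"
  using clinearD(2)[of f 0 0] by simp

lemma clinear_uminus: "clinear f \<Longrightarrow> f (- x) = - f x"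
  using clinearD(2)[of f "-1" x] by (simp add: cvec.scale_minus_left scaleC_one)

lemma clinear_diff: "clinear f \<Longrightarrow> f (x - y) = f x - f y"
  using clinearD(1)[of f x "- y"] by (simp add: clinear_uminus)

lemma clinear_sum: "clinear f \<Longrightarrow> f (sum g S) = (\<Sum>x\<in>S. f (g x))"
  by (induction S rule: infinite_finite_induct) (simp_all add: clinear_0 clinearD)

lemma calg_homD:
  assumes "calg_hom f"
  shows "f 1 = 1" "f (x * y) = f x * f y" "f (x + y) = f x + f y" "f (c *\<^sub>C x) = c *\<^sub>C f x"
    "f 0 = 0" "f (- x) = - f x" "f (x - y) = f x - f y"
  using assms by (simp_all add: calg_hom_def clinearD clinear_0 clinear_uminus clinear_diff)

lemma calg_hom_sum: "calg_hom f \<Longrightarrow> f (sum g S) = (\<Sum>x\<in>S. f (g x))"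
  by (rule clinear_sum[OF calg_hom_clinear])

lemma calg_hom_prod: "calg_hom f \<Longrightarrow> f (prod g S) = (\<Prod>x\<in>S. f (g x))"
  by (induction S rule: infinite_finite_induct) (simp_all add: calg_homD)

lemma calg_hom_power: "calg_hom f \<Longrightarrow> f (x ^ n) = f x ^ n"
  by (induction n) (simp_all add: calg_homD)

lemma calg_hom_det:
  assumes "calg_hom f"
  shows "f (det A) = det (\<chi> i j. f (A $ i $ j))"
proof -
  have sign: "f (of_int (sign p)) = of_int (sign p)" for p :: "'x \<Rightarrow> 'x"
    by (simp add: sign_def calg_homD[OF assms])
  show ?thesis
    by (simp add: det_def sign calg_hom_sum[OF assms] calg_hom_prod[OF assms] calg_homD[OF assms])
qed

lemma calg_hom_comp: "calg_hom f \<Longrightarrow> calg_hom g \<Longrightarrow> calg_hom (\<lambda>x. f (g x))"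
  by (rule calg_homI) (simp_all add: calg_homD)

lemma calg_hom_id: "calg_hom id"
  by (rule calg_homI) simp_all

lemma calg_hom_aeval: "calg_hom (aeval f)"
  by (rule calg_homI) (simp_all add: aeval_add aeval_scaleC aeval_1 aeval_mult)

lemma calg_hom_hom_ext:
  assumes "\<And>r. r \<in> relations \<Longrightarrow> aeval f r = 0"
  shows "calg_hom (hom_ext f)"
  by (rule calg_homI) (simp_all add: hom_ext_simps[of f, OF assms])

lemma mpoly_induct [case_names var one scale add mult]:
  assumes var: "\<And>v. P (var v)" and one: "P 1" and scale: "\<And>c p. P p \<Longrightarrow> P (c *\<^sub>C p)"
    and add: "\<And>p q. P p \<Longrightarrow> P q \<Longrightarrow> P (p + q)" and mult: "\<And>p q. P p \<Longrightarrow> P q \<Longrightarrow> P (p * q)"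
  shows "P (p :: 'v mpoly)"
proof (induction p rule: poly_mapping_add_induct)
  case 1
  then show ?case using scale[OF one, of 0] by simp
next
  case (2 m c)
  have "P (Poly_Mapping.single (Poly_Mapping.single v n) 1)" for v n
  proof (induction n)
    case 0
    then show ?case using one by simp
  next
    case (Suc n)
    have "Poly_Mapping.single (Poly_Mapping.single v (Suc n)) (1::complex) =
        var v * Poly_Mapping.single (Poly_Mapping.single v n) 1"
      by (simp add: var_def mult_single single_add[symmetric])
    then show ?case using mult[OF var Suc.IH] by simp
  qed
  then have "P (Poly_Mapping.single m 1)"
  proof (induction m rule: poly_mapping_add_induct)
    case 1
    then show ?case using one by simp
  next
    case (3 m n)
    then show ?case
      using mult[of "Poly_Mapping.single m 1" "Poly_Mapping.single n 1"] by (simp add: mult_single)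
  qed
  from scale[OF this, of c] show ?case by (simp add: scaleC_single)
qed (rule add)

text \<open>Allows arguments on generators without a choice of representative. Equality of
  homomorphisms and every clearing of denominators below run through it.\<close>

lemma presented_induct [case_names gen one scale add mult]:
  assumes "\<And>v. P (gen v)" "P 1" "\<And>c p. P p \<Longrightarrow> P (c *\<^sub>C p)"
    and "\<And>p q. P p \<Longrightarrow> P q \<Longrightarrow> P (p + q)" "\<And>p q. P p \<Longrightarrow> P q \<Longrightarrow> P (p * q)"
  shows "P (x :: 'v::presentation presented)"
proof (induction x)
  fix p :: "'v mpoly"
  show "P (abs_presented p)"
    by (induction p rule: mpoly_induct)
      (simp_all add: assms gen.abs_eq[symmetric] one_presented.abs_eq[symmetric]
        scaleC_presented.abs_eq[symmetric] plus_presented.abs_eq[symmetric]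
        times_presented.abs_eq[symmetric])
qed

lemma calg_hom_mpoly_eqI:
  assumes "calg_hom f" "calg_hom g" "\<And>v. f (var v) = g (var v)"
  shows "f (p :: 'v mpoly) = g p"
  by (induction p rule: mpoly_induct) (simp_all add: assms calg_homD[OF assms(1)] calg_homD[OF assms(2)])

lemma calg_hom_presented_eqI:
  assumes "calg_hom f" "calg_hom g" "\<And>v. f (gen v) = g (gen v)"
  shows "f (x :: 'v::presentation presented) = g x"
  by (induction x rule: presented_induct)
    (simp_all add: assms calg_homD[OF assms(1)] calg_homD[OF assms(2)])

lemma calg_hom_o_aeval: "calg_hom g \<Longrightarrow> g (aeval f p) = aeval (\<lambda>v. g (f v)) p"
  by (rule calg_hom_mpoly_eqI) (simp_all add: calg_hom_comp calg_hom_aeval aeval_var)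

lemma calg_hom_abs_presented: "calg_hom (abs_presented :: 'v::presentation mpoly \<Rightarrow> _)"
  by (rule calg_homI)
    (simp_all add: one_presented.abs_eq scaleC_presented.abs_eq plus_presented.abs_eq times_presented.abs_eq)

lemma abs_presented_eq_aeval: "abs_presented p = aeval gen p"
  by (rule calg_hom_mpoly_eqI)
    (simp_all add: calg_hom_abs_presented calg_hom_aeval aeval_var gen.abs_eq)

lemma aeval_gen_relation: "r \<in> relations \<Longrightarrow> aeval gen (r :: 'v::presentation mpoly) = 0"
  by (simp add: abs_presented_eq_aeval[symmetric] zero_presented.abs_eq presented.abs_eq_iff
      presented_eq_def ring_ideal.span_base)

lemma bilin_tens_maps: "clinear f \<Longrightarrow> clinear g \<Longrightarrow> bilin (\<lambda>a b. f a \<otimes> g b)"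
  by (rule bilinI) (simp_all add: clinearD bilinD[OF bilin_tens])

lemma map_tensor_tens: "clinear f \<Longrightarrow> clinear g \<Longrightarrow> map_tensor f g (a \<otimes> b) = f a \<otimes> g b"
  by (simp add: map_tensor_def tensor_ext_tens bilin_tens_maps)

lemma clinear_map_tensor: "clinear f \<Longrightarrow> clinear g \<Longrightarrow> clinear (map_tensor f g)"
  by (simp add: map_tensor_def clinear_tensor_ext bilin_tens_maps)

lemma clinear_tensor_eqI:
  assumes "clinear f" "clinear g" "\<And>a b. f (a \<otimes> b) = g (a \<otimes> b)"
  shows "f t = g t"
  by (induction t rule: tensor_induct) (simp_all add: assms clinear_0 clinearD)

lemma clinear_comp: "clinear f \<Longrightarrow> clinear g \<Longrightarrow> clinear (\<lambda>x. f (g x))"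
  by (rule clinearI) (simp_all add: clinearD)

lemma clinear_id: "clinear id"
  by (rule clinearI) simp_all

text \<open>Pure tensors span and the product is bilinear, so multiplicativity need only be seen on
  pure tensors.\<close>

lemma tensor_calg_homI:
  assumes f: "clinear f" and one: "f (1 \<otimes> 1) = 1"
    and mult: "\<And>a b c d. f ((a * c) \<otimes> (b * d)) = f (a \<otimes> b) * f (c \<otimes> d)"
  shows "calg_hom (f :: ('a::calg, 'b::calg) tensor \<Rightarrow> 'c::calg)"
proof (rule calg_homI)
  fix x y
  show "f (x * y) = f x * f y"
  proof (induction x rule: tensor_induct)
    case (tens a b)
    show ?case
      by (induction y rule: tensor_induct)
        (simp_all add: tensor_mult_tens mult clinear_0[OF f] clinearD[OF f] distrib_left)
  qed (simp_all add: clinear_0[OF f] clinearD[OF f] distrib_right)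
qed (simp_all add: one clinearD[OF f] one_tensor_def)

lemma calg_hom_map_tensor: "calg_hom f \<Longrightarrow> calg_hom g \<Longrightarrow> calg_hom (map_tensor f g)"
  by (rule tensor_calg_homI)
    (simp_all add: clinear_map_tensor calg_hom_clinear map_tensor_tens calg_homD tensor_mult_tens
      one_tensor_def)

lemma calg_hom_tens_1: "calg_hom (\<lambda>x. x \<otimes> 1)" "calg_hom (\<lambda>x. 1 \<otimes> x)"
  by (rule calg_homI; simp add: bilinD[OF bilin_tens] tensor_mult_tens one_tensor_def)+

text \<open>By definition \<open>tensor_ext\<close> is a finite sum over one fixed representative of
  the tensor, so this is an exchange of finite sums, for arbitrary \<open>T\<close>.\<close>

lemma tensor_ext_fubini:
  fixes T :: "'a::cvec \<Rightarrow> 'b::cvec \<Rightarrow> 'c::cvec \<Rightarrow> 'd::cvec \<Rightarrow> 'e::cvec"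
  shows "tensor_ext (\<lambda>a b. tensor_ext (\<lambda>c d. T a b c d) u) t =
   tensor_ext (\<lambda>c d. tensor_ext (\<lambda>a b. T a b c d) t) u"
proof -
  have "lin_ext (\<lambda>k. lin_ext (\<lambda>l. S k l) f) g = lin_ext (\<lambda>l. lin_ext (\<lambda>k. S k l) g) f"
    for S :: "'x \<Rightarrow> 'y \<Rightarrow> 'e" and f g
    by (subst (1 2) lin_ext_def, simp add: lin_ext_def cvec.scale_sum_right)
      (subst sum.swap, simp add: scaleC_scaleC mult.commute)
  from this[of "\<lambda>(a, b) (c, d). T a b c d"] show ?thesis
    unfolding tensor_ext_def by (simp add: split_def)
qed

lemma clinear_tensor_ext_fun:
  assumes "\<And>a b. clinear (\<lambda>x. B x a b)"
  shows "clinear (\<lambda>x. tensor_ext (B x) t)"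
proof (rule clinearI)
  have "B (x + y) = (\<lambda>a b. B x a b + B y a b)" "B (c *\<^sub>C x) = (\<lambda>a b. c *\<^sub>C B x a b)" for x y c
    by (simp_all add: fun_eq_iff clinearD[OF assms])
  then show "tensor_ext (B (x + y)) t = tensor_ext (B x) t + tensor_ext (B y) t"
    "tensor_ext (B (c *\<^sub>C x)) t = c *\<^sub>C tensor_ext (B x) t" for x y c
    by (simp_all add: tensor_ext_add_fun tensor_ext_scale_fun)
qed

lemma clinear_o_tensor_ext:
  assumes "clinear f"
  shows "f (tensor_ext B t) = tensor_ext (\<lambda>a b. f (B a b)) t"
  by (simp add: tensor_ext_def lin_ext_def clinear_sum[OF assms] clinearD[OF assms] split_def)

lemma tensor_ext_map_tensor:
  assumes "bilin B" "clinear f" "clinear g"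
  shows "tensor_ext B (map_tensor f g t) = tensor_ext (\<lambda>a b. B (f a) (g b)) t"
  by (simp add: map_tensor_def clinear_o_tensor_ext[OF clinear_tensor_ext] assms tensor_ext_tens)

text \<open>The Leibniz formula, with the permuted indices peeled off one at a time. It serves the
  concrete matrices \<open>chart\<close> and \<open>translation_part\<close>.\<close>

lemma det_4:
  "det (A::'a::comm_ring_1^4^4) =
    A$1$1*A$2$2*A$3$3*A$4$4 - A$1$1*A$2$2*A$3$4*A$4$3
  - A$1$1*A$2$3*A$3$2*A$4$4 + A$1$1*A$2$3*A$3$4*A$4$2
  + A$1$1*A$2$4*A$3$2*A$4$3 - A$1$1*A$2$4*A$3$3*A$4$2
  - A$1$2*A$2$1*A$3$3*A$4$4 + A$1$2*A$2$1*A$3$4*A$4$3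
  + A$1$2*A$2$3*A$3$1*A$4$4 - A$1$2*A$2$3*A$3$4*A$4$1
  - A$1$2*A$2$4*A$3$1*A$4$3 + A$1$2*A$2$4*A$3$3*A$4$1
  + A$1$3*A$2$1*A$3$2*A$4$4 - A$1$3*A$2$1*A$3$4*A$4$2
  - A$1$3*A$2$2*A$3$1*A$4$4 + A$1$3*A$2$2*A$3$4*A$4$1
  + A$1$3*A$2$4*A$3$1*A$4$2 - A$1$3*A$2$4*A$3$2*A$4$1
  - A$1$4*A$2$1*A$3$2*A$4$3 + A$1$4*A$2$1*A$3$3*A$4$2
  + A$1$4*A$2$2*A$3$1*A$4$3 - A$1$4*A$2$2*A$3$3*A$4$1
  - A$1$4*A$2$3*A$3$1*A$4$2 + A$1$4*A$2$3*A$3$2*A$4$1"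
proof -
  have f1: "finite {2::4, 3, 4}" "1 \<notin> {2::4, 3, 4}" by auto
  have f2: "finite {3::4, 4}" "2 \<notin> {3::4, 4}" by auto
  have f3: "finite {4::4}" "3 \<notin> {4::4}" by auto
  show ?thesis
    unfolding det_def UNIV_4
    unfolding sum_over_permutations_insert[OF f1]
    unfolding sum_over_permutations_insert[OF f2]
    unfolding sum_over_permutations_insert[OF f3]
    unfolding permutes_sing
    by (simp add: sign_swap_id permutation_swap_id permutation_compose sign_compose sign_id swap_id_eq)
qed


section \<open>Polynomials as functions\<close>

text \<open>Monomials are pairwise distinct multiplicative characters, hence linearly independent.\<close>

lemma monomials_independent:
  fixes c :: "('v \<Rightarrow>\<^sub>0 nat) \<Rightarrow> complex"
  defines "ev \<equiv> \<lambda>m (x :: 'v \<Rightarrow> complex). \<Prod>v\<in>Poly_Mapping.keys m. x v ^ Poly_Mapping.lookup m v"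
  assumes "finite S" "\<And>x. (\<Sum>m\<in>S. c m * ev m x) = 0" "m \<in> S"
  shows "c m = 0"
  using assms(2-)
proof (induction S arbitrary: c m rule: finite_induct)
  case empty
  then show ?case by simp
next
  case (insert n S c m)
  have ev_mult: "ev m (\<lambda>v. x v * y v) = ev m x * ev m y" for m x y
    by (simp add: ev_def power_mult_distrib prod.distrib)
  have ev_1: "ev m (\<lambda>_. 1) = 1" for m
    by (simp add: ev_def)
  \<comment> \<open>At a point with value 2 in one coordinate and 1 elsewhere, a monomial takes the
    value 2 to the power of its exponent, which tells different exponents apart.\<close>
  have separate: "\<exists>y. ev m y \<noteq> ev n y" if "m \<noteq> n" for m n
  proof -
    from that obtain v where v: "Poly_Mapping.lookup m v \<noteq> Poly_Mapping.lookup n v"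
      by (metis poly_mapping_eqI)
    have "ev m ((\<lambda>_. 1)(v := 2)) = 2 ^ Poly_Mapping.lookup m v" for m
    proof -
      have "ev m ((\<lambda>_. 1)(v := 2)) = (\<Prod>w\<in>Poly_Mapping.keys m. if w = v then 2 ^ Poly_Mapping.lookup m v else 1)"
        unfolding ev_def by (rule prod.cong) auto
      also have "\<dots> = 2 ^ Poly_Mapping.lookup m v"
        by (simp add: prod.delta' in_keys_iff)
      finally show ?thesis .
    qed
    moreover have "(2::complex) ^ a = 2 ^ b \<longleftrightarrow> a = b" for a b
    proof -
      have "(2::complex) ^ a = of_nat (2 ^ a)" for a by simp
      then have "(2::complex) ^ a = 2 ^ b \<longleftrightarrow> (2::nat) ^ a = 2 ^ b"
        by (metis of_nat_eq_iff)
      then show ?thesis by simp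
    qed
    ultimately show ?thesis using v by metis
  qed
  \<comment> \<open>Artin's argument: the relation at the pointwise product of \<open>x\<close> and
    \<open>y\<close> minus \<open>ev n y\<close> times the relation at \<open>x\<close> loses its
    \<open>n\<close>-term. Choosing \<open>y\<close> to separate \<open>k\<close> from
    \<open>n\<close> keeps the factor in front of \<open>c k\<close> nonzero.\<close>
  have S: "c k = 0" if "k \<in> S" for k
  proof -
    from that insert.hyps obtain y where y: "ev k y \<noteq> ev n y"
      using separate[of k n] by auto
    have "(\<Sum>m\<in>S. (c m * (ev m y - ev n y)) * ev m x) = 0" for x
    proof -
      have "(\<Sum>m\<in>S. (c m * (ev m y - ev n y)) * ev m x) =
          (\<Sum>m\<in>insert n S. (c m * (ev m y - ev n y)) * ev m x)"
        using insert.hyps by simp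
      also have "\<dots> = (\<Sum>m\<in>insert n S. c m * ev m (\<lambda>v. x v * y v) - ev n y * (c m * ev m x))"
        by (rule sum.cong[OF refl]) (simp only: ev_mult left_diff_distrib right_diff_distrib mult_ac)
      also have "\<dots> = (\<Sum>m\<in>insert n S. c m * ev m (\<lambda>v. x v * y v)) -
          ev n y * (\<Sum>m\<in>insert n S. c m * ev m x)"
        by (simp only: sum_subtractf sum_distrib_left)
      also have "\<dots> = 0"
        by (simp only: insert.prems mult_zero_right diff_zero)
      finally show ?thesis .
    qed
    from insert.IH[OF this that] y show ?thesis by simp
  qed
  have "c n = 0"
    using insert.prems(1)[of "\<lambda>_. 1"] insert.hyps S by (simp add: ev_1)
  with S insert.prems(2) show ?case by auto
qed

lemma mpoly_eq_0_if_aeval_0: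
  assumes "\<And>x :: 'v \<Rightarrow> complex. aeval x p = 0"
  shows "p = 0"
proof (rule poly_mapping_eqI)
  fix m
  show "Poly_Mapping.lookup p m = Poly_Mapping.lookup 0 m"
  proof (cases "m \<in> Poly_Mapping.keys p")
    case True
    have "Poly_Mapping.lookup p m = 0"
      by (rule monomials_independent[OF finite_keys _ True])
        (use assms in \<open>simp add: aeval_def lin_ext_def scaleC_complex_def\<close>)
    then show ?thesis by simp
  qed (simp add: in_keys_iff)
qed

text \<open>Restriction to a line leads to univariate polynomials, which form an integral domain and
  are determined by their values.\<close>

lemma aeval_on_line:
  "\<exists>P :: complex poly. \<forall>\<tau>. poly P \<tau> = aeval (\<lambda>v. x v + \<tau> * y v) p"
proof (induction p rule: mpoly_induct)
  case (var v)
  show ?case by (rule exI[of _ "[:x v, y v:]"]) (simp add: aeval_var)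
next
  case one
  show ?case by (rule exI[of _ 1]) (simp add: aeval_1)
next
  case (scale c p)
  then obtain P :: "complex poly" where "\<forall>\<tau>. poly P \<tau> = aeval (\<lambda>v. x v + \<tau> * y v) p" by blast
  then show ?case by (intro exI[of _ "smult c P"]) (simp add: aeval_scaleC scaleC_complex_def)
next
  case (add p q)
  then obtain P Q :: "complex poly" where "\<forall>\<tau>. poly P \<tau> = aeval (\<lambda>v. x v + \<tau> * y v) p"
    "\<forall>\<tau>. poly Q \<tau> = aeval (\<lambda>v. x v + \<tau> * y v) q" by blast
  then show ?case by (intro exI[of _ "P + Q"]) (simp add: aeval_add)
next
  case (mult p q)
  then obtain P Q :: "complex poly" where "\<forall>\<tau>. poly P \<tau> = aeval (\<lambda>v. x v + \<tau> * y v) p"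
    "\<forall>\<tau>. poly Q \<tau> = aeval (\<lambda>v. x v + \<tau> * y v) q" by blast
  then show ?case by (intro exI[of _ "P * Q"]) (simp add: aeval_mult)
qed

text \<open>Two polynomials are nonzero at some point each; restrict them to the line through these points.\<close>

lemma mpoly_mult_eq_0:
  assumes "p * q = (0 :: 'v mpoly)"
  shows "p = 0 \<or> q = 0"
proof (rule ccontr)
  assume "\<not> ?thesis"
  then obtain x y :: "'v \<Rightarrow> complex" where xy: "aeval x p \<noteq> 0" "aeval y q \<noteq> 0"
    using mpoly_eq_0_if_aeval_0[of p] mpoly_eq_0_if_aeval_0[of q] by blast
  obtain P where P: "\<And>\<tau>. poly P \<tau> = aeval (\<lambda>v. x v + \<tau> * (y v - x v)) p"
    using aeval_on_line[of x "\<lambda>v. y v - x v" p] by blast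
  obtain Q where Q: "\<And>\<tau>. poly Q \<tau> = aeval (\<lambda>v. x v + \<tau> * (y v - x v)) q"
    using aeval_on_line[of x "\<lambda>v. y v - x v" q] by blast
  have "poly (P * Q) \<tau> = 0" for \<tau>
    using arg_cong[OF assms, of "aeval (\<lambda>v. x v + \<tau> * (y v - x v))"]
    by (simp add: P Q aeval_mult aeval_0)
  then have "P * Q = 0" using poly_all_0_iff_0 by blast
  then have "P = 0 \<or> Q = 0" by simp
  moreover have "poly P 0 \<noteq> 0" "poly Q 1 \<noteq> 0" using xy by (simp_all add: P Q)
  ultimately show False by auto
qed

text \<open>Density of a nonempty principal open set: \<open>r * p\<close> vanishes everywhere, and
  there are no zero divisors. The point \<open>y\<close> certifies that \<open>r\<close> is
  nonzero.\<close>

lemma mpoly_eq_0_if_aeval_0_off: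
  assumes "aeval (y :: 'v \<Rightarrow> complex) r \<noteq> 0"
    and "\<And>x :: 'v \<Rightarrow> complex. aeval x r \<noteq> 0 \<Longrightarrow> aeval x p = 0"
  shows "p = 0"
proof -
  have "r * p = 0"
    by (rule mpoly_eq_0_if_aeval_0) (use assms(2) in \<open>auto simp: aeval_mult\<close>)
  moreover have "r \<noteq> 0" using assms(1) by (auto simp: aeval_0)
  ultimately show ?thesis using mpoly_mult_eq_0 by blast
qed

text \<open>The endomorphism \<open>aeval (var(v := 0))\<close> substitutes zero for
  \<open>v\<close>, so divisibility by \<open>var v\<close> can be tested by this
  substitution.\<close>

lemma mpoly_split_var: "\<exists>k. p - aeval (var(v := 0)) p = var v * k"
proof (induction p rule: mpoly_induct)
  case (var w)
  have "var w - aeval (var(v := 0)) (var w) = var v * (if w = v then 1 else 0)"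
    by (simp add: aeval_var)
  then show ?case by blast
next
  case one
  have "1 - aeval (var(v := 0)) 1 = var v * 0" by (simp add: aeval_1)
  then show ?case by blast
next
  case (scale c p)
  then obtain k where k: "p - aeval (var(v := 0)) p = var v * k" by blast
  have "c *\<^sub>C p - aeval (var(v := 0)) (c *\<^sub>C p) = var v * (c *\<^sub>C k)"
    by (simp add: aeval_scaleC scaleC_mult_right k[symmetric] cvec.scale_right_diff_distrib)
  then show ?case by blast
next
  case (add p q)
  then obtain k l where k: "p - aeval (var(v := 0)) p = var v * k"
    and l: "q - aeval (var(v := 0)) q = var v * l"
    by blast
  have "p + q - aeval (var(v := 0)) (p + q) = var v * (k + l)"
    by (simp add: aeval_add distrib_left k[symmetric] l[symmetric])
  then show ?case by blast
next
  case (mult p q)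
  then obtain k l where k: "p - aeval (var(v := 0)) p = var v * k"
    and l: "q - aeval (var(v := 0)) q = var v * l"
    by blast
  have "p * q - aeval (var(v := 0)) (p * q) =
      (p - aeval (var(v := 0)) p) * q + aeval (var(v := 0)) p * (q - aeval (var(v := 0)) q)"
    by (simp add: aeval_mult algebra_simps)
  also have "\<dots> = var v * (k * q + aeval (var(v := 0)) p * l)"
    unfolding k l by (simp only: distrib_left mult.assoc mult.left_commute)
  finally show ?case by blast
qed


section \<open>The cone over the Grassmannian\<close>

lemma x_CM_antisym: "x_CM \<nu> \<mu> = - x_CM \<mu> \<nu>"
proof -
  have "var (CM_x \<mu> \<nu>) + var (CM_x \<nu> \<mu>) \<in> relations"
    by (auto simp: relations_CM_gen_def)
  from aeval_gen_relation[OF this] show ?thesis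
    by (simp add: aeval_add aeval_var eq_neg_iff_add_eq_0 add.commute)
qed

lemma x_CM_diag: "x_CM \<mu> \<mu> = 0"
proof -
  have "2 *\<^sub>C x_CM \<mu> \<mu> = (1 + 1) *\<^sub>C x_CM \<mu> \<mu>" by simp
  also have "\<dots> = 0"
    using x_CM_antisym[of \<mu> \<mu>] by (simp only: scaleC_add_left scaleC_one eq_neg_iff_add_eq_0)
  finally show ?thesis by (simp only: cvec.scale_eq_0_iff) simp
qed

lemma x_CM_quadric: "x_CM 1 2 * x_CM 3 4 = x_CM 1 3 * x_CM 2 4 - x_CM 1 4 * x_CM 2 3"
proof -
  have "var (CM_x 1 2) * var (CM_x 3 4) - var (CM_x 1 3) * var (CM_x 2 4) + var (CM_x 1 4) * var (CM_x 2 3) \<in> relations"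
    by (auto simp: relations_CM_gen_def)
  from aeval_gen_relation[OF this] show ?thesis
    by (simp add: aeval_add aeval_diff aeval_mult aeval_var algebra_simps eq_diff_eq)
qed

definition quadric :: "CM_gen mpoly" where
  "quadric = var (CM_x 1 2) * var (CM_x 3 4) - var (CM_x 1 3) * var (CM_x 2 4) + var (CM_x 1 4) * var (CM_x 2 3)"

lemma abs_presented_quadric: "abs_presented quadric = 0"
  using x_CM_quadric
  by (simp add: quadric_def calg_homD[OF calg_hom_abs_presented] gen.abs_eq[symmetric])

section \<open>Normal forms modulo antisymmetry, and the regular sequence\<close>

definition increasing_pairs :: "(4 \<times> 4) set"
  where "increasing_pairs = {(1, 2), (1, 3), (1, 4), (2, 3), (2, 4), (3, 4)}"

definition nf :: "CM_gen \<Rightarrow> CM_gen mpoly" where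
  "nf v = (case v of CM_x \<mu> \<nu> \<Rightarrow>
     if (\<mu>, \<nu>) \<in> increasing_pairs then var (CM_x \<mu> \<nu>)
     else if (\<nu>, \<mu>) \<in> increasing_pairs then - var (CM_x \<nu> \<mu>) else 0)"

lemma abs_presented_nf: "abs_presented (aeval nf p) = abs_presented p"
proof -
  have diag: "\<mu> = \<nu>" if "(\<mu>, \<nu>) \<notin> increasing_pairs" "(\<nu>, \<mu>) \<notin> increasing_pairs" for \<mu> \<nu>
    using exhaust_4[of \<mu>] exhaust_4[of \<nu>] that by (auto simp: increasing_pairs_def)
  have "abs_presented (nf v) = gen v" for v
  proof (cases v)
    case (CM_x \<mu> \<nu>)
    then show ?thesis
      using diag[of \<mu> \<nu>] x_CM_antisym[of \<mu> \<nu>] x_CM_diag[of \<mu>]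
      by (auto simp: nf_def gen.abs_eq[symmetric] calg_homD[OF calg_hom_abs_presented])
  qed
  then show ?thesis
    by (simp add: calg_hom_o_aeval[OF calg_hom_abs_presented] abs_presented_eq_aeval[of p])
qed

text \<open>The substitution \<open>nf\<close> sends the antisymmetry relators to zero and fixes
  \<open>quadric\<close>, so it carries the ideal of relations into a principal ideal of a
  polynomial ring. Questions about the cone become questions about multiples of one
  polynomial.\<close>

lemma nf_zero:
  assumes "abs_presented p = (0 :: CM_gen presented)"
  shows "\<exists>h. aeval nf p = quadric * h"
proof -
  have rel: "\<exists>h. aeval nf r = quadric * h" if r: "r \<in> relations" for r
  proof -
    have anti: "nf (CM_x \<mu> \<nu>) + nf (CM_x \<nu> \<mu>) = 0" for \<mu> \<nu>
      using exhaust_4[of \<mu>] exhaust_4[of \<nu>] by (auto simp: nf_def increasing_pairs_def)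
    from r consider \<mu> \<nu> where "r = var (CM_x \<mu> \<nu>) + var (CM_x \<nu> \<mu>)" | "r = quadric"
      by (auto simp: relations_CM_gen_def quadric_def)
    then show ?thesis
    proof cases
      case 1
      then have "aeval nf r = quadric * 0" by (simp add: aeval_add aeval_var anti)
      then show ?thesis by blast
    next
      case 2
      then have "aeval nf r = quadric * 1"
        by (simp add: quadric_def aeval_add aeval_diff aeval_mult aeval_var)
          (simp add: nf_def increasing_pairs_def)
      then show ?thesis by blast
    qed
  qed
  have "p \<in> module.span (*) relations"
    using assms by (simp add: zero_presented.abs_eq presented.abs_eq_iff presented_eq_def)
  then show ?thesis
  proof (induction rule: ring_ideal.span_induct_alt)
    case base
    have "aeval nf 0 = quadric * 0" by (simp add: aeval_0)
    then show ?case by blast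
  next
    case (step c x y)
    then obtain h k where "aeval nf x = quadric * h" "aeval nf y = quadric * k"
      using rel by blast
    then have "aeval nf (c * x + y) = quadric * (aeval nf c * h + k)"
      by (simp only: aeval_add aeval_mult distrib_left mult.left_commute)
    then show ?case by blast
  qed
qed

lemma var_mult_cancel: "var v * p = var v * q \<Longrightarrow> p = q"
proof -
  assume "var v * p = var v * q"
  then have "var v * (p - q) = 0" by (simp add: right_diff_distrib)
  moreover have "var v \<noteq> 0"
    using aeval_var[of "\<lambda>_. 1::complex" v] by (metis aeval_0 zero_neq_one)
  ultimately show ?thesis using mpoly_mult_eq_0[of "var v" "p - q"] by auto
qed

text \<open>What remains of the quadric at x12 = 0 is nonzero and free of x34. Both halves of the
  regular sequence argument rest on these two facts.\<close>

lemma quadric_at_s_0: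
  "aeval (var(CM_x 1 2 := 0)) quadric = quadric - var (CM_x 1 2) * var (CM_x 3 4)"
  "aeval (var(CM_x 1 2 := 0)) quadric \<noteq> 0"
proof -
  show eq: "aeval (var(CM_x 1 2 := 0)) quadric = quadric - var (CM_x 1 2) * var (CM_x 3 4)"
    by (simp add: quadric_def aeval_add aeval_diff aeval_mult aeval_var)
  have "aeval (\<lambda>v. if v = CM_x 1 3 \<or> v = CM_x 2 4 then 1 else 0 :: complex) (quadric - var (CM_x 1 2) * var (CM_x 3 4)) \<noteq> 0"
    by (simp add: quadric_def aeval_add aeval_diff aeval_mult aeval_var)
  then show "aeval (var(CM_x 1 2 := 0)) quadric \<noteq> 0"
    unfolding eq using aeval_0 by force
qed

lemma nf_var: "(\<mu>, \<nu>) \<in> increasing_pairs \<Longrightarrow> aeval nf (var (CM_x \<mu> \<nu>)) = var (CM_x \<mu> \<nu>)"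
  by (simp add: aeval_var nf_def)

text \<open>If x12 times a polynomial equals \<open>quadric * h\<close>, putting x12 to zero kills
  the left side while the quadric stays nonzero. So x12 divides \<open>h\<close> and can be
  cancelled.\<close>

lemma x12_cancel:
  assumes "x_CM 1 2 * a = 0"
  shows "a = 0"
proof -
  obtain p where p: "a = abs_presented p" by (metis Quotient_abs_rep[OF Quotient_presented])
  have "abs_presented (var (CM_x 1 2) * p) = 0"
    using assms by (simp add: p gen.abs_eq times_presented.abs_eq)
  from nf_zero[OF this] obtain h where h: "var (CM_x 1 2) * aeval nf p = quadric * h"
    by (auto simp: aeval_mult nf_var increasing_pairs_def)
  from arg_cong[OF this, of "aeval (var(CM_x 1 2 := 0))"]
  have "aeval (var(CM_x 1 2 := 0)) quadric * aeval (var(CM_x 1 2 := 0)) h = 0"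
    by (simp add: aeval_mult aeval_var)
  then have "aeval (var(CM_x 1 2 := 0)) h = 0"
    using mpoly_mult_eq_0 quadric_at_s_0(2) by blast
  then obtain k where "h = var (CM_x 1 2) * k"
    using mpoly_split_var[of h "CM_x 1 2"] by auto
  then have "var (CM_x 1 2) * aeval nf p = var (CM_x 1 2) * (quadric * k)"
    using h by (metis mult.left_commute)
  then have "aeval nf p = quadric * k" by (rule var_mult_cancel)
  then have "abs_presented p = abs_presented (quadric * k)"
    by (metis abs_presented_nf)
  also have "\<dots> = 0"
    by (simp only: calg_homD[OF calg_hom_abs_presented] abs_presented_quadric mult_zero_left)
  finally show ?thesis by (simp add: p)
qed

lemma x12_power_cancel: "x_CM 1 2 ^ n * a = 0 \<Longrightarrow> a = 0"
proof (induction n)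
  case (Suc n)
  then have "x_CM 1 2 * (x_CM 1 2 ^ n * a) = 0" by (simp only: power_Suc mult.assoc)
  then show ?case by (rule Suc.IH[OF x12_cancel])
qed simp

text \<open>Together with \<open>x12_cancel\<close>: \<open>x12, x34\<close> is a regular sequence.\<close>

lemma x34_x12_regular:
  assumes "x_CM 3 4 * a = x_CM 1 2 * b"
  shows "\<exists>c. a = x_CM 1 2 * c"
proof -
  let ?s = "CM_x 1 2" and ?t = "CM_x 3 4"
  let ?S = "aeval (var(?s := 0))" and ?T = "aeval (var(?t := 0))"
  obtain p where p: "a = abs_presented p" by (metis Quotient_abs_rep[OF Quotient_presented])
  obtain r where r: "b = abs_presented r" by (metis Quotient_abs_rep[OF Quotient_presented])
  have "abs_presented (var ?t * p - var ?s * r) = 0"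
    using assms by (simp add: p r gen.abs_eq calg_homD[OF calg_hom_abs_presented])
  from nf_zero[OF this] obtain h where h: "var ?t * aeval nf p - var ?s * aeval nf r = quadric * h"
    by (auto simp: aeval_mult aeval_diff nf_var increasing_pairs_def)
  from arg_cong[OF this, of ?S]
  have S: "var ?t * ?S (aeval nf p) = ?S quadric * ?S h"
    by (simp add: aeval_mult aeval_diff aeval_var)
  \<comment> \<open>The quadric at x12 = 0 does not involve x34, so putting x34 to zero in
    \<open>S\<close> shows that x34 divides \<open>?S h\<close>.\<close>
  have "?T (?S quadric) = ?S quadric"
    by (simp add: quadric_def aeval_add aeval_diff aeval_mult aeval_var)
  with arg_cong[OF S, of ?T] have "?S quadric * ?T (?S h) = 0"
    by (simp add: aeval_mult aeval_var)
  then have "?T (?S h) = 0" using mpoly_mult_eq_0 quadric_at_s_0(2) by blast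
  then obtain h' where h': "?S h = var ?t * h'"
    using mpoly_split_var[of "?S h" ?t] by auto
  then have "var ?t * ?S (aeval nf p) = var ?t * (?S quadric * h')"
    by (simp only: S mult.left_commute)
  then have p': "?S (aeval nf p) = ?S quadric * h'" by (rule var_mult_cancel)
  obtain k where k: "aeval nf p - ?S (aeval nf p) = var ?s * k"
    using mpoly_split_var[of "aeval nf p" ?s] by blast
  have "aeval nf p = aeval nf p - ?S (aeval nf p) + ?S (aeval nf p)"
    by (rule diff_add_cancel[symmetric])
  \<comment> \<open>Modulo x12 the normal form is \<open>?S quadric * h'\<close>, and
    \<open>?S quadric\<close> differs from \<open>quadric\<close> by the multiple x12 x34 of
    x12.\<close>
  also have "\<dots> = quadric * h' + var ?s * (k - var ?t * h')"
  proof -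
    have "x * k + (q - x * t) * h = q * h + x * (k - t * h)" for x k q t h :: "CM_gen mpoly"
      by (simp only: right_diff_distrib left_diff_distrib mult_ac) (simp only: add_diff_eq diff_add_eq add.commute)
    then show ?thesis unfolding k unfolding p' unfolding quadric_at_s_0(1) .
  qed
  finally have nf: "aeval nf p = quadric * h' + var ?s * (k - var ?t * h')" .
  have "a = abs_presented (aeval nf p)" by (simp only: abs_presented_nf p)
  also have "\<dots> = x_CM 1 2 * abs_presented (k - var ?t * h')"
    unfolding nf by (simp only: calg_homD[OF calg_hom_abs_presented] abs_presented_quadric gen.abs_eq
        mult_zero_left add_0_left)
  finally show ?thesis by blast
qed

text \<open>Two nested inductions: for a single factor x12 the factors x34 are stripped one by one;
  then the factors x12 are split off and cancelled by \<open>x12_cancel\<close>.\<close>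

lemma x34_x12_regular_power:
  assumes "x_CM 3 4 ^ m * a = x_CM 1 2 ^ n * b"
  shows "\<exists>c. a = x_CM 1 2 ^ n * c"
proof -
  have one: "\<exists>c. a = x_CM 1 2 * c" if "x_CM 3 4 ^ m * a = x_CM 1 2 * b" for m a b
    using that
  proof (induction m arbitrary: a b)
    case 0
    then show ?case by auto
  next
    case (Suc m)
    then have "x_CM 3 4 ^ m * (x_CM 3 4 * a) = x_CM 1 2 * b" by (simp only: power_Suc mult_ac)
    from Suc.IH[OF this] show ?case using x34_x12_regular by blast
  qed
  show ?thesis using assms
  proof (induction n arbitrary: a)
    case 0
    then show ?case by auto
  next
    case (Suc n)
    have "x_CM 3 4 ^ m * a = x_CM 1 2 * (x_CM 1 2 ^ n * b)"
      using Suc.prems by (simp only: power_Suc mult.assoc)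
    from one[OF this] obtain a' where a': "a = x_CM 1 2 * a'" by blast
    have "x_CM 1 2 * (x_CM 3 4 ^ m * a' - x_CM 1 2 ^ n * b) = 0"
      using Suc.prems by (simp only: a' right_diff_distrib power_Suc mult_ac diff_self)
    then have "x_CM 3 4 ^ m * a' = x_CM 1 2 ^ n * b"
      using x12_cancel eq_iff_diff_eq_0 by blast
    from Suc.IH[OF this] obtain c where "a' = x_CM 1 2 ^ n * c" by blast
    then have "a = x_CM 1 2 ^ Suc n * c" by (simp only: a' power_Suc mult.assoc)
    then show ?case by blast
  qed
qed


section \<open>Minors on the general linear group\<close>

definition ev_GL :: "complex^4^4 \<Rightarrow> GL_gen presented \<Rightarrow> complex" where
  "ev_GL A = hom_ext (\<lambda>v. case v of GL_a \<mu> \<nu> \<Rightarrow> A $ \<mu> $ \<nu> | GL_det_inv \<Rightarrow> inverse (det A))"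

lemma matrix_eta: "(\<chi> i j. A $ i $ j) = A"
  by (simp add: vec_eq_iff)

lemma ev_GL_relations:
  fixes A :: "complex^4^4"
  assumes "det A \<noteq> 0" "r \<in> relations"
  shows "aeval (\<lambda>v. case v of GL_a \<mu> \<nu> \<Rightarrow> A $ \<mu> $ \<nu> | GL_det_inv \<Rightarrow> inverse (det A)) r = 0"
  using assms(2) right_inverse[OF assms(1)]
  by (simp add: relations_GL_gen_def aeval_diff aeval_mult aeval_det aeval_var aeval_1 matrix_eta)

lemma calg_hom_ev_GL: "det A \<noteq> 0 \<Longrightarrow> calg_hom (ev_GL A)"
  unfolding ev_GL_def by (rule calg_hom_hom_ext) (rule ev_GL_relations)

lemma ev_GL_gen:
  assumes "det A \<noteq> 0"
  shows "ev_GL A (a_GL \<mu> \<nu>) = A $ \<mu> $ \<nu>" "ev_GL A (gen GL_det_inv) = inverse (det A)"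
  by (simp_all add: ev_GL_def hom_ext_simps(1)[OF ev_GL_relations[OF assms]])

definition det_GL :: "GL_gen presented" where "det_GL = det (\<chi> \<mu> \<nu>. a_GL \<mu> \<nu>)"

lemma det_GL_inv: "det_GL * gen GL_det_inv = 1"
proof -
  have "det (\<chi> \<mu> \<nu>. var (GL_a \<mu> \<nu>)) * var GL_det_inv - 1 \<in> relations"
    by (simp add: relations_GL_gen_def)
  from aeval_gen_relation[OF this] show ?thesis
    by (simp add: aeval_diff aeval_mult aeval_det aeval_var aeval_1 det_GL_def)
qed

abbreviation poly_GL :: "(4 \<times> 4) mpoly \<Rightarrow> GL_gen presented"
  where "poly_GL \<equiv> aeval (\<lambda>(\<mu>, \<nu>). a_GL \<mu> \<nu>)"

abbreviation poly_at :: "complex^4^4 \<Rightarrow> (4 \<times> 4) mpoly \<Rightarrow> complex"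
  where "poly_at A \<equiv> aeval (\<lambda>(\<mu>, \<nu>). A $ \<mu> $ \<nu>)"

lemma ev_GL_poly: "det A \<noteq> 0 \<Longrightarrow> ev_GL A (poly_GL p) = poly_at A p"
  by (simp add: calg_hom_o_aeval[OF calg_hom_ev_GL] ev_GL_gen split_def)

text \<open>The inverse determinant is the only generator that is not a matrix entry, and
  \<open>det_GL\<close> cancels it.\<close>

lemma GL_clear_denominators: "\<exists>n p. det_GL ^ n * g = poly_GL p"
proof (induction g rule: presented_induct)
  case (gen v)
  show ?case
  proof (cases v)
    case (GL_a \<mu> \<nu>)
    then have "det_GL ^ 0 * gen v = poly_GL (var (\<mu>, \<nu>))" by (simp add: aeval_var)
    then show ?thesis by blast
  next
    case GL_det_inv
    then have "det_GL ^ 1 * gen v = poly_GL 1" by (simp add: det_GL_inv aeval_1)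
    then show ?thesis by blast
  qed
next
  case one
  have "det_GL ^ 0 * 1 = poly_GL 1" by (simp add: aeval_1)
  then show ?case by blast
next
  case (scale c g)
  then obtain n p where "det_GL ^ n * g = poly_GL p" by blast
  then have "det_GL ^ n * (c *\<^sub>C g) = poly_GL (c *\<^sub>C p)" by (simp only: scaleC_mult_right aeval_scaleC)
  then show ?case by blast
next
  case (add g h)
  then obtain n p m q where n: "det_GL ^ n * g = poly_GL p" and m: "det_GL ^ m * h = poly_GL q"
    by blast
  have d: "det_GL = poly_GL (det (\<chi> \<mu> \<nu>. var (\<mu>, \<nu>)))"
    by (simp add: det_GL_def aeval_det aeval_var)
  have "det_GL ^ (n + m) * (g + h) = det_GL ^ m * (det_GL ^ n * g) + det_GL ^ n * (det_GL ^ m * h)"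
    by (simp only: power_add ring_distribs mult_ac)
  also have "\<dots> = poly_GL (det (\<chi> \<mu> \<nu>. var (\<mu>, \<nu>)) ^ m * p + det (\<chi> \<mu> \<nu>. var (\<mu>, \<nu>)) ^ n * q)"
    by (simp only: n m aeval_add aeval_mult calg_hom_power[OF calg_hom_aeval] d[symmetric])
  finally show ?case by blast
next
  case (mult g h)
  then obtain n p m q where n: "det_GL ^ n * g = poly_GL p" and m: "det_GL ^ m * h = poly_GL q"
    by blast
  have "det_GL ^ (n + m) * (g * h) = (det_GL ^ n * g) * (det_GL ^ m * h)"
    by (simp only: power_add mult_ac)
  also have "\<dots> = poly_GL (p * q)" by (simp only: n m aeval_mult)
  finally show ?case by blast
qed

text \<open>After the determinant is cleared, a polynomial in the entries vanishes wherever
  \<open>r\<close> and the determinant do not. The matrix \<open>B\<close>, possibly singular,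
  certifies that \<open>r\<close> is not the zero polynomial.\<close>

lemma GL_eq_0_if_ev_0_off:
  assumes r: "poly_at B r \<noteq> 0"
    and ev: "\<And>A. det A \<noteq> 0 \<Longrightarrow> poly_at A r \<noteq> 0 \<Longrightarrow> ev_GL A g = 0"
  shows "g = 0"
proof -
  obtain n p where p: "det_GL ^ n * g = poly_GL p" using GL_clear_denominators by blast
  let ?D = "det (\<chi> \<mu> \<nu>. var (\<mu>, \<nu>)) :: (4 \<times> 4) mpoly"
  have D: "poly_at A ?D = det A" for A
    by (simp add: aeval_det aeval_var matrix_eta)
  have "?D \<noteq> 0"
    using D[of "mat 1"] by (auto simp: aeval_0)
  moreover have "r \<noteq> 0" using r by (auto simp: aeval_0)
  ultimately have "r * ?D \<noteq> 0" using mpoly_mult_eq_0 by blast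
  then obtain x :: "4 \<times> 4 \<Rightarrow> complex" where x: "aeval x (r * ?D) \<noteq> 0"
    using mpoly_eq_0_if_aeval_0 by blast
  have "p = 0"
  proof (rule mpoly_eq_0_if_aeval_0_off[OF x])
    fix y :: "4 \<times> 4 \<Rightarrow> complex"
    define A :: "complex^4^4" where "A = (\<chi> i j. y (i, j))"
    have y: "y = (\<lambda>(\<mu>, \<nu>). A $ \<mu> $ \<nu>)" by (auto simp: A_def)
    assume "aeval y (r * ?D) \<noteq> 0"
    then have "poly_at A r \<noteq> 0" and A: "det A \<noteq> 0"
      by (simp_all add: y aeval_mult D)
    then have "ev_GL A (det_GL ^ n * g) = 0"
      by (simp add: calg_homD[OF calg_hom_ev_GL] ev)
    then show "aeval y p = 0" by (simp only: p ev_GL_poly[OF A] y)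
  qed
  then have "det_GL ^ n * g = 0" using p by (simp add: aeval_0)
  then have "gen GL_det_inv ^ n * (det_GL ^ n * g) = 0" by (simp only: mult_zero_right)
  moreover have "gen GL_det_inv ^ n * det_GL ^ n = 1"
    by (metis det_GL_inv mult.commute power_mult_distrib power_one)
  ultimately show ?thesis by (metis mult.assoc mult_1_left)
qed

section \<open>Pluecker coordinates of the first two columns\<close>

definition minors :: "CM_gen presented \<Rightarrow> GL_gen presented" where
  "minors = hom_ext (\<lambda>v. case v of CM_x \<mu> \<nu> \<Rightarrow> a_GL \<mu> 1 * a_GL \<nu> 2 - a_GL \<mu> 2 * a_GL \<nu> 1)"

lemma minors_relations:
  "r \<in> relations \<Longrightarrow> aeval (\<lambda>v. case v of CM_x \<mu> \<nu> \<Rightarrow> a_GL \<mu> 1 * a_GL \<nu> 2 - a_GL \<mu> 2 * a_GL \<nu> 1) r = 0"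
proof -
  show "r \<in> relations \<Longrightarrow> aeval (\<lambda>v. case v of CM_x \<mu> \<nu> \<Rightarrow> a_GL \<mu> 1 * a_GL \<nu> 2 - a_GL \<mu> 2 * a_GL \<nu> 1) r = 0"
    by (auto simp: relations_CM_gen_def aeval_add aeval_diff aeval_mult aeval_var) (simp_all only: algebra_simps, simp_all)
qed

lemma calg_hom_minors: "calg_hom minors"
  unfolding minors_def by (rule calg_hom_hom_ext) (rule minors_relations)

lemma minors_x: "minors (x_CM \<mu> \<nu>) = a_GL \<mu> 1 * a_GL \<nu> 2 - a_GL \<mu> 2 * a_GL \<nu> 1"
  by (simp add: minors_def hom_ext_simps(1)[OF minors_relations])

definition minor :: "'a::comm_ring^4^4 \<Rightarrow> 4 \<Rightarrow> 4 \<Rightarrow> 'a"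
  where "minor A \<mu> \<nu> = A $ \<mu> $ 1 * A $ \<nu> $ 2 - A $ \<mu> $ 2 * A $ \<nu> $ 1"

lemma ev_GL_minors: "det A \<noteq> 0 \<Longrightarrow> ev_GL A (minors (x_CM \<mu> \<nu>)) = minor A \<mu> \<nu>"
  by (simp add: minors_x calg_homD[OF calg_hom_ev_GL] ev_GL_gen minor_def)

text \<open>A representative of a coset of the block triangular subgroup, in terms of the minors \<open>m\<close> of the
  first two columns. It exists where \<open>m p q \<noteq> 0\<close>; \<open>r, s\<close> are the remaining indices.\<close>

definition chart :: "4 \<Rightarrow> 4 \<Rightarrow> 4 \<Rightarrow> 4 \<Rightarrow> (4 \<Rightarrow> 4 \<Rightarrow> complex) \<Rightarrow> complex^4^4" where
  "chart p q r s m = (\<chi> i j. if j = 1 then m i q else if j = 2 then m p i / m p q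
     else if j = 3 then (if i = r then 1 else 0) else (if i = s then 1 else 0))"

lemma chart_nth:
  "chart p q r s m $ i $ 1 = m i q" "chart p q r s m $ i $ 2 = m p i / m p q"
  "chart p q r s m $ i $ 3 = (if i = r then 1 else 0)" "chart p q r s m $ i $ 4 = (if i = s then 1 else 0)"
  by (simp_all add: chart_def)

lemma det_chart:
  assumes "(p, q, r, s) \<in> {(1, 2, 3, 4), (3, 4, 1, 2)}" "m p p = 0" "m q q = 0" "m p q \<noteq> 0"
  shows "det (chart p q r s m) = m p q"
proof -
  from assms(1) consider "p = 1" "q = 2" "r = 3" "s = 4" | "p = 3" "q = 4" "r = 1" "s = 2" by blast
  then show ?thesis
    by cases (use assms(2-) in \<open>simp_all add: det_4 chart_nth\<close>)
qed

lemma minor_diag: "minor A \<mu> \<mu> = (0 :: 'a::comm_ring)"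
  by (simp add: minor_def mult.commute)

text \<open>The coordinates \<open>var (CM_x \<mu> \<nu>)\<close> other than \<open>x34\<close> parametrize the part of the cone where \<open>x12\<close> is
  invertible.\<close>

lemma minors_eq_0:
  assumes "minors F = 0"
  shows "F = 0"
proof -
  define five where "five = increasing_pairs - {(3, 4)}"
  define y where "y v = (case v of CM_x \<mu> \<nu> \<Rightarrow> if (\<mu>, \<nu>) \<in> five then x_CM \<mu> \<nu> else 0)" for v
  define y' where "y' v = (case v of CM_x \<mu> \<nu> \<Rightarrow> if (\<mu>, \<nu>) \<in> five then var (CM_x \<mu> \<nu>) else 0)" for v
  have y_var: "aeval y (var (CM_x \<mu> \<nu>)) = x_CM \<mu> \<nu>" if "(\<mu>, \<nu>) \<in> five" for \<mu> \<nu>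
    using that by (simp add: aeval_var y_def)
  have s: "aeval y (var (CM_x 1 2)) = x_CM 1 2"
    by (rule y_var) (simp add: five_def increasing_pairs_def)
  \<comment> \<open>Where x12 is inverted the quadric can be solved for x34. So up to a power of x12
    every element is a polynomial in the other five coordinates.\<close>
  have "\<exists>n p. x_CM 1 2 ^ n * F = aeval y p"
  proof (induction F rule: presented_induct)
    case (gen v)
    obtain \<mu> \<nu> where v: "v = CM_x \<mu> \<nu>" by (cases v)
    have five: "\<exists>n p. x_CM 1 2 ^ n * x_CM \<mu> \<nu> = aeval y p" if "(\<mu>, \<nu>) \<in> five" for \<mu> \<nu>
      using y_var[OF that] by (metis mult_1_left power_0)
    have "x_CM 1 2 ^ 1 * x_CM 3 4 = aeval y (var (CM_x 1 3) * var (CM_x 2 4) - var (CM_x 1 4) * var (CM_x 2 3))"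
      by (simp add: aeval_diff aeval_mult y_var five_def increasing_pairs_def x_CM_quadric)
    then have incr: "\<exists>n p. x_CM 1 2 ^ n * x_CM \<mu> \<nu> = aeval y p" if "(\<mu>, \<nu>) \<in> increasing_pairs" for \<mu> \<nu>
      using five[of \<mu> \<nu>] that unfolding five_def by blast
    have decr: "\<exists>n p. x_CM 1 2 ^ n * x_CM \<mu> \<nu> = aeval y p" if dec: "(\<nu>, \<mu>) \<in> increasing_pairs" for \<mu> \<nu>
    proof -
      obtain n p where "x_CM 1 2 ^ n * x_CM \<nu> \<mu> = aeval y p" using incr[OF dec] by blast
      then have "x_CM 1 2 ^ n * x_CM \<mu> \<nu> = aeval y (- p)"
        by (simp add: x_CM_antisym[of \<mu> \<nu>] calg_homD[OF calg_hom_aeval])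
      then show ?thesis by blast
    qed
    have diag: "\<exists>n p. x_CM 1 2 ^ n * x_CM \<mu> \<mu> = aeval y p" for \<mu>
      by (rule exI[of _ 0], rule exI[of _ 0]) (simp add: x_CM_diag aeval_0)
    have "(\<mu>, \<nu>) \<in> increasing_pairs \<or> (\<nu>, \<mu>) \<in> increasing_pairs \<or> \<mu> = \<nu>"
      using exhaust_4[of \<mu>] exhaust_4[of \<nu>] by (auto simp: increasing_pairs_def)
    then show ?case unfolding v using incr decr diag by blast
  next
    case one
    have "x_CM 1 2 ^ 0 * 1 = aeval y 1" by (simp add: aeval_1)
    then show ?case by blast
  next
    case (scale c g)
    then obtain n p where "x_CM 1 2 ^ n * g = aeval y p" by blast
    then have "x_CM 1 2 ^ n * (c *\<^sub>C g) = aeval y (c *\<^sub>C p)" by (simp only: scaleC_mult_right aeval_scaleC)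
    then show ?case by blast
  next
    case (add g h)
    then obtain n p m q where n: "x_CM 1 2 ^ n * g = aeval y p" and m: "x_CM 1 2 ^ m * h = aeval y q"
      by blast
    have "x_CM 1 2 ^ (n + m) * (g + h) = x_CM 1 2 ^ m * (x_CM 1 2 ^ n * g) + x_CM 1 2 ^ n * (x_CM 1 2 ^ m * h)"
      by (simp only: power_add ring_distribs mult_ac)
    also have "\<dots> = aeval y (var (CM_x 1 2) ^ m * p + var (CM_x 1 2) ^ n * q)"
      by (simp only: n m aeval_add aeval_mult calg_hom_power[OF calg_hom_aeval] s)
    finally show ?case by blast
  next
    case (mult g h)
    then obtain n p m q where n: "x_CM 1 2 ^ n * g = aeval y p" and m: "x_CM 1 2 ^ m * h = aeval y q"
      by blast
    have "x_CM 1 2 ^ (n + m) * (g * h) = (x_CM 1 2 ^ n * g) * (x_CM 1 2 ^ m * h)"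
      by (simp only: power_add mult_ac)
    also have "\<dots> = aeval y (p * q)" by (simp only: n m aeval_mult)
    finally show ?case by blast
  qed
  then obtain n p where p: "x_CM 1 2 ^ n * F = aeval y p" by blast
  \<comment> \<open>\<open>y'\<close> lifts \<open>y\<close> to free variables. For arbitrary values
    of the five coordinates with x12 nonzero, the chart is an invertible matrix having these values
    as its minors; evaluating there transfers the vanishing of \<open>minors F\<close> to
    \<open>p\<close>.\<close>
  have "aeval y' p = 0"
  proof (rule mpoly_eq_0_if_aeval_0_off)
    show "aeval (\<lambda>_. 1 :: complex) (var (CM_x 1 2)) \<noteq> 0" by (simp add: aeval_var)
  next
    fix z :: "CM_gen \<Rightarrow> complex"
    assume "aeval z (var (CM_x 1 2)) \<noteq> 0"
    then have z: "z (CM_x 1 2) \<noteq> 0" by (simp add: aeval_var)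
    \<comment> \<open>Going through \<open>nf\<close> makes \<open>m\<close> antisymmetric, as
      minors are. The entries computed next are exactly those that occur in the chart.\<close>
    define m where "m \<mu> \<nu> = aeval z (nf (CM_x \<mu> \<nu>))" for \<mu> \<nu>
    have nf: "aeval z (nf (CM_x \<mu> \<nu>)) = (if (\<mu>, \<nu>) \<in> increasing_pairs then z (CM_x \<mu> \<nu>)
        else if (\<nu>, \<mu>) \<in> increasing_pairs then - z (CM_x \<nu> \<mu>) else 0)" for \<mu> \<nu>
      by (simp add: nf_def aeval_var aeval_0 calg_homD[OF calg_hom_aeval])
    have m: "m 1 1 = 0" "m 2 2 = 0" "m 1 2 = z (CM_x 1 2)" "m 1 3 = z (CM_x 1 3)" "m 1 4 = z (CM_x 1 4)"
      "m 3 2 = - z (CM_x 2 3)" "m 4 2 = - z (CM_x 2 4)"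
      by (simp_all add: m_def nf increasing_pairs_def)
    let ?A = "chart 1 2 3 4 m"
    have "det ?A = m 1 2"
      by (rule det_chart) (use z in \<open>simp_all add: m\<close>)
    then have A: "det ?A \<noteq> 0" using z by (simp add: m)
    have "minor ?A \<mu> \<nu> = z (CM_x \<mu> \<nu>)" if "(\<mu>, \<nu>) \<in> five" for \<mu> \<nu>
    proof -
      from that consider "\<mu> = 1" "\<nu> = 2" | "\<mu> = 1" "\<nu> = 3" | "\<mu> = 1" "\<nu> = 4" | "\<mu> = 2" "\<nu> = 3" | "\<mu> = 2" "\<nu> = 4"
        unfolding five_def increasing_pairs_def by blast
      then show ?thesis by cases (use z in \<open>simp_all add: minor_def chart_nth m\<close>)
    qed
    then have "ev_GL ?A (minors (y v)) = aeval z (y' v)" for v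
      by (cases v) (simp add: y_def y'_def ev_GL_minors[OF A] calg_homD[OF calg_hom_minors]
          calg_homD[OF calg_hom_ev_GL[OF A]] aeval_var aeval_0)
    then have "ev_GL ?A (minors (aeval y p)) = aeval z (aeval y' p)"
      by (simp add: calg_hom_o_aeval[OF calg_hom_minors] calg_hom_o_aeval[OF calg_hom_ev_GL[OF A]]
          calg_hom_o_aeval[OF calg_hom_aeval])
    then show "aeval z (aeval y' p) = 0"
      by (simp add: p[symmetric] calg_homD[OF calg_hom_minors] assms calg_homD[OF calg_hom_ev_GL[OF A]])
  qed
  moreover have "abs_presented (aeval y' p) = aeval y p"
  proof -
    have "abs_presented (y' v) = y v" for v
      by (cases v) (simp add: y_def y'_def gen.abs_eq zero_presented.abs_eq)
    then show ?thesis by (simp add: calg_hom_o_aeval[OF calg_hom_abs_presented])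
  qed
  ultimately have "x_CM 1 2 ^ n * F = 0"
    by (simp only: p zero_presented.abs_eq)
  then show ?thesis by (rule x12_power_cancel)
qed


section \<open>Coproduct, coaction and projection\<close>

text \<open>Over the tensor algebra the matrix of coproducts is the matrix product of
  \<open>a \<otimes> 1\<close> and \<open>1 \<otimes> a\<close>, so multiplicativity of the
  determinant makes it group-like.\<close>

lemma comult_relation:
  assumes "\<And>i j. f (g i j) = (\<Sum>k\<in>UNIV. a i k \<otimes> a k j)" "f d = e \<otimes> e" "det (\<chi> i j. a i j) * e = 1"
  shows "aeval f (det (\<chi> i j :: 4. var (g i j)) * var d - 1) = (0 :: ('a::calg, 'a) tensor)"
proof -
  have "(\<chi> i j. f (g i j)) = (\<chi> i j. a i j \<otimes> 1) ** (\<chi> i j. 1 \<otimes> a i j)"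
    by (simp add: matrix_matrix_mult_def assms(1) tensor_mult_tens)
  moreover have "det (\<chi> i j. a i j \<otimes> (1 :: 'a)) = det (\<chi> i j. a i j) \<otimes> 1"
    "det (\<chi> i j. (1 :: 'a) \<otimes> a i j) = 1 \<otimes> det (\<chi> i j. a i j)"
    by (simp_all add: calg_hom_det[OF calg_hom_tens_1(1)] calg_hom_det[OF calg_hom_tens_1(2)])
  ultimately have "det (\<chi> i j. f (g i j)) = det (\<chi> i j. a i j) \<otimes> det (\<chi> i j. a i j)"
    by (simp add: det_mul tensor_mult_tens)
  then show ?thesis
    by (simp add: aeval_diff aeval_mult aeval_det aeval_var aeval_1 assms(2,3) tensor_mult_tens one_tensor_def)
qed

lemma comult_GL4_relations:
  "r \<in> relations \<Longrightarrow> aeval (\<lambda>v. case v of GL_a \<mu> \<nu> \<Rightarrow> \<Sum>\<alpha>\<in>UNIV. a_GL \<mu> \<alpha> \<otimes> a_GL \<alpha> \<nu>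
     | GL_det_inv \<Rightarrow> gen GL_det_inv \<otimes> gen GL_det_inv) r = 0"
  using comult_relation[where g = GL_a and a = a_GL and d = GL_det_inv and e = "gen GL_det_inv"] det_GL_inv
  by (simp add: relations_GL_gen_def det_GL_def)

lemma calg_hom_comult_GL4: "calg_hom (comult GL4)"
  unfolding GL4_def hopf.simps by (rule calg_hom_hom_ext) (rule comult_GL4_relations)

lemma comult_GL4_gen:
  "comult GL4 (a_GL \<mu> \<nu>) = (\<Sum>\<alpha>\<in>UNIV. a_GL \<mu> \<alpha> \<otimes> a_GL \<alpha> \<nu>)"
  "comult GL4 (gen GL_det_inv) = gen GL_det_inv \<otimes> gen GL_det_inv"
  by (simp_all add: GL4_def hom_ext_simps(1)[OF comult_GL4_relations])

lemma counit_GL4_relations: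
  "r \<in> relations \<Longrightarrow> aeval (\<lambda>v. case v of GL_a \<mu> \<nu> \<Rightarrow> if \<mu> = \<nu> then 1 else 0 | GL_det_inv \<Rightarrow> 1) r = (0 :: complex)"
  by (simp add: relations_GL_gen_def aeval_diff aeval_mult aeval_det aeval_var aeval_1 det_delta)

lemma calg_hom_counit_GL4: "calg_hom (counit GL4)"
  unfolding GL4_def hopf.simps by (rule calg_hom_hom_ext) (rule counit_GL4_relations)

lemma counit_GL4_gen:
  "counit GL4 (a_GL \<mu> \<nu>) = (if \<mu> = \<nu> then 1 else 0)" "counit GL4 (gen GL_det_inv) = 1"
  by (simp_all add: GL4_def hom_ext_simps(1)[OF counit_GL4_relations])

lemma proj_H_relations:
  "r \<in> relations \<Longrightarrow> aeval (\<lambda>v. case v of GL_a \<mu> \<nu> \<Rightarrow> a_H \<mu> \<nu> | GL_det_inv \<Rightarrow> gen H_det_inv) r = 0"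
proof -
  have "det (\<chi> \<mu> \<nu>. var (H_a \<mu> \<nu>)) * var H_det_inv - 1 \<in> relations"
    by (simp add: relations_H_gen_def)
  from aeval_gen_relation[OF this]
  have "det (\<chi> \<mu> \<nu>. a_H \<mu> \<nu>) * gen H_det_inv - 1 = 0"
    by (simp add: aeval_diff aeval_mult aeval_det aeval_var aeval_1)
  then show "r \<in> relations \<Longrightarrow> aeval (\<lambda>v. case v of GL_a \<mu> \<nu> \<Rightarrow> a_H \<mu> \<nu> | GL_det_inv \<Rightarrow> gen H_det_inv) r = 0"
    by (simp add: relations_GL_gen_def aeval_diff aeval_mult aeval_det aeval_var aeval_1)
qed

lemma calg_hom_proj_H: "calg_hom proj_H"
  unfolding proj_H_def by (rule calg_hom_hom_ext) (rule proj_H_relations)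

lemma proj_H_gen: "proj_H (a_GL \<mu> \<nu>) = a_H \<mu> \<nu>" "proj_H (gen GL_det_inv) = gen H_det_inv"
  by (simp_all add: proj_H_def hom_ext_simps(1)[OF proj_H_relations])

lemma a_H_relations:
  "a_H 3 1 = 0" "a_H 3 2 = 0" "a_H 4 1 = 0" "a_H 4 2 = 0" "a_H 1 1 * a_H 2 2 - a_H 2 1 * a_H 1 2 = 1"
proof -
  have "var (H_a 3 1) \<in> relations" "var (H_a 3 2) \<in> relations" "var (H_a 4 1) \<in> relations"
    "var (H_a 4 2) \<in> relations" "var (H_a 1 1) * var (H_a 2 2) - var (H_a 2 1) * var (H_a 1 2) - 1 \<in> relations"
    by (simp_all add: relations_H_gen_def)
  from this[THEN aeval_gen_relation]
  show "a_H 3 1 = 0" "a_H 3 2 = 0" "a_H 4 1 = 0" "a_H 4 2 = 0" "a_H 1 1 * a_H 2 2 - a_H 2 1 * a_H 1 2 = 1"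
    by (simp_all add: aeval_var aeval_diff aeval_mult aeval_1)
qed

lemma tens_sum: "(\<Sum>i\<in>S. f i) \<otimes> b = (\<Sum>i\<in>S. f i \<otimes> b)" "a \<otimes> (\<Sum>i\<in>S. g i) = (\<Sum>i\<in>S. a \<otimes> g i)"
  by (rule clinear_sum, rule clinearI; simp add: bilinD[OF bilin_tens])+

lemma tens_linear:
  "(- a) \<otimes> b = - (a \<otimes> b)" "a \<otimes> (- b) = - (a \<otimes> b)"
  "(a - a') \<otimes> b = a \<otimes> b - a' \<otimes> b" "a \<otimes> (b - b') = a \<otimes> b - a \<otimes> b'" "0 \<otimes> b = 0" "a \<otimes> 0 = 0"
proof -
  have l: "clinear (\<lambda>a. a \<otimes> b)" and r: "clinear (\<lambda>b. a \<otimes> b)"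
    by (rule clinearI; simp add: bilinD[OF bilin_tens])+
  show "(- a) \<otimes> b = - (a \<otimes> b)" "a \<otimes> (- b) = - (a \<otimes> b)"
    "(a - a') \<otimes> b = a \<otimes> b - a' \<otimes> b" "a \<otimes> (b - b') = a \<otimes> b - a \<otimes> b'" "0 \<otimes> b = 0" "a \<otimes> 0 = 0"
    using clinear_diff[OF l] clinear_diff[OF r] clinear_0[OF l] clinear_0[OF r]
      clinear_uminus[OF l] clinear_uminus[OF r] by simp_all
qed

text \<open>Under left multiplication the minors transform just as the generators
  \<open>x_CM\<close> do under the coaction.\<close>

lemma comult_minors_x:
  "comult GL4 (minors (x_CM \<mu> \<nu>)) =
   (\<Sum>\<alpha>\<in>UNIV. \<Sum>\<beta>\<in>UNIV. (a_GL \<mu> \<alpha> * a_GL \<nu> \<beta>) \<otimes> minors (x_CM \<alpha> \<beta>))"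
proof -
  have "(\<Sum>\<alpha>\<in>UNIV. a_GL \<mu> \<alpha> \<otimes> a_GL \<alpha> i) * (\<Sum>\<alpha>\<in>UNIV. a_GL \<nu> \<alpha> \<otimes> a_GL \<alpha> j) =
      (\<Sum>\<alpha>\<in>UNIV. \<Sum>\<beta>\<in>UNIV. (a_GL \<mu> \<alpha> * a_GL \<nu> \<beta>) \<otimes> (a_GL \<alpha> i * a_GL \<beta> j))" for i j
    by (simp add: sum_product tensor_mult_tens)
  then show ?thesis
    by (simp add: minors_x calg_homD[OF calg_hom_comult_GL4] comult_GL4_gen tens_linear sum_subtractf)
qed

text \<open>A linear splitting remains one after tensoring with the identity; this yields the
  injectivity of \<open>map_tensor id minors\<close>.\<close>

lemma minors_left_inverse: "\<exists>g. clinear g \<and> (\<forall>x. g (minors x) = x)"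
proof -
  interpret vector_space_pair "scaleC :: complex \<Rightarrow> CM_gen presented \<Rightarrow> CM_gen presented"
    "scaleC :: complex \<Rightarrow> GL_gen presented \<Rightarrow> GL_gen presented" ..
  have "inj minors"
  proof (rule injI)
    fix x y assume "minors x = minors y"
    then have "minors (x - y) = 0" by (simp add: calg_homD[OF calg_hom_minors])
    then show "x = y" using minors_eq_0 by fastforce
  qed
  from linear_injective_left_inverse[OF calg_hom_clinear[OF calg_hom_minors] this]
  show ?thesis by (auto simp: fun_eq_iff)
qed

text \<open>The relations hold because \<open>id \<otimes> minors\<close> is injective and turns the coaction into the coproduct.\<close>

lemma coact_CM_relations:
  assumes "r \<in> relations"
  shows "aeval (\<lambda>v. case v of CM_x \<mu> \<nu> \<Rightarrow> \<Sum>\<alpha>\<in>UNIV. \<Sum>\<beta>\<in>UNIV. (a_GL \<mu> \<alpha> * a_GL \<nu> \<beta>) \<otimes> x_CM \<alpha> \<beta>) r = 0"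
    (is "aeval ?f r = 0")
proof -
  obtain g where g: "clinear g" "\<And>x. g (minors x) = x" using minors_left_inverse by blast
  have "map_tensor id minors (?f v) = comult GL4 (minors (gen v))" for v
    by (cases v) (simp add: comult_minors_x clinear_sum clinear_map_tensor clinear_id
        calg_hom_clinear[OF calg_hom_minors] map_tensor_tens)
  then have "map_tensor id minors (aeval ?f r) = comult GL4 (minors (aeval gen r))"
    by (simp add: calg_hom_o_aeval calg_hom_map_tensor calg_hom_id calg_hom_minors calg_hom_comult_GL4)
  then have "map_tensor id g (map_tensor id minors (aeval ?f r)) = 0"
    by (simp add: aeval_gen_relation[OF assms] calg_homD[OF calg_hom_minors] calg_homD[OF calg_hom_comult_GL4]
        clinear_0 clinear_map_tensor clinear_id g)
  moreover have "map_tensor id g (map_tensor id minors t) = t" for t :: "(GL_gen presented, CM_gen presented) tensor"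
  proof (rule clinear_tensor_eqI[where f = "\<lambda>t. map_tensor id g (map_tensor id minors t)" and g = "\<lambda>t. t"])
    have minors: "clinear minors" by (rule calg_hom_clinear[OF calg_hom_minors])
    show "clinear (\<lambda>t. map_tensor id g (map_tensor id minors t))"
      by (rule clinear_comp[OF clinear_map_tensor[OF clinear_id g(1)] clinear_map_tensor[OF clinear_id minors]])
    show "clinear (\<lambda>t :: (GL_gen presented, CM_gen presented) tensor. t)" by (rule clinearI) simp_all
    show "map_tensor id g (map_tensor id minors (a \<otimes> b)) = a \<otimes> b"
      for a :: "GL_gen presented" and b :: "CM_gen presented"
      by (simp only: map_tensor_tens[OF clinear_id minors] map_tensor_tens[OF clinear_id g(1)] id_apply g(2))
  qed
  ultimately show ?thesis by simp
qed

lemma calg_hom_coact_CM: "calg_hom coact_CM"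
  unfolding coact_CM_def by (rule calg_hom_hom_ext) (rule coact_CM_relations)

lemma coact_CM_x: "coact_CM (x_CM \<mu> \<nu>) = (\<Sum>\<alpha>\<in>UNIV. \<Sum>\<beta>\<in>UNIV. (a_GL \<mu> \<alpha> * a_GL \<nu> \<beta>) \<otimes> x_CM \<alpha> \<beta>)"
  by (simp add: coact_CM_def hom_ext_simps(1)[OF coact_CM_relations])

text \<open>So \<open>minors\<close> is a comodule map into the left regular comodule, which is what
  carries one twisted product to the other.\<close>

lemma comult_minors: "comult GL4 (minors x) = map_tensor id minors (coact_CM x)"
proof (rule calg_hom_presented_eqI[where x = x])
  show "calg_hom (\<lambda>x. comult GL4 (minors x))" "calg_hom (\<lambda>x. map_tensor id minors (coact_CM x))"
    by (rule calg_hom_comp[OF calg_hom_comult_GL4 calg_hom_minors])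
      (rule calg_hom_comp[OF calg_hom_map_tensor[OF calg_hom_id calg_hom_minors] calg_hom_coact_CM])
  fix v show "comult GL4 (minors (gen v)) = map_tensor id minors (coact_CM (gen v))"
    by (cases v) (simp add: comult_minors_x coact_CM_x clinear_sum clinear_map_tensor clinear_id
        calg_hom_clinear[OF calg_hom_minors] map_tensor_tens)
qed

text \<open>In H the first two columns have zero lower block and an upper block of determinant one.
  Hence only the minors with rows 1, 2 in either order survive the projection, with value 1 or -1,
  and their coefficients recombine to the original minor.\<close>

lemma minors_invariant: "map_tensor id proj_H (comult GL4 (minors x)) = minors x \<otimes> 1"
proof (rule calg_hom_presented_eqI[where x = x])
  show "calg_hom (\<lambda>x. map_tensor id proj_H (comult GL4 (minors x)))" "calg_hom (\<lambda>x. minors x \<otimes> (1 :: H_gen presented))"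
    by (rule calg_hom_comp[OF calg_hom_map_tensor[OF calg_hom_id calg_hom_proj_H]
          calg_hom_comp[OF calg_hom_comult_GL4 calg_hom_minors]])
      (rule calg_hom_comp[OF calg_hom_tens_1(1) calg_hom_minors])
  fix v
  obtain \<mu> \<nu> where v: "v = CM_x \<mu> \<nu>" by (cases v)
  have H: "a_H 2 1 * a_H 1 2 = a_H 1 1 * a_H 2 2 - 1"
    using a_H_relations(5) by (simp add: algebra_simps)
  have "proj_H (minors (x_CM \<alpha> \<beta>)) = (if \<alpha> = 1 \<and> \<beta> = 2 then 1 else if \<alpha> = 2 \<and> \<beta> = 1 then -1 else 0)" for \<alpha> \<beta>
    using exhaust_4[of \<alpha>] exhaust_4[of \<beta>]
    by (elim disjE; simp add: minors_x calg_homD[OF calg_hom_proj_H] proj_H_gen a_H_relations(1-4) H mult.commute)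
      (simp_all add: H mult.commute[of "a_H 1 2"])
  then have "map_tensor id proj_H (comult GL4 (minors (gen v))) =
     (\<Sum>\<alpha>\<in>UNIV. \<Sum>\<beta>\<in>UNIV. (a_GL \<mu> \<alpha> * a_GL \<nu> \<beta>) \<otimes> (if \<alpha> = 1 \<and> \<beta> = 2 then 1 else if \<alpha> = 2 \<and> \<beta> = 1 then -1 else 0))"
    by (simp add: v comult_minors_x clinear_sum clinear_map_tensor clinear_id
        calg_hom_clinear[OF calg_hom_proj_H] map_tensor_tens)
  also have "\<dots> = minors (gen v) \<otimes> 1"
    by (simp add: sum_4 v minors_x tens_linear)
  finally show "map_tensor id proj_H (comult GL4 (minors (gen v))) = minors (gen v) \<otimes> 1" .
qed


section \<open>Invariants\<close>

definition ev_H :: "complex^4^4 \<Rightarrow> H_gen presented \<Rightarrow> complex" where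
  "ev_H h = hom_ext (\<lambda>v. case v of H_a \<mu> \<nu> \<Rightarrow> h $ \<mu> $ \<nu> | H_det_inv \<Rightarrow> inverse (det h))"

text \<open>These are the complex points of the quotient Hopf algebra.\<close>

definition block_triangular :: "complex^4^4 \<Rightarrow> bool" where
  "block_triangular h \<longleftrightarrow> det h \<noteq> 0 \<and> h$3$1 = 0 \<and> h$3$2 = 0 \<and> h$4$1 = 0 \<and> h$4$2 = 0 \<and>
     h$1$1 * h$2$2 - h$2$1 * h$1$2 = 1"

lemma ev_H_relations:
  assumes "block_triangular h" "r \<in> relations"
  shows "aeval (\<lambda>v. case v of H_a \<mu> \<nu> \<Rightarrow> h $ \<mu> $ \<nu> | H_det_inv \<Rightarrow> inverse (det h)) r = 0"
  using assms by (auto simp: relations_H_gen_def block_triangular_def aeval_diff aeval_mult aeval_det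
      aeval_var aeval_1 matrix_eta)

lemma calg_hom_ev_H: "block_triangular h \<Longrightarrow> calg_hom (ev_H h)"
  unfolding ev_H_def by (rule calg_hom_hom_ext) (rule ev_H_relations)

lemma ev_H_gen:
  assumes "block_triangular h"
  shows "ev_H h (a_H \<mu> \<nu>) = h $ \<mu> $ \<nu>" "ev_H h (gen H_det_inv) = inverse (det h)"
  by (simp_all add: ev_H_def hom_ext_simps(1)[OF ev_H_relations[OF assms]])

lemma bilin_hom_mult: "clinear f \<Longrightarrow> clinear g \<Longrightarrow> bilin (\<lambda>a b. f a * g b :: 'c::calg)"
  by (rule bilinI) (simp_all add: clinearD ring_distribs scaleC_mult_left scaleC_mult_right)

text \<open>The tensor product is the coproduct of commutative algebras; commutativity of the target
  makes the product of \<open>f a\<close> and \<open>g b\<close> multiplicative.\<close>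

lemma calg_hom_tensor_ext:
  assumes "calg_hom f" "calg_hom g"
  shows "calg_hom (tensor_ext (\<lambda>a b. f a * g b))"
proof -
  have B: "bilin (\<lambda>a b. f a * g b)"
    by (intro bilin_hom_mult calg_hom_clinear assms)
  show ?thesis
    by (rule tensor_calg_homI)
      (simp_all add: clinear_tensor_ext B tensor_ext_tens[OF B] calg_homD[OF assms(1)] calg_homD[OF assms(2)] ac_simps)
qed

text \<open>Evaluating the two legs of the coproduct at \<open>A\<close> and \<open>h\<close>
  amounts to evaluating at \<open>A ** h\<close>, whereas by invariance the second leg is 1 and
  contributes nothing.\<close>

lemma ev_GL_invariant:
  assumes f: "map_tensor id proj_H (comult GL4 f) = f \<otimes> 1"
    and A: "det A \<noteq> 0" and h: "block_triangular h"
  shows "ev_GL (A ** h) f = ev_GL A f"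
proof -
  define L where "L = tensor_ext (\<lambda>a b. ev_GL A a * ev_H h b)"
  note hA = calg_hom_ev_GL[OF A] and hh = calg_hom_ev_H[OF h]
  have B: "bilin (\<lambda>a b. ev_GL A a * ev_H h b)"
    by (intro bilin_hom_mult calg_hom_clinear hA hh)
  have L: "calg_hom L" unfolding L_def by (rule calg_hom_tensor_ext[OF hA hh])
  have L_tens: "L (a \<otimes> b) = ev_GL A a * ev_H h b" for a b
    by (simp add: L_def tensor_ext_tens[OF B])
  have Ah: "det (A ** h) \<noteq> 0"
    using A h by (simp add: det_mul block_triangular_def)
  have entry: "(A ** h) $ i $ j = (\<Sum>k\<in>UNIV. A $ i $ k * h $ k $ j)" for i j
    by (simp add: matrix_matrix_mult_def)
  have "L (map_tensor id proj_H (comult GL4 f)) = ev_GL (A ** h) f"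
  proof (rule calg_hom_presented_eqI[where x = f])
    show "calg_hom (\<lambda>x. L (map_tensor id proj_H (comult GL4 x)))"
      by (rule calg_hom_comp[OF L calg_hom_comp[OF calg_hom_map_tensor[OF calg_hom_id calg_hom_proj_H]
            calg_hom_comult_GL4]])
    show "calg_hom (ev_GL (A ** h))" by (rule calg_hom_ev_GL[OF Ah])
    show "L (map_tensor id proj_H (comult GL4 (gen v))) = ev_GL (A ** h) (gen v)" for v
      by (cases v) (simp_all add: comult_GL4_gen clinear_sum clinear_map_tensor clinear_id map_tensor_tens
          calg_hom_clinear[OF calg_hom_proj_H] calg_hom_sum[OF L] L_tens proj_H_gen
          ev_GL_gen[OF A] ev_H_gen[OF h] ev_GL_gen[OF Ah] det_mul entry)
  qed
  moreover have "L (f \<otimes> 1) = ev_GL A f" by (simp add: L_tens calg_homD[OF hh])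
  ultimately show ?thesis by (simp add: f)
qed

text \<open>By the formula for a minor, the first two columns of the chart are combinations of the
  first two columns of \<open>A\<close>, so the inverse of \<open>A\<close> times the chart has zero
  lower left block. The coefficients form a 2 by 2 matrix whose determinant is
  \<open>minor A p q\<close> divided by itself.\<close>

lemma chart_coset:
  assumes pq: "(p, q, r, s) \<in> {(1, 2, 3, 4), (3, 4, 1, 2)}"
    and A: "det A \<noteq> 0" and m: "minor A p q \<noteq> 0"
  shows "\<exists>h. block_triangular h \<and> A ** h = chart p q r s (minor A)"
proof -
  let ?N = "chart p q r s (minor A)"
  obtain B where inv: "A ** B = mat 1" "B ** A = mat 1"
    using A by (auto simp: invertible_det_nz[symmetric] invertible_def)
  define h where "h = B ** ?N"
  have Ah: "A ** h = ?N"
    by (simp add: h_def matrix_mul_assoc inv)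
  have "det A * det h = minor A p q"
    using arg_cong[OF Ah, of det] det_chart[OF pq] m by (simp add: det_mul minor_diag)
  then have "det h \<noteq> 0" using m by auto
  have col: "h $ i $ j = (if i = 1 then c else if i = 2 then d else 0)"
    if "\<And>k. ?N $ k $ j = A $ k $ 1 * c + A $ k $ 2 * d" for i j c d
  proof -
    have "h $ i $ j = (B ** A) $ i $ 1 * c + (B ** A) $ i $ 2 * d"
      by (simp add: h_def matrix_matrix_mult_def that sum.distrib sum_distrib_left algebra_simps)
    then show ?thesis by (simp add: inv mat_def)
  qed
  have h1: "h $ i $ 1 = (if i = 1 then A $ q $ 2 else if i = 2 then - A $ q $ 1 else 0)" for i
    by (rule col) (simp add: chart_nth minor_def)
  have h2: "h $ i $ 2 = (if i = 1 then - A $ p $ 2 / minor A p q else if i = 2 then A $ p $ 1 / minor A p q else 0)" for i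
    by (rule col) (simp add: chart_nth minor_def diff_divide_distrib mult.commute)
  have "A $ q $ 2 * (A $ p $ 1 / minor A p q) - A $ q $ 1 * (A $ p $ 2 / minor A p q) = minor A p q / minor A p q"
    by (simp only: times_divide_eq_right diff_divide_distrib[symmetric] minor_def mult.commute)
  then have "block_triangular h"
    using \<open>det h \<noteq> 0\<close> m by (simp add: block_triangular_def h1 h2)
  with Ah show ?thesis by blast
qed

text \<open>Each entry of the chart, and its inverse determinant, is a constant or a minor up to at
  most one factor \<open>minor A p q\<close> in the denominator. One pair \<open>n\<close>,
  \<open>k\<close> serves all \<open>A\<close>, which later turns equality of values into equality
  of functions.\<close>

lemma chart_clear_denominators:
  assumes pq: "(p, q, r, s) \<in> {(1, 2, 3, 4), (3, 4, 1, 2)}"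
  shows "\<exists>n k. \<forall>A. det A \<noteq> 0 \<longrightarrow> minor A p q \<noteq> 0 \<longrightarrow>
    ev_GL (chart p q r s (minor A)) f * minor A p q ^ n = ev_GL A (minors k)"
proof -
  let ?N = "\<lambda>A. chart p q r s (minor A)"
  have N: "det (?N A) = minor A p q" if "minor A p q \<noteq> 0" for A
    by (rule det_chart[OF pq]) (simp_all add: minor_diag that)
  show ?thesis
  proof (induction f rule: presented_induct)
    case (gen v)
    show ?case
    proof (cases v)
      case (GL_a i j)
      note g = ev_GL_gen N calg_homD[OF calg_hom_minors] calg_homD[OF calg_hom_ev_GL] chart_nth ev_GL_minors
      consider "j = 1" | "j = 2" | "j = 3" | "j = 4" using exhaust_4[of j] by blast
      then show ?thesis
      proof cases
        case 1
        show ?thesis by (rule exI[of _ 0], rule exI[of _ "x_CM i q"]) (simp add: GL_a 1 g)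
      next
        case 2
        show ?thesis by (rule exI[of _ 1], rule exI[of _ "x_CM p i"]) (simp add: GL_a 2 g)
      next
        case 3
        show ?thesis by (rule exI[of _ 0], rule exI[of _ "if i = r then 1 else 0"]) (simp add: GL_a 3 g)
      next
        case 4
        show ?thesis by (rule exI[of _ 0], rule exI[of _ "if i = s then 1 else 0"]) (simp add: GL_a 4 g)
      qed
    next
      case GL_det_inv
      show ?thesis
        by (rule exI[of _ 1], rule exI[of _ 1])
          (simp add: GL_det_inv ev_GL_gen N calg_homD[OF calg_hom_minors] calg_homD[OF calg_hom_ev_GL])
    qed
  next
    case one
    show ?case
      by (rule exI[of _ 0], rule exI[of _ 1])
        (simp add: N calg_homD[OF calg_hom_minors] calg_homD[OF calg_hom_ev_GL])
  next
    case (scale c f)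
    then obtain n k where "\<forall>A. det A \<noteq> 0 \<longrightarrow> minor A p q \<noteq> 0 \<longrightarrow>
        ev_GL (?N A) f * minor A p q ^ n = ev_GL A (minors k)" by blast
    then show ?case
      by (intro exI[of _ n] exI[of _ "c *\<^sub>C k"])
        (simp add: N calg_homD[OF calg_hom_minors] calg_homD[OF calg_hom_ev_GL] scaleC_mult_left)
  next
    case (add f g)
    then obtain n k m l where nm: "\<forall>A. det A \<noteq> 0 \<longrightarrow> minor A p q \<noteq> 0 \<longrightarrow>
        ev_GL (?N A) f * minor A p q ^ n = ev_GL A (minors k)"
      "\<forall>A. det A \<noteq> 0 \<longrightarrow> minor A p q \<noteq> 0 \<longrightarrow> ev_GL (?N A) g * minor A p q ^ m = ev_GL A (minors l)" by blast
    have "ev_GL (?N A) (f + g) * minor A p q ^ (n + m) =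
        ev_GL A (minors (x_CM p q ^ m * k + x_CM p q ^ n * l))"
      if A: "det A \<noteq> 0" "minor A p q \<noteq> 0" for A
    proof -
      have "ev_GL (?N A) (f + g) * minor A p q ^ (n + m) =
        minor A p q ^ m * (ev_GL (?N A) f * minor A p q ^ n) + minor A p q ^ n * (ev_GL (?N A) g * minor A p q ^ m)"
        using A by (simp add: N calg_homD[OF calg_hom_ev_GL] power_add algebra_simps)
      then show ?thesis
        using nm A by (simp add: calg_homD[OF calg_hom_minors] calg_homD[OF calg_hom_ev_GL]
            calg_hom_power[OF calg_hom_minors] calg_hom_power[OF calg_hom_ev_GL] ev_GL_minors)
    qed
    then show ?case by blast
  next
    case (mult f g)
    then obtain n k m l where nm: "\<forall>A. det A \<noteq> 0 \<longrightarrow> minor A p q \<noteq> 0 \<longrightarrow>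
        ev_GL (?N A) f * minor A p q ^ n = ev_GL A (minors k)"
      "\<forall>A. det A \<noteq> 0 \<longrightarrow> minor A p q \<noteq> 0 \<longrightarrow> ev_GL (?N A) g * minor A p q ^ m = ev_GL A (minors l)" by blast
    have "ev_GL (?N A) (f * g) * minor A p q ^ (n + m) = ev_GL A (minors (k * l))"
      if A: "det A \<noteq> 0" "minor A p q \<noteq> 0" for A
    proof -
      have "ev_GL (?N A) (f * g) * minor A p q ^ (n + m) =
        (ev_GL (?N A) f * minor A p q ^ n) * (ev_GL (?N A) g * minor A p q ^ m)"
        using A by (simp add: N calg_homD[OF calg_hom_ev_GL] power_add algebra_simps)
      then show ?thesis
        using nm A by (simp add: calg_homD[OF calg_hom_minors] calg_homD[OF calg_hom_ev_GL])
    qed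
    then show ?case by blast
  qed
qed

lemma minor_cancel:
  assumes "p \<noteq> q" "\<And>A. det A \<noteq> 0 \<Longrightarrow> minor A p q \<noteq> 0 \<Longrightarrow> ev_GL A g = 0"
  shows "g = 0"
proof (rule GL_eq_0_if_ev_0_off)
  let ?r = "var (p, 1) * var (q, 2) - var (p, 2) * var (q, 1) :: (4 \<times> 4) mpoly"
  have r: "poly_at A ?r = minor A p q" for A
    by (simp add: aeval_diff aeval_mult aeval_var minor_def)
  \<comment> \<open>The unit vectors at \<open>p\<close> and \<open>q\<close> as first two columns
    give the minor the value 1; this matrix is singular, which \<open>GL_eq_0_if_ev_0_off\<close>
    permits.\<close>
  let ?B = "(\<chi> i j. if i = p \<and> j = 1 \<or> i = q \<and> j = 2 then 1 else 0) :: complex^4^4"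
  show "poly_at ?B ?r \<noteq> 0" unfolding r using assms(1) by (simp add: minor_def)
  show "ev_GL A g = 0" if "det A \<noteq> 0" "poly_at A ?r \<noteq> 0" for A
    using that assms(2) unfolding r by blast
qed

lemma invariant_on_chart:
  fixes p q r s :: 4
  assumes pq: "(p, q, r, s) \<in> {(1, 2, 3, 4), (3, 4, 1, 2)}"
    and f: "map_tensor id proj_H (comult GL4 f) = f \<otimes> 1"
  shows "\<exists>n k. minors (x_CM p q) ^ n * f = minors k"
proof -
  obtain n k where k: "\<And>A. det A \<noteq> 0 \<Longrightarrow> minor A p q \<noteq> 0 \<Longrightarrow>
      ev_GL (chart p q r s (minor A)) f * minor A p q ^ n = ev_GL A (minors k)"
    using chart_clear_denominators[OF pq] by blast
  have "minors (x_CM p q) ^ n * f - minors k = 0"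
  proof (rule minor_cancel[of p q])
    show "p \<noteq> q" using pq by auto
    fix A :: "complex^4^4" assume A: "det A \<noteq> 0" "minor A p q \<noteq> 0"
    have "ev_GL (chart p q r s (minor A)) f = ev_GL A f"
      using chart_coset[OF pq A] ev_GL_invariant[OF f A(1)] by metis
    with k[OF A] show "ev_GL A (minors (x_CM p q) ^ n * f - minors k) = 0"
      by (simp add: calg_homD[OF calg_hom_ev_GL[OF A(1)]] calg_hom_power[OF calg_hom_ev_GL[OF A(1)]]
          ev_GL_minors[OF A(1)] mult.commute)
  qed
  then show ?thesis by auto
qed

lemma minors_surj_invariants:
  assumes f: "map_tensor id proj_H (comult GL4 f) = f \<otimes> 1"
  shows "\<exists>k. f = minors k"
proof -
  note hom = calg_homD[OF calg_hom_minors] calg_hom_power[OF calg_hom_minors]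
  obtain n k where k: "minors (x_CM 1 2) ^ n * f = minors k"
    using invariant_on_chart[OF _ f, of 1 2 3 4] by auto
  obtain m l where l: "minors (x_CM 3 4) ^ m * f = minors l"
    using invariant_on_chart[OF _ f, of 3 4 1 2] by auto
  \<comment> \<open>Cross-multiplying the two chart expressions for \<open>f\<close> gives an
    equation between minors. Injectivity pulls it back to the cone, where regularity divides
    \<open>k\<close> by the power of x12.\<close>
  have "minors (x_CM 3 4 ^ m * k - x_CM 1 2 ^ n * l) = 0"
    by (simp add: hom k[symmetric] l[symmetric] ac_simps)
  then have "x_CM 3 4 ^ m * k = x_CM 1 2 ^ n * l" using minors_eq_0 by fastforce
  then obtain c where c: "k = x_CM 1 2 ^ n * c" using x34_x12_regular_power by blast
  have "f - minors c = 0"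
  proof (rule minor_cancel[of 1 2])
    fix A :: "complex^4^4" assume A: "det A \<noteq> 0" "minor A 1 2 \<noteq> 0"
    have "minor A 1 2 ^ n * (ev_GL A (f - minors c)) = ev_GL A (minors (x_CM 1 2) ^ n * (f - minors c))"
      by (simp add: calg_homD[OF calg_hom_ev_GL[OF A(1)]] calg_hom_power[OF calg_hom_ev_GL[OF A(1)]]
          ev_GL_minors[OF A(1)])
    also have "\<dots> = 0"
      by (simp add: right_diff_distrib k c hom calg_homD[OF calg_hom_ev_GL[OF A(1)]])
    finally show "ev_GL A (f - minors c) = 0" using A by simp
  qed simp
  then show ?thesis by auto
qed

lemma right_invariants_eq_range_minors:
  "{h. map_tensor id proj_H (comult GL4 h) = h \<otimes> 1} = range minors"
  using minors_invariant minors_surj_invariants by blast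


section \<open>The translation cocycle\<close>

text \<open>Fitted to the recursion of the cocycle, which takes one variable at a time off its first
  argument.\<close>

lemma mpoly_var_induct [case_names one scale add var_mult]:
  assumes "P 1" "\<And>c p. P p \<Longrightarrow> P (c *\<^sub>C p)" "\<And>p q. P p \<Longrightarrow> P q \<Longrightarrow> P (p + q)"
    and "\<And>v p. P p \<Longrightarrow> P (var v * p)"
  shows "P (p :: 'v mpoly)"
proof -
  have "P (p * q)" if "P q" for q
    using that
    by (induction p arbitrary: q rule: mpoly_induct)
      (auto simp: assms scaleC_mult_left distrib_right mult.assoc)
  from this[OF assms(1)] show ?thesis by simp
qed

section \<open>Partial derivatives and the exponent of the cocycle\<close>

lemma clinear_partial_deriv: "clinear (partial_deriv v)"
  unfolding partial_deriv_def by (rule clinear_lin_ext)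

lemma partial_deriv_single:
  "partial_deriv v (Poly_Mapping.single m c) =
   Poly_Mapping.single (m - Poly_Mapping.single v 1) (c * of_nat (Poly_Mapping.lookup m v))"
  by (simp add: partial_deriv_def lin_ext_single scaleC_single)

lemma partial_deriv_1: "partial_deriv v 1 = 0"
  using partial_deriv_single[of v 0 1] by simp

lemma partial_deriv_var: "partial_deriv v (var w) = (if v = w then 1 else 0)"
  by (simp add: var_def partial_deriv_single lookup_single)

lemma partial_deriv_mult:
  "partial_deriv v (p * q) = partial_deriv v p * q + p * partial_deriv v q"
proof -
  note lin = clinearD[OF clinear_partial_deriv] clinear_0[OF clinear_partial_deriv]
  let ?e = "Poly_Mapping.single v 1 :: _ \<Rightarrow>\<^sub>0 nat"
  \<comment> \<open>Subtraction of exponents is truncated, so the shift demands a positive exponent;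
    for exponent zero the coefficient of the derivative vanishes anyway.\<close>
  have shift: "m - ?e + n = m + n - ?e" if "Poly_Mapping.lookup m v \<noteq> 0" for m n
    using that by (intro poly_mapping_eqI) (auto simp: lookup_add lookup_minus lookup_single when_def)
  have single: "partial_deriv v (Poly_Mapping.single m a * Poly_Mapping.single n b) =
     partial_deriv v (Poly_Mapping.single m a) * Poly_Mapping.single n b +
     Poly_Mapping.single m a * partial_deriv v (Poly_Mapping.single n b)" for m n and a b :: complex
    using shift[of m n] shift[of n m]
    by (cases "Poly_Mapping.lookup m v = 0"; cases "Poly_Mapping.lookup n v = 0")
      (simp_all add: partial_deriv_single mult_single lookup_add single_add[symmetric] algebra_simps)
  show ?thesis
  proof (induction p rule: poly_mapping_add_induct)
    case (2 m a)
    show ?case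
      by (induction q rule: poly_mapping_add_induct) (simp_all add: lin single ring_distribs ac_simps)
  qed (simp_all add: lin ring_distribs ac_simps)
qed

lemma partial_deriv_commute: "partial_deriv v (partial_deriv w p) = partial_deriv w (partial_deriv v p)"
proof (induction p rule: mpoly_var_induct)
  case (var_mult u p)
  then show ?case
    by (simp add: partial_deriv_mult partial_deriv_var clinearD[OF clinear_partial_deriv]
        partial_deriv_1 clinear_0[OF clinear_partial_deriv])
qed (simp_all add: clinearD[OF clinear_partial_deriv] partial_deriv_1 clinear_0[OF clinear_partial_deriv])

lemma sum_C4_gen: "(\<Sum>i\<in>UNIV. f i) = (\<Sum>A\<in>{1, 2}. \<Sum>A'\<in>{3, 4}. f (t_gen A A'))"
proof -
  have "(UNIV :: C4_gen set) = Abs_C4_gen ` ({1, 2} \<times> {3, 4})"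
    by (rule type_definition.Abs_image[OF type_definition_C4_gen, symmetric])
  moreover have "inj_on Abs_C4_gen ({1, 2} \<times> {3, 4})"
    by (auto simp: inj_on_def Abs_C4_gen_inject)
  ultimately have "sum f UNIV = (\<Sum>x\<in>{1, 2} \<times> {3, 4}. f (Abs_C4_gen x))"
    using sum.reindex[of Abs_C4_gen "{1, 2} \<times> {3, 4}" f] by (simp only: o_def)
  also have "\<dots> = (\<Sum>A\<in>{1, 2}. \<Sum>A'\<in>{3, 4}. f (t_gen A A'))"
    by (simp only: sum.cartesian_product split_def prod.collapse)
  finally show ?thesis .
qed

lemma finite_C4_gen: "finite (UNIV :: C4_gen set)"
  by (metis type_definition.Abs_image[OF type_definition_C4_gen] finite.emptyI finite.insertI
      finite_SigmaI finite_imageI)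

definition theta_coeff :: "(4 \<Rightarrow> 4 \<Rightarrow> 4 \<Rightarrow> 4 \<Rightarrow> complex) \<Rightarrow> C4_gen \<Rightarrow> C4_gen \<Rightarrow> complex" where
  "theta_coeff \<theta> i j = \<i> / 2 *
     \<theta> (fst (Rep_C4_gen i)) (fst (Rep_C4_gen j)) (snd (Rep_C4_gen i)) (snd (Rep_C4_gen j))"

lemma theta_coeff_t_gen:
  assumes "A \<in> {1, 2}" "B \<in> {1, 2}" "A' \<in> {3, 4}" "B' \<in> {3, 4}"
  shows "theta_coeff \<theta> (t_gen A A') (t_gen B B') = \<i> / 2 * \<theta> A B A' B'"
proof -
  have "Rep_C4_gen (t_gen A A') = (A, A')" "Rep_C4_gen (t_gen B B') = (B, B')"
    using assms by (auto intro!: Abs_C4_gen_inverse)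
  then show ?thesis by (simp add: theta_coeff_def)
qed

lemma theta_op_alt:
  "theta_op \<theta> u = (\<Sum>i\<in>UNIV. \<Sum>j\<in>UNIV. theta_coeff \<theta> i j *\<^sub>C map_tensor (partial_deriv i) (partial_deriv j) u)"
proof -
  have "(\<Sum>i\<in>UNIV. \<Sum>j\<in>UNIV. theta_coeff \<theta> i j *\<^sub>C map_tensor (partial_deriv i) (partial_deriv j) u) =
     (\<Sum>A\<in>{1, 2}. \<Sum>A'\<in>{3, 4}. \<Sum>B\<in>{1, 2}. \<Sum>B'\<in>{3, 4}.
       (\<i> / 2 * \<theta> A B A' B') *\<^sub>C map_tensor (partial_deriv (t_gen A A')) (partial_deriv (t_gen B B')) u)"
    unfolding sum_C4_gen by (intro sum.cong refl) (simp add: theta_coeff_t_gen)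
  also have "\<dots> = theta_op \<theta> u"
    unfolding theta_op_def by (rule sum.cong[OF refl], rule sum.swap)
  finally show ?thesis by simp
qed

text \<open>The commutator of \<open>theta_op \<theta>\<close> with multiplication by
  \<open>var k \<otimes> 1\<close>: the constant coefficient vector field belonging to
  \<open>k\<close>, acting on the second leg.\<close>

definition theta_right :: "(4 \<Rightarrow> 4 \<Rightarrow> 4 \<Rightarrow> 4 \<Rightarrow> complex) \<Rightarrow> C4_gen \<Rightarrow>
    (C4_gen mpoly, C4_gen mpoly) tensor \<Rightarrow> (C4_gen mpoly, C4_gen mpoly) tensor" where
  "theta_right \<theta> k u = (\<Sum>j\<in>UNIV. theta_coeff \<theta> k j *\<^sub>C map_tensor id (partial_deriv j) u)"

lemma clinear_sum_fun: "(\<And>i. i \<in> S \<Longrightarrow> clinear (f i)) \<Longrightarrow> clinear (\<lambda>x. \<Sum>i\<in>S. f i x)"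
  by (rule clinearI) (simp_all add: clinearD sum.distrib cvec.scale_sum_right)

lemma clinear_scale_fun: "clinear f \<Longrightarrow> clinear (\<lambda>x. c *\<^sub>C f x)"
  by (rule clinearI) (simp_all add: clinearD scaleC_add_right scaleC_scaleC mult.commute)

lemma clinear_theta_op: "clinear (theta_op \<theta>)"
proof -
  have "theta_op \<theta> = (\<lambda>u. \<Sum>i\<in>UNIV. \<Sum>j\<in>UNIV. theta_coeff \<theta> i j *\<^sub>C map_tensor (partial_deriv i) (partial_deriv j) u)"
    by (rule ext) (rule theta_op_alt)
  then show ?thesis
    by (simp only:) (intro clinear_sum_fun clinear_scale_fun clinear_map_tensor clinear_partial_deriv)
qed

lemma clinear_theta_right: "clinear (theta_right \<theta> k)"
  unfolding theta_right_def
  by (intro clinear_sum_fun clinear_scale_fun clinear_map_tensor clinear_partial_deriv clinear_id)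

lemma theta_op_tens:
  "theta_op \<theta> (a \<otimes> b) = (\<Sum>i\<in>UNIV. \<Sum>j\<in>UNIV. theta_coeff \<theta> i j *\<^sub>C (partial_deriv i a \<otimes> partial_deriv j b))"
  by (simp add: theta_op_alt map_tensor_tens clinear_partial_deriv)

lemma theta_right_tens:
  "theta_right \<theta> k (a \<otimes> b) = (\<Sum>j\<in>UNIV. theta_coeff \<theta> k j *\<^sub>C (a \<otimes> partial_deriv j b))"
  by (simp add: theta_right_def map_tensor_tens clinear_partial_deriv clinear_id)

lemma theta_op_var_mult:
  "theta_op \<theta> ((var k \<otimes> 1) * u) = (var k \<otimes> 1) * theta_op \<theta> u + theta_right \<theta> k u"
proof -
  have l: "clinear (\<lambda>u. theta_op \<theta> ((var k \<otimes> 1) * u))"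
    "clinear (\<lambda>u. (var k \<otimes> 1) * theta_op \<theta> u + theta_right \<theta> k u)"
    by (rule clinearI; simp add: distrib_left scaleC_mult_right scaleC_add_right clinearD[OF clinear_theta_op]
        clinearD[OF clinear_theta_right])+
  show ?thesis
  proof (rule clinear_tensor_eqI[OF l])
    fix a b
    have "theta_op \<theta> ((var k * a) \<otimes> b) =
       (\<Sum>i\<in>UNIV. (\<Sum>j\<in>UNIV. theta_coeff \<theta> i j *\<^sub>C ((var k * partial_deriv i a) \<otimes> partial_deriv j b)) +
         (if i = k then (\<Sum>j\<in>UNIV. theta_coeff \<theta> i j *\<^sub>C (a \<otimes> partial_deriv j b)) else 0))"
      unfolding theta_op_tens sum.distrib[symmetric]
      by (rule sum.cong[OF refl]) (simp add: partial_deriv_mult partial_deriv_var bilinD[OF bilin_tens]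
          scaleC_add_right sum.distrib tens_linear add.commute)
    also have "\<dots> = (\<Sum>i\<in>UNIV. \<Sum>j\<in>UNIV. theta_coeff \<theta> i j *\<^sub>C ((var k * partial_deriv i a) \<otimes> partial_deriv j b))
        + theta_right \<theta> k (a \<otimes> b)"
      by (simp add: sum.distrib sum.delta[OF finite_C4_gen] theta_right_tens)
    finally show "theta_op \<theta> ((var k \<otimes> 1) * (a \<otimes> b)) = (var k \<otimes> 1) * theta_op \<theta> (a \<otimes> b) + theta_right \<theta> k (a \<otimes> b)"
      by (simp add: tensor_mult_tens theta_op_tens sum_distrib_left scaleC_mult_right)
  qed
qed

lemma theta_op_theta_right: "theta_op \<theta> (theta_right \<theta> k u) = theta_right \<theta> k (theta_op \<theta> u)"
proof (rule clinear_tensor_eqI[OF clinear_comp[OF clinear_theta_op clinear_theta_right]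
      clinear_comp[OF clinear_theta_right clinear_theta_op]])
  fix a b
  have "theta_op \<theta> (theta_right \<theta> k (a \<otimes> b)) = (\<Sum>l\<in>UNIV. \<Sum>i\<in>UNIV. \<Sum>j\<in>UNIV.
     (theta_coeff \<theta> k l * theta_coeff \<theta> i j) *\<^sub>C (partial_deriv i a \<otimes> partial_deriv j (partial_deriv l b)))"
    by (simp add: theta_right_tens theta_op_tens clinear_sum[OF clinear_theta_op] clinearD(2)[OF clinear_theta_op]
        cvec.scale_sum_right scaleC_scaleC)
  also have "\<dots> = (\<Sum>i\<in>UNIV. \<Sum>j\<in>UNIV. \<Sum>l\<in>UNIV.
     (theta_coeff \<theta> k l * theta_coeff \<theta> i j) *\<^sub>C (partial_deriv i a \<otimes> partial_deriv j (partial_deriv l b)))"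
    by (subst sum.swap, rule sum.cong[OF refl], rule sum.swap)
  also have "\<dots> = theta_right \<theta> k (theta_op \<theta> (a \<otimes> b))"
    by (simp add: theta_right_tens theta_op_tens clinear_sum[OF clinear_theta_right]
        clinearD(2)[OF clinear_theta_right] cvec.scale_sum_right scaleC_scaleC mult.commute
        partial_deriv_commute)
  finally show "theta_op \<theta> (theta_right \<theta> k (a \<otimes> b)) = theta_right \<theta> k (theta_op \<theta> (a \<otimes> b))" .
qed

lemma theta_op_pow_theta_right:
  "(theta_op \<theta> ^^ n) (theta_right \<theta> k u) = theta_right \<theta> k ((theta_op \<theta> ^^ n) u)"
  by (induction n) (simp_all add: theta_op_theta_right)

text \<open>Since the commutator \<open>theta_right \<theta> k\<close> itself commutes with
  \<open>theta_op \<theta>\<close>, the rule [T^n, x] = n T^(n-1) [T, x] applies, here with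
  \<open>Suc n\<close> for n.\<close>

lemma theta_op_pow_var_mult:
  "(theta_op \<theta> ^^ Suc n) ((var k \<otimes> 1) * u) =
   (var k \<otimes> 1) * (theta_op \<theta> ^^ Suc n) u + of_nat (Suc n) *\<^sub>C theta_right \<theta> k ((theta_op \<theta> ^^ n) u)"
proof (induction n)
  case 0
  then show ?case by (simp add: theta_op_var_mult scaleC_one)
next
  case (Suc n)
  let ?T = "theta_op \<theta>" and ?R = "theta_right \<theta> k"
  have "(?T ^^ Suc (Suc n)) ((var k \<otimes> 1) * u) = ?T ((?T ^^ Suc n) ((var k \<otimes> 1) * u))" by simp
  also have "\<dots> = (var k \<otimes> 1) * ?T ((?T ^^ Suc n) u) + ?R ((?T ^^ Suc n) u)
      + of_nat (Suc n) *\<^sub>C ?R (?T ((?T ^^ n) u))"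
    unfolding Suc.IH by (simp only: clinearD[OF clinear_theta_op] theta_op_var_mult theta_op_theta_right)
  also have "\<dots> = (var k \<otimes> 1) * (?T ^^ Suc (Suc n)) u + of_nat (Suc (Suc n)) *\<^sub>C ?R ((?T ^^ Suc n) u)"
    by (simp only: funpow.simps o_apply of_nat_Suc scaleC_add_left scaleC_one add_ac)
  finally show ?case .
qed

lemma clinear_theta_op_pow: "clinear (theta_op \<theta> ^^ n)"
proof (induction n)
  case (Suc n)
  from clinear_comp[OF clinear_theta_op this] show ?case by (simp add: o_def)
qed (auto intro: clinearI)

text \<open>Every application lowers the degree of the left leg. Instead of counting degrees, the
  induction spends one further power for each variable factor.\<close>

lemma theta_op_nilpotent: "\<exists>N. \<forall>n\<ge>N. (theta_op \<theta> ^^ n) u = 0"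
proof (induction u rule: tensor_induct)
  case zero
  then show ?case by (simp add: clinear_0[OF clinear_theta_op_pow])
next
  case (tens a b)
  show ?case
  proof (induction a rule: mpoly_var_induct)
    case one
    have "theta_op \<theta> (1 \<otimes> b) = 0"
      by (simp add: theta_op_tens partial_deriv_1 tens_linear)
    then have "(theta_op \<theta> ^^ Suc n) (1 \<otimes> b) = 0" for n
      by (simp only: funpow_Suc_right o_def clinear_0[OF clinear_theta_op_pow])
    then show ?case by (metis Suc_le_D)
  next
    case (scale c a)
    then show ?case by (auto simp: bilinD[OF bilin_tens] clinearD[OF clinear_theta_op_pow])
  next
    case (add a c)
    then obtain N M where "\<forall>n\<ge>N. (theta_op \<theta> ^^ n) (a \<otimes> b) = 0" "\<forall>n\<ge>M. (theta_op \<theta> ^^ n) (c \<otimes> b) = 0" by blast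
    then show ?case
      by (intro exI[of _ "max N M"]) (simp add: bilinD[OF bilin_tens] clinearD[OF clinear_theta_op_pow])
  next
    case (var_mult k a)
    then obtain N where N: "\<And>n. n \<ge> N \<Longrightarrow> (theta_op \<theta> ^^ n) (a \<otimes> b) = 0" by blast
    have "(theta_op \<theta> ^^ Suc n) ((var k * a) \<otimes> b) = 0" if "n \<ge> N" for n
      using theta_op_pow_var_mult[of n \<theta> k "a \<otimes> b"] N[of n] N[of "Suc n"] that
      by (simp add: tensor_mult_tens clinear_0[OF clinear_theta_right] del: funpow.simps)
    then show ?case by (metis Suc_le_D Suc_le_mono)
  qed
next
  case (add t u)
  then obtain N M where "\<forall>n\<ge>N. (theta_op \<theta> ^^ n) t = 0" "\<forall>n\<ge>M. (theta_op \<theta> ^^ n) u = 0" by blast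
  then show ?case
    by (intro exI[of _ "max N M"]) (simp add: clinearD[OF clinear_theta_op_pow])
qed

section \<open>The cocycle as a linear functional and its recursion\<close>

lemma calg_hom_eval_zero: "calg_hom eval_zero"
  unfolding eval_zero_def by (rule calg_hom_aeval)

definition eval_zero2 :: "(C4_gen mpoly, C4_gen mpoly) tensor \<Rightarrow> complex"
  where "eval_zero2 = tensor_ext (\<lambda>u v. eval_zero u * eval_zero v)"

lemma calg_hom_eval_zero2: "calg_hom eval_zero2"
  unfolding eval_zero2_def by (rule calg_hom_tensor_ext[OF calg_hom_eval_zero calg_hom_eval_zero])

lemma eval_zero2_tens: "eval_zero2 (a \<otimes> b) = eval_zero a * eval_zero b"
  unfolding eval_zero2_def
  by (rule tensor_ext_tens) (intro bilin_hom_mult calg_hom_clinear calg_hom_eval_zero)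

definition F_tensor :: "(4 \<Rightarrow> 4 \<Rightarrow> 4 \<Rightarrow> 4 \<Rightarrow> complex) \<Rightarrow> (C4_gen mpoly, C4_gen mpoly) tensor \<Rightarrow> complex"
  where "F_tensor \<theta> u = suminf (\<lambda>n. eval_zero2 ((theta_op \<theta> ^^ n) u) / fact n)"

lemma F_C4_eq: "F_C4 \<theta> h g = F_tensor \<theta> (h \<otimes> g)"
  by (simp add: F_C4_def F_tensor_def eval_zero2_def)

lemma F_tensor_summable: "summable (\<lambda>n. eval_zero2 ((theta_op \<theta> ^^ n) u) / fact n)"
proof -
  obtain N where N: "\<And>n. n \<ge> N \<Longrightarrow> (theta_op \<theta> ^^ n) u = 0" using theta_op_nilpotent by blast
  show ?thesis
    by (rule summable_finite[of "{..<N}"]) (auto simp: N calg_homD[OF calg_hom_eval_zero2] not_less)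
qed

lemma clinear_F_tensor: "clinear (F_tensor \<theta>)"
proof (rule clinearI)
  note lin = clinearD[OF clinear_theta_op_pow] calg_homD[OF calg_hom_eval_zero2]
  show "F_tensor \<theta> (x + y) = F_tensor \<theta> x + F_tensor \<theta> y" for x y
    unfolding F_tensor_def
    by (simp add: lin add_divide_distrib suminf_add[OF F_tensor_summable F_tensor_summable, symmetric])
  show "F_tensor \<theta> (c *\<^sub>C x) = c *\<^sub>C F_tensor \<theta> x" for c x
    unfolding F_tensor_def
    by (simp add: lin scaleC_complex_def suminf_mult[OF F_tensor_summable, symmetric])
qed

lemma bilin_F_C4: "bilin (F_C4 \<theta>)"
  by (rule bilinI) (simp_all add: F_C4_eq bilinD[OF bilin_tens] clinearD[OF clinear_F_tensor])

lemma F_C4_1: "F_C4 \<theta> 1 g = eval_zero g"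
proof -
  have "theta_op \<theta> (1 \<otimes> g) = 0"
    by (simp add: theta_op_tens partial_deriv_1 tens_linear)
  then have "(theta_op \<theta> ^^ Suc n) (1 \<otimes> g) = 0" for n
    by (simp only: funpow_Suc_right o_def clinear_0[OF clinear_theta_op_pow])
  then have "(theta_op \<theta> ^^ n) (1 \<otimes> g) = 0" if "n \<noteq> 0" for n
    using that by (metis not0_implies_Suc)
  then have "F_tensor \<theta> (1 \<otimes> g) = (\<Sum>n\<in>{0}. eval_zero2 ((theta_op \<theta> ^^ n) (1 \<otimes> g)) / fact n)"
    unfolding F_tensor_def by (intro suminf_finite) (auto simp: calg_homD[OF calg_hom_eval_zero2])
  then show ?thesis
    by (simp add: F_C4_eq eval_zero2_tens calg_homD[OF calg_hom_eval_zero])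
qed

text \<open>Evaluation at zero kills every term that keeps the factor \<open>var k\<close>, so only
  commutator terms remain. As \<open>Suc n / fact (Suc n)\<close> is \<open>1 / fact n\<close>, the
  series is merely shifted by one place.\<close>

lemma F_tensor_var_mult: "F_tensor \<theta> ((var k \<otimes> 1) * u) = F_tensor \<theta> (theta_right \<theta> k u)"
proof -
  let ?f = "\<lambda>n. eval_zero2 ((theta_op \<theta> ^^ n) ((var k \<otimes> 1) * u)) / fact n"
  have z: "eval_zero2 ((var k \<otimes> 1) * w) = 0" for w
    by (simp add: calg_homD[OF calg_hom_eval_zero2] eval_zero2_tens) (simp add: eval_zero_def aeval_var)
  have "?f (Suc n) = eval_zero2 ((theta_op \<theta> ^^ n) (theta_right \<theta> k u)) / fact n" for n
    unfolding theta_op_pow_var_mult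
    by (simp add: calg_homD(3,4)[OF calg_hom_eval_zero2] z theta_op_pow_theta_right scaleC_complex_def
        del: of_nat_Suc)
  then have "F_tensor \<theta> (theta_right \<theta> k u) = suminf (\<lambda>n. ?f (Suc n))"
    unfolding F_tensor_def by simp
  also have "\<dots> = suminf ?f - ?f 0"
    by (rule suminf_split_head[OF F_tensor_summable])
  also have "\<dots> = F_tensor \<theta> ((var k \<otimes> 1) * u)"
    unfolding F_tensor_def by (simp add: z)
  finally show ?thesis by simp
qed

lemma F_C4_var_mult: "F_C4 \<theta> (var k * p) q = (\<Sum>j\<in>UNIV. theta_coeff \<theta> k j * F_C4 \<theta> p (partial_deriv j q))"
  using F_tensor_var_mult[of \<theta> k "p \<otimes> q"]
  by (simp add: F_C4_eq tensor_mult_tens theta_right_tens clinear_sum[OF clinear_F_tensor]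
      clinearD[OF clinear_F_tensor] scaleC_complex_def)


section \<open>The bicharacter property and the convolution inverse\<close>

definition add_comult :: "C4_gen mpoly \<Rightarrow> (C4_gen mpoly, C4_gen mpoly) tensor"
  where "add_comult = aeval (\<lambda>i. var i \<otimes> 1 + 1 \<otimes> var i)"

lemma calg_hom_add_comult: "calg_hom add_comult"
  unfolding add_comult_def by (rule calg_hom_aeval)

lemma add_comult_var: "add_comult (var i) = var i \<otimes> 1 + 1 \<otimes> var i"
  by (simp add: add_comult_def aeval_var)

lemma map_tensor_deriv_mult:
  fixes x y :: "('v mpoly, 'b::calg) tensor"
  shows "map_tensor (partial_deriv j) id (x * y) =
    map_tensor (partial_deriv j) id x * y + x * map_tensor (partial_deriv j) id y"
proof -
  define D :: "('v mpoly, 'b) tensor \<Rightarrow> ('v mpoly, 'b) tensor" where "D = map_tensor (partial_deriv j) id"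
  have lin: "clinear D"
    unfolding D_def by (rule clinear_map_tensor[OF clinear_partial_deriv clinear_id])
  have D_tens: "D (a \<otimes> b) = partial_deriv j a \<otimes> b" for a b
    unfolding D_def map_tensor_tens[OF clinear_partial_deriv clinear_id] by simp
  have "D (x * y) = D x * y + x * D y"
  proof (induction x rule: tensor_induct)
    case (tens a b)
    show ?case
      by (induction y rule: tensor_induct)
        (simp_all add: tensor_mult_tens clinear_0[OF lin] clinearD[OF lin] D_tens
          partial_deriv_mult bilinD[OF bilin_tens] ring_distribs ac_simps)
  qed (simp_all add: clinear_0[OF lin] clinearD[OF lin] ring_distribs ac_simps)
  then show ?thesis by (simp only: D_def)
qed

text \<open>Derivations with constant coefficients are translation invariant, so they pass through
  the additive coproduct onto one leg.\<close>

lemma add_comult_partial_deriv: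
  "add_comult (partial_deriv j q) = map_tensor (partial_deriv j) id (add_comult q)"
proof -
  define D :: "(C4_gen mpoly, C4_gen mpoly) tensor \<Rightarrow> _" where "D = map_tensor (partial_deriv j) id"
  have lin: "clinear D"
    unfolding D_def by (rule clinear_map_tensor[OF clinear_partial_deriv clinear_id])
  have D_tens: "D (a \<otimes> b) = partial_deriv j a \<otimes> b" for a b
    unfolding D_def map_tensor_tens[OF clinear_partial_deriv clinear_id] by simp
  have mult: "D (x * y) = D x * y + x * D y" for x y
    unfolding D_def by (rule map_tensor_deriv_mult)
  note simps = calg_homD[OF calg_hom_add_comult] clinearD[OF lin] clinearD[OF clinear_partial_deriv] D_tens
  have "add_comult (partial_deriv j q) = D (add_comult q)"
  proof (induction q rule: mpoly_var_induct)
    case one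
    then show ?case by (simp add: simps partial_deriv_1 one_tensor_def tens_linear)
  next
    case (var_mult v p)
    then show ?case
      by (auto simp: simps partial_deriv_mult mult partial_deriv_var add_comult_var
          partial_deriv_1 tens_linear one_tensor_def[symmetric])
  qed (simp_all add: simps)
  then show ?thesis by (simp only: D_def)
qed

lemma bilin_F_mult: "bilin (\<lambda>q1 q2. F_C4 \<theta> p q1 * F_C4 \<theta> p' q2)"
  using bilin_F_C4 by (intro bilin_hom_mult) (simp_all add: bilin_def)

lemma F_C4_clinear: "clinear (F_C4 \<theta> p)" "clinear (\<lambda>p. F_C4 \<theta> p q)"
  using bilin_F_C4 by (simp_all add: bilin_def)

lemma tensor_ext_sum_fun:
  "tensor_ext (\<lambda>a b. \<Sum>i\<in>S. B i a b) t = (\<Sum>i\<in>S. tensor_ext (B i) t)"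
proof (induction S rule: infinite_finite_induct)
  case (insert i S)
  then show ?case by (simp add: tensor_ext_add_fun)
qed (simp_all add: tensor_ext_def lin_ext_def split_def)

lemma tensor_ext_mult_fun:
  fixes B :: "'a::cvec \<Rightarrow> 'b::cvec \<Rightarrow> complex"
  shows "tensor_ext (\<lambda>a b. c * B a b) t = c * tensor_ext B t" "tensor_ext (\<lambda>a b. B a b * c) t = tensor_ext B t * c"
  using tensor_ext_scale_fun[of c B t] by (simp_all add: scaleC_complex_def mult.commute)

lemma bilin_scale_hom:
  assumes "calg_hom (e :: 'a::calg \<Rightarrow> complex)"
  shows "bilin (\<lambda>a b :: 'b::cvec. e a *\<^sub>C b)"
  by (rule bilinI) (simp_all add: calg_homD[OF assms] scaleC_add_right scaleC_add_left
      scaleC_scaleC scaleC_complex_def mult.commute)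

lemma calg_hom_scale_hom:
  assumes "calg_hom (e :: 'a::calg \<Rightarrow> complex)"
  shows "calg_hom (tensor_ext (\<lambda>a b :: 'b::calg. e a *\<^sub>C b))"
  by (rule tensor_calg_homI)
    (simp_all add: clinear_tensor_ext bilin_scale_hom[OF assms] tensor_ext_tens[OF bilin_scale_hom[OF assms]]
      calg_homD[OF assms] scaleC_one scaleC_mult_left scaleC_mult_right scaleC_scaleC)

lemma add_comult_counit: "tensor_ext (\<lambda>a b. eval_zero a *\<^sub>C b) (add_comult q) = q"
proof (rule calg_hom_mpoly_eqI[where p = q])
  note B = bilin_scale_hom[OF calg_hom_eval_zero]
  show "calg_hom (\<lambda>q. tensor_ext (\<lambda>a b. eval_zero a *\<^sub>C b) (add_comult q))"
    by (rule calg_hom_comp[OF calg_hom_scale_hom[OF calg_hom_eval_zero] calg_hom_add_comult])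
  show "calg_hom (\<lambda>q :: C4_gen mpoly. q)" by (rule calg_homI) simp_all
  show "tensor_ext (\<lambda>a b. eval_zero a *\<^sub>C b) (add_comult (var v)) = var v" for v
    by (simp add: add_comult_var tensor_ext_add[OF B] tensor_ext_tens[OF B] calg_homD[OF calg_hom_eval_zero] scaleC_one)
      (simp add: eval_zero_def aeval_var)
qed

text \<open>A variable multiplied to \<open>p\<close> becomes a derivation of \<open>q\<close>. By
  \<open>add_comult_partial_deriv\<close> it acts on the first leg of the coproduct, where the
  recursion absorbs it back into \<open>p\<close>.\<close>

lemma F_C4_mult:
  "F_C4 \<theta> (p * p') q = tensor_ext (\<lambda>q1 q2. F_C4 \<theta> p q1 * F_C4 \<theta> p' q2) (add_comult q)"
proof (induction p arbitrary: q rule: mpoly_var_induct)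
  case one
  have "F_C4 \<theta> p' q = F_C4 \<theta> p' (tensor_ext (\<lambda>a b. eval_zero a *\<^sub>C b) (add_comult q))"
    by (simp add: add_comult_counit)
  then show ?case
    by (simp add: clinear_o_tensor_ext[OF F_C4_clinear(1)] clinearD(2)[OF F_C4_clinear(1)] F_C4_1 scaleC_complex_def)
next
  case (scale c p)
  then show ?case
    using tensor_ext_scale_fun[of c "\<lambda>q1 q2. F_C4 \<theta> p q1 * F_C4 \<theta> p' q2"]
    by (simp add: scaleC_mult_left clinearD[OF F_C4_clinear(2)])
next
  case (add p r)
  then show ?case
    by (simp add: distrib_right clinearD[OF F_C4_clinear(2)] tensor_ext_add_fun)
next
  case (var_mult k p)
  have "F_C4 \<theta> (var k * p * p') q =
      (\<Sum>j\<in>UNIV. theta_coeff \<theta> k j * tensor_ext (\<lambda>q1 q2. F_C4 \<theta> p (partial_deriv j q1) * F_C4 \<theta> p' q2) (add_comult q))"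
    by (simp add: mult.assoc F_C4_var_mult var_mult.IH add_comult_partial_deriv
        tensor_ext_map_tensor[OF bilin_F_mult clinear_partial_deriv clinear_id])
  also have "\<dots> = tensor_ext (\<lambda>q1 q2. F_C4 \<theta> (var k * p) q1 * F_C4 \<theta> p' q2) (add_comult q)"
    by (simp add: F_C4_var_mult sum_distrib_right mult.assoc tensor_ext_sum_fun tensor_ext_mult_fun)
  finally show ?case .
qed

section \<open>Pullback to the general linear group\<close>

definition transl :: "GL_gen presented \<Rightarrow> C4_gen mpoly"
  where "transl = hom_ext (\<lambda>v. case v of GL_a \<mu> \<nu> \<Rightarrow> translation_part \<mu> \<nu> | GL_det_inv \<Rightarrow> 1)"

definition transl_H :: "H_gen presented \<Rightarrow> C4_gen mpoly"
  where "transl_H = hom_ext (\<lambda>v. case v of H_a \<mu> \<nu> \<Rightarrow> translation_part \<mu> \<nu> | H_det_inv \<Rightarrow> 1)"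

lemma F_GL_eq: "F_GL \<theta> h g = F_C4 \<theta> (transl h) (transl g)"
  by (simp add: F_GL_def transl_def Let_def)

lemma det_translation_part: "det (\<chi> \<mu> \<nu>. translation_part \<mu> \<nu>) = 1"
  by (simp add: det_4 translation_part_def)

lemma transl_relations:
  "r \<in> relations \<Longrightarrow> aeval (\<lambda>v. case v of GL_a \<mu> \<nu> \<Rightarrow> translation_part \<mu> \<nu> | GL_det_inv \<Rightarrow> 1) r = 0"
  by (simp add: relations_GL_gen_def aeval_diff aeval_mult aeval_det aeval_var aeval_1 det_translation_part)

lemma transl_H_relations:
  "r \<in> relations \<Longrightarrow> aeval (\<lambda>v. case v of H_a \<mu> \<nu> \<Rightarrow> translation_part \<mu> \<nu> | H_det_inv \<Rightarrow> 1) r = 0"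
  by (auto simp: relations_H_gen_def aeval_diff aeval_mult aeval_det aeval_var aeval_1 det_translation_part)
    (simp_all add: translation_part_def)

lemma calg_hom_transl: "calg_hom transl"
  unfolding transl_def by (rule calg_hom_hom_ext) (rule transl_relations)

lemma calg_hom_transl_H: "calg_hom transl_H"
  unfolding transl_H_def by (rule calg_hom_hom_ext) (rule transl_H_relations)

lemma transl_gen: "transl (a_GL \<mu> \<nu>) = translation_part \<mu> \<nu>" "transl (gen GL_det_inv) = 1"
  by (simp_all add: transl_def hom_ext_simps(1)[OF transl_relations])

text \<open>Through this factorization the inverse cocycle sees the third legs of a twisted product
  only after projection to H, which is where invariance gives information.\<close>

lemma transl_H_proj_H: "transl_H (proj_H h) = transl h"
proof (rule calg_hom_presented_eqI[where x = h])
  show "calg_hom (\<lambda>h. transl_H (proj_H h))" by (rule calg_hom_comp[OF calg_hom_transl_H calg_hom_proj_H])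
  show "transl_H (proj_H (gen v)) = transl (gen v)" for v
    by (cases v) (simp_all add: proj_H_gen transl_gen transl_H_def hom_ext_simps(1)[OF transl_H_relations])
qed (rule calg_hom_transl)

text \<open>Block matrices with identity diagonal blocks and only an upper right block multiply by
  adding that block. Hence \<open>transl\<close> respects the coproducts.\<close>

lemma add_comult_transl: "add_comult (transl h) = map_tensor transl transl (comult GL4 h)"
proof (rule calg_hom_presented_eqI[where x = h])
  note lin = calg_hom_clinear[OF calg_hom_transl]
  show "calg_hom (\<lambda>h. add_comult (transl h))" by (rule calg_hom_comp[OF calg_hom_add_comult calg_hom_transl])
  show "calg_hom (\<lambda>h. map_tensor transl transl (comult GL4 h))"
    by (rule calg_hom_comp[OF calg_hom_map_tensor[OF calg_hom_transl calg_hom_transl] calg_hom_comult_GL4])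
  have add: "add_comult (translation_part \<mu> \<nu>) = (\<Sum>\<alpha>\<in>UNIV. translation_part \<mu> \<alpha> \<otimes> translation_part \<alpha> \<nu>)" for \<mu> \<nu>
    using exhaust_4[of \<mu>] exhaust_4[of \<nu>]
    by (elim disjE) (simp_all add: sum_4 translation_part_def calg_homD[OF calg_hom_add_comult]
        add_comult_var tens_linear one_tensor_def add.commute)
  show "add_comult (transl (gen v)) = map_tensor transl transl (comult GL4 (gen v))" for v
    by (cases v) (simp_all add: transl_gen add comult_GL4_gen clinear_sum[OF clinear_map_tensor[OF lin lin]]
        map_tensor_tens[OF lin lin] calg_homD[OF calg_hom_add_comult] one_tensor_def)
qed

lemma eval_zero_transl: "eval_zero (transl h) = counit GL4 h"
proof (rule calg_hom_presented_eqI[where x = h])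
  show "calg_hom (\<lambda>h. eval_zero (transl h))" by (rule calg_hom_comp[OF calg_hom_eval_zero calg_hom_transl])
  have "eval_zero (translation_part \<mu> \<nu>) = (if \<mu> = \<nu> then 1 else 0)" for \<mu> \<nu>
    by (auto simp: translation_part_def calg_homD[OF calg_hom_eval_zero]) (simp_all add: eval_zero_def aeval_var)
  then show "eval_zero (transl (gen v)) = counit GL4 (gen v)" for v
    by (cases v) (simp_all add: transl_gen counit_GL4_gen calg_homD[OF calg_hom_eval_zero])
qed (rule calg_hom_counit_GL4)

definition antipode_C4 :: "C4_gen mpoly \<Rightarrow> C4_gen mpoly"
  where "antipode_C4 = aeval (\<lambda>i. - var i)"

lemma calg_hom_antipode_C4: "calg_hom antipode_C4"
  unfolding antipode_C4_def by (rule calg_hom_aeval)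

text \<open>\<open>F_C4_mult\<close>, read from right to left, absorbs the coproduct of
  \<open>g\<close>. What is left is the convolution of \<open>f\<close> and \<open>f'\<close> as
  maps into the polynomial algebra.\<close>

lemma convolution_F_C4:
  assumes "clinear f" "clinear f'"
  shows "convolution GL4 (\<lambda>h g. F_C4 \<theta> (f h) (transl g)) (\<lambda>h g. F_C4 \<theta> (f' h) (transl g)) h g =
    F_C4 \<theta> (tensor_ext (\<lambda>h1 h2. f h1 * f' h2) (comult GL4 h)) (transl g)"
proof -
  note lin = calg_hom_clinear[OF calg_hom_transl]
  have "tensor_ext (\<lambda>g1 g2. F_C4 \<theta> p (transl g1) * F_C4 \<theta> p' (transl g2)) (comult GL4 g) = F_C4 \<theta> (p * p') (transl g)" for p p'
    by (simp add: F_C4_mult add_comult_transl tensor_ext_map_tensor[OF bilin_F_mult lin lin])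
  then show ?thesis
    by (simp add: convolution_def clinear_o_tensor_ext[OF F_C4_clinear(2)])
qed

text \<open>The antipode law of the additive group, pulled back. All algebras being commutative,
  both sides are homomorphisms in \<open>h\<close>, so generators suffice.\<close>

lemma antipode_transl:
  "tensor_ext (\<lambda>h1 h2. transl h1 * antipode_C4 (transl h2)) (comult GL4 h) = counit GL4 h *\<^sub>C 1" (is "?L = _")
  "tensor_ext (\<lambda>h1 h2. antipode_C4 (transl h1) * transl h2) (comult GL4 h) = counit GL4 h *\<^sub>C 1" (is "?R = _")
proof -
  note tr = calg_hom_transl and anti = calg_hom_comp[OF calg_hom_antipode_C4 calg_hom_transl]
  have B: "bilin (\<lambda>h1 h2. transl h1 * antipode_C4 (transl h2))" "bilin (\<lambda>h1 h2. antipode_C4 (transl h1) * transl h2)"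
    by (rule bilin_hom_mult[OF calg_hom_clinear[OF tr] calg_hom_clinear[OF anti]]
        bilin_hom_mult[OF calg_hom_clinear[OF anti] calg_hom_clinear[OF tr]])+
  have e: "calg_hom (\<lambda>h. counit GL4 h *\<^sub>C (1 :: C4_gen mpoly))"
    by (rule calg_homI) (simp_all add: calg_homD[OF calg_hom_counit_GL4] scaleC_one scaleC_add_left
        scaleC_mult_left scaleC_mult_right scaleC_scaleC scaleC_complex_def)
  have gens: "(\<Sum>\<alpha>\<in>UNIV. translation_part \<mu> \<alpha> * antipode_C4 (translation_part \<alpha> \<nu>)) = (if \<mu> = \<nu> then 1 else 0)"
    "(\<Sum>\<alpha>\<in>UNIV. antipode_C4 (translation_part \<mu> \<alpha>) * translation_part \<alpha> \<nu>) = (if \<mu> = \<nu> then 1 else 0)" for \<mu> \<nu>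
  proof -
    have v: "antipode_C4 (var i) = - var i" for i by (simp add: antipode_C4_def aeval_var)
    show "(\<Sum>\<alpha>\<in>UNIV. translation_part \<mu> \<alpha> * antipode_C4 (translation_part \<alpha> \<nu>)) = (if \<mu> = \<nu> then 1 else 0)"
      "(\<Sum>\<alpha>\<in>UNIV. antipode_C4 (translation_part \<mu> \<alpha>) * translation_part \<alpha> \<nu>) = (if \<mu> = \<nu> then 1 else 0)"
      using exhaust_4[of \<mu>] exhaust_4[of \<nu>]
      by (elim disjE; simp add: sum_4 translation_part_def calg_homD[OF calg_hom_antipode_C4] v)+
  qed
  show "?L = counit GL4 h *\<^sub>C 1"
  proof (rule calg_hom_presented_eqI[where x = h, OF _ e])
    show "calg_hom (\<lambda>h. tensor_ext (\<lambda>h1 h2. transl h1 * antipode_C4 (transl h2)) (comult GL4 h))"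
      by (rule calg_hom_comp[OF calg_hom_tensor_ext[OF tr anti] calg_hom_comult_GL4])
    show "tensor_ext (\<lambda>h1 h2. transl h1 * antipode_C4 (transl h2)) (comult GL4 (gen v)) = counit GL4 (gen v) *\<^sub>C 1" for v
      by (cases v) (simp_all add: comult_GL4_gen counit_GL4_gen clinear_sum[OF clinear_tensor_ext[OF B(1)]]
          tensor_ext_tens[OF B(1)] transl_gen gens calg_homD[OF calg_hom_antipode_C4] scaleC_one)
  qed
  show "?R = counit GL4 h *\<^sub>C 1"
  proof (rule calg_hom_presented_eqI[where x = h, OF _ e])
    show "calg_hom (\<lambda>h. tensor_ext (\<lambda>h1 h2. antipode_C4 (transl h1) * transl h2) (comult GL4 h))"
      by (rule calg_hom_comp[OF calg_hom_tensor_ext[OF anti tr] calg_hom_comult_GL4])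
    show "tensor_ext (\<lambda>h1 h2. antipode_C4 (transl h1) * transl h2) (comult GL4 (gen v)) = counit GL4 (gen v) *\<^sub>C 1" for v
      by (cases v) (simp_all add: comult_GL4_gen counit_GL4_gen clinear_sum[OF clinear_tensor_ext[OF B(2)]]
          tensor_ext_tens[OF B(2)] transl_gen gens calg_homD[OF calg_hom_antipode_C4] scaleC_one)
  qed
qed

definition F_inv :: "(4 \<Rightarrow> 4 \<Rightarrow> 4 \<Rightarrow> 4 \<Rightarrow> complex) \<Rightarrow> GL_gen presented \<Rightarrow> GL_gen presented \<Rightarrow> complex"
  where "F_inv \<theta> h g = F_C4 \<theta> (antipode_C4 (transl h)) (transl g)"

lemma bilin_pullback: "bilin B \<Longrightarrow> clinear f \<Longrightarrow> clinear g \<Longrightarrow> bilin (\<lambda>a b. B (f a) (g b))"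
  by (rule bilinI) (simp_all add: bilinD clinearD)

lemma bilin_F_GL: "bilin (F_GL \<theta>)"
  using bilin_pullback[OF bilin_F_C4 calg_hom_clinear[OF calg_hom_transl] calg_hom_clinear[OF calg_hom_transl]]
  by (simp add: F_GL_eq[abs_def])

lemma bilin_F_inv: "bilin (F_inv \<theta>)"
  using bilin_pullback[OF bilin_F_C4 calg_hom_clinear[OF calg_hom_comp[OF calg_hom_antipode_C4 calg_hom_transl]]
      calg_hom_clinear[OF calg_hom_transl]]
  by (simp add: F_inv_def[abs_def])

lemma convolution_F_inv:
  "convolution GL4 (F_GL \<theta>) (F_inv \<theta>) = (\<lambda>h g. counit GL4 h * counit GL4 g)"
  "convolution GL4 (F_inv \<theta>) (F_GL \<theta>) = (\<lambda>h g. counit GL4 h * counit GL4 g)"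
proof -
  note lin = calg_hom_clinear[OF calg_hom_transl]
    calg_hom_clinear[OF calg_hom_comp[OF calg_hom_antipode_C4 calg_hom_transl]]
  show "convolution GL4 (F_GL \<theta>) (F_inv \<theta>) = (\<lambda>h g. counit GL4 h * counit GL4 g)"
    "convolution GL4 (F_inv \<theta>) (F_GL \<theta>) = (\<lambda>h g. counit GL4 h * counit GL4 g)"
    by (simp_all add: fun_eq_iff F_GL_eq[abs_def] F_inv_def[abs_def] convolution_F_C4 lin antipode_transl
        clinearD(2)[OF F_C4_clinear(2)] F_C4_1 eval_zero_transl scaleC_complex_def)
qed


section \<open>The twisted product on invariants\<close>

lemma tensor_ext_tensor_ext_bilin:
  assumes "\<And>x. bilin (B x)" "\<And>a b. clinear (\<lambda>x. B x a b)"
  shows "bilin (\<lambda>x u. tensor_ext (B x) u)" "bilin (\<lambda>u x. tensor_ext (B x) u)"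
proof -
  have "clinear (tensor_ext (B x))" "clinear (\<lambda>x. tensor_ext (B x) u)" for x u
    by (rule clinear_tensor_ext[OF assms(1)], rule clinear_tensor_ext_fun[OF assms(2)])
  then show "bilin (\<lambda>x u. tensor_ext (B x) u)" "bilin (\<lambda>u x. tensor_ext (B x) u)"
    by (simp_all add: bilin_def)
qed

text \<open>The two bracketings of a triple tensor product are different types, so coassociativity
  is stated through this associator.\<close>

definition reassoc :: "('a::calg, ('b::calg, 'c::calg) tensor) tensor \<Rightarrow> (('a, 'b) tensor, 'c) tensor"
  where "reassoc = tensor_ext (\<lambda>a t. tensor_ext (\<lambda>b c. (a \<otimes> b) \<otimes> c) t)"

lemma bilin_reassoc: "bilin (\<lambda>b c. (a \<otimes> b) \<otimes> c)" "bilin (\<lambda>a t. tensor_ext (\<lambda>b c. (a \<otimes> b) \<otimes> c) t)"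
proof -
  show B: "bilin (\<lambda>b c. (a \<otimes> b) \<otimes> c)" for a
    by (rule bilinI) (simp_all add: bilinD[OF bilin_tens])
  show "bilin (\<lambda>a t. tensor_ext (\<lambda>b c. (a \<otimes> b) \<otimes> c) t)"
    by (rule tensor_ext_tensor_ext_bilin[OF B]) (rule clinearI; simp add: bilinD[OF bilin_tens])
qed

lemma reassoc_tens: "reassoc (a \<otimes> (b \<otimes> c)) = (a \<otimes> b) \<otimes> c"
  by (simp add: reassoc_def tensor_ext_tens[OF bilin_reassoc(2)] tensor_ext_tens[OF bilin_reassoc(1)])

lemma clinear_reassoc: "clinear reassoc"
  unfolding reassoc_def by (rule clinear_tensor_ext[OF bilin_reassoc(2)])

lemma calg_hom_reassoc: "calg_hom reassoc"
proof (rule tensor_calg_homI[OF clinear_reassoc])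
  show "reassoc (1 \<otimes> 1) = 1" by (simp add: reassoc_tens one_tensor_def)
  note z = tens_linear clinear_0[OF clinear_reassoc] clinearD[OF clinear_reassoc] bilinD[OF bilin_tens]
  show "reassoc ((a * c) \<otimes> (t * u)) = reassoc (a \<otimes> t) * reassoc (c \<otimes> u)" for a c t u
  proof (induction t rule: tensor_induct)
    case (tens b d)
    show ?case
      by (induction u rule: tensor_induct)
        (simp_all add: reassoc_tens tensor_mult_tens z distrib_left)
  qed (simp_all add: z distrib_right)
qed

lemma coassoc_GL4: "map_tensor (comult GL4) id (comult GL4 h) = reassoc (map_tensor id (comult GL4) (comult GL4 h))"
proof (rule calg_hom_presented_eqI[where x = h])
  note D = calg_hom_comult_GL4 and lin = calg_hom_clinear[OF calg_hom_comult_GL4]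
  show "calg_hom (\<lambda>h. map_tensor (comult GL4) id (comult GL4 h))"
    by (rule calg_hom_comp[OF calg_hom_map_tensor[OF D calg_hom_id] D])
  show "calg_hom (\<lambda>h. reassoc (map_tensor id (comult GL4) (comult GL4 h)))"
    by (rule calg_hom_comp[OF calg_hom_reassoc calg_hom_comp[OF calg_hom_map_tensor[OF calg_hom_id D] D]])
  show "map_tensor (comult GL4) id (comult GL4 (gen v)) = reassoc (map_tensor id (comult GL4) (comult GL4 (gen v)))" for v
  proof (cases v)
    case (GL_a \<mu> \<nu>)
    have "map_tensor (comult GL4) id (comult GL4 (gen v)) =
        (\<Sum>\<alpha>\<in>UNIV. \<Sum>\<beta>\<in>UNIV. (a_GL \<mu> \<beta> \<otimes> a_GL \<beta> \<alpha>) \<otimes> a_GL \<alpha> \<nu>)"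
      by (simp add: GL_a comult_GL4_gen clinear_sum[OF clinear_map_tensor[OF lin clinear_id]]
          map_tensor_tens[OF lin clinear_id] tens_sum)
    also have "\<dots> = (\<Sum>\<beta>\<in>UNIV. \<Sum>\<alpha>\<in>UNIV. (a_GL \<mu> \<beta> \<otimes> a_GL \<beta> \<alpha>) \<otimes> a_GL \<alpha> \<nu>)"
      by (rule sum.swap)
    also have "\<dots> = reassoc (map_tensor id (comult GL4) (comult GL4 (gen v)))"
      by (simp add: GL_a comult_GL4_gen clinear_sum[OF clinear_map_tensor[OF clinear_id lin]]
          map_tensor_tens[OF clinear_id lin] tens_sum clinear_sum[OF clinear_reassoc] reassoc_tens)
    finally show ?thesis .
  next
    case GL_det_inv
    then show ?thesis
      by (simp add: comult_GL4_gen map_tensor_tens[OF lin clinear_id] map_tensor_tens[OF clinear_id lin] reassoc_tens)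
  qed
qed

text \<open>Coassociativity for nested Sweedler sums: as \<open>T\<close> is trilinear, both sides
  are one linear map on the triple tensor product, applied to the two iterated coproducts.\<close>

lemma coassoc_GL4_sweedler:
  assumes "\<And>a. bilin (T a)" "\<And>b c. clinear (\<lambda>a. T a b c)"
  shows "tensor_ext (\<lambda>h' h3. tensor_ext (\<lambda>h1 h2. T h1 h2 h3) (comult GL4 h')) (comult GL4 h) =
    tensor_ext (\<lambda>h1 h'. tensor_ext (\<lambda>h2 h3. T h1 h2 h3) (comult GL4 h')) (comult GL4 h)"
proof -
  note lin = calg_hom_clinear[OF calg_hom_comult_GL4]
  have T3: "bilin (\<lambda>a b. T a b c)" "clinear (\<lambda>c. T a b c)" for a b c
    using assms unfolding bilin_def by auto
  define L where "L = tensor_ext (\<lambda>u c. tensor_ext (\<lambda>a b. T a b c) u)"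
  have B: "bilin (\<lambda>u c. tensor_ext (\<lambda>a b. T a b c) u)"
    by (rule tensor_ext_tensor_ext_bilin(2)[of "\<lambda>c a b. T a b c", OF T3])
  have L: "clinear L" unfolding L_def by (rule clinear_tensor_ext[OF B])
  have L_tens: "L ((a \<otimes> b) \<otimes> c) = T a b c" for a b c
    by (simp add: L_def tensor_ext_tens[OF B] tensor_ext_tens[OF T3(1)])
  have B': "bilin (\<lambda>a t. tensor_ext (\<lambda>b c. T a b c) t)"
    by (rule tensor_ext_tensor_ext_bilin(1)[OF assms])
  have "tensor_ext (\<lambda>h' h3. tensor_ext (\<lambda>h1 h2. T h1 h2 h3) (comult GL4 h')) (comult GL4 h) =
      L (map_tensor (comult GL4) id (comult GL4 h))"
    by (simp add: L_def tensor_ext_map_tensor[OF B lin clinear_id])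
  also have "\<dots> = L (reassoc (map_tensor id (comult GL4) (comult GL4 h)))"
    by (simp only: coassoc_GL4)
  also have "\<dots> = tensor_ext (\<lambda>a t. tensor_ext (\<lambda>b c. T a b c) t) (map_tensor id (comult GL4) (comult GL4 h))"
    by (simp add: reassoc_def clinear_o_tensor_ext[OF L] L_tens)
  also have "\<dots> = tensor_ext (\<lambda>h1 h'. tensor_ext (\<lambda>h2 h3. T h1 h2 h3) (comult GL4 h')) (comult GL4 h)"
    by (simp add: tensor_ext_map_tensor[OF B' clinear_id lin])
  finally show ?thesis .
qed

lemma counit_GL4_sweedler:
  "tensor_ext (\<lambda>h1 h2. counit GL4 h1 *\<^sub>C h2) (comult GL4 h) = h"
  "tensor_ext (\<lambda>h1 h2. counit GL4 h2 *\<^sub>C h1) (comult GL4 h) = h"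
proof -
  note e = calg_hom_counit_GL4
  have ident: "calg_hom (\<lambda>h :: GL_gen presented. h)" by (rule calg_homI) simp_all
  have B: "bilin (\<lambda>h1 h2. counit GL4 h2 *\<^sub>C h1 :: GL_gen presented)"
    by (rule bilinI) (simp_all add: calg_homD[OF e] scaleC_add_right scaleC_add_left scaleC_scaleC
        scaleC_complex_def mult.commute)
  have h: "calg_hom (tensor_ext (\<lambda>h1 h2. counit GL4 h2 *\<^sub>C h1 :: GL_gen presented))"
    by (rule tensor_calg_homI)
      (simp_all add: clinear_tensor_ext B tensor_ext_tens[OF B] calg_homD[OF e] scaleC_one
        scaleC_mult_left scaleC_mult_right scaleC_scaleC)
  have pick: "(\<Sum>\<alpha>\<in>UNIV. (if \<alpha> = \<nu> then 1 else 0 :: complex) *\<^sub>C f \<alpha>) = f \<nu>"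
    "(\<Sum>\<alpha>\<in>UNIV. (if \<nu> = \<alpha> then 1 else 0 :: complex) *\<^sub>C f \<alpha>) = f \<nu>" for \<nu> :: 4 and f :: "4 \<Rightarrow> GL_gen presented"
    by (simp_all add: if_distrib[of "\<lambda>c. c *\<^sub>C _"] scaleC_one cong: if_cong)
  show "tensor_ext (\<lambda>h1 h2. counit GL4 h1 *\<^sub>C h2) (comult GL4 h) = h"
  proof (rule calg_hom_presented_eqI[where x = h, OF _ ident])
    show "calg_hom (\<lambda>h. tensor_ext (\<lambda>h1 h2. counit GL4 h1 *\<^sub>C h2) (comult GL4 h))"
      by (rule calg_hom_comp[OF calg_hom_scale_hom[OF e] calg_hom_comult_GL4])
    show "tensor_ext (\<lambda>h1 h2. counit GL4 h1 *\<^sub>C h2) (comult GL4 (gen v)) = gen v" for v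
      by (cases v) (simp_all add: comult_GL4_gen clinear_sum[OF clinear_tensor_ext[OF bilin_scale_hom[OF e]]]
          tensor_ext_tens[OF bilin_scale_hom[OF e]] counit_GL4_gen pick scaleC_one)
  qed
  show "tensor_ext (\<lambda>h1 h2. counit GL4 h2 *\<^sub>C h1) (comult GL4 h) = h"
  proof (rule calg_hom_presented_eqI[where x = h, OF _ ident])
    show "calg_hom (\<lambda>h. tensor_ext (\<lambda>h1 h2. counit GL4 h2 *\<^sub>C h1) (comult GL4 h))"
      by (rule calg_hom_comp[OF h calg_hom_comult_GL4])
    show "tensor_ext (\<lambda>h1 h2. counit GL4 h2 *\<^sub>C h1) (comult GL4 (gen v)) = gen v" for v
      by (cases v) (simp_all add: comult_GL4_gen clinear_sum[OF clinear_tensor_ext[OF B]]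
          tensor_ext_tens[OF B] counit_GL4_gen pick scaleC_one)
  qed
qed

lemma convolution_counit:
  assumes "bilin G"
  shows "convolution GL4 (\<lambda>h g. counit GL4 h * counit GL4 g) G = G"
    "convolution GL4 G (\<lambda>h g. counit GL4 h * counit GL4 g) = G"
proof -
  have lin: "clinear (G h)" "clinear (\<lambda>h. G h g)" for h g
    using assms by (auto simp: bilin_def)
  have "convolution GL4 (\<lambda>h g. counit GL4 h * counit GL4 g) G h g =
      G (tensor_ext (\<lambda>h1 h2. counit GL4 h1 *\<^sub>C h2) (comult GL4 h)) (tensor_ext (\<lambda>h1 h2. counit GL4 h1 *\<^sub>C h2) (comult GL4 g))" for h g
    unfolding clinear_o_tensor_ext[OF lin(2)] bilinD(4)[OF assms]
    by (simp add: convolution_def clinear_o_tensor_ext[OF lin(1)] bilinD(2)[OF assms] scaleC_complex_def mult.assoc tensor_ext_mult_fun)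
  then show "convolution GL4 (\<lambda>h g. counit GL4 h * counit GL4 g) G = G"
    by (simp add: fun_eq_iff counit_GL4_sweedler)
  have "convolution GL4 G (\<lambda>h g. counit GL4 h * counit GL4 g) h g =
      G (tensor_ext (\<lambda>h1 h2. counit GL4 h2 *\<^sub>C h1) (comult GL4 h)) (tensor_ext (\<lambda>h1 h2. counit GL4 h2 *\<^sub>C h1) (comult GL4 g))" for h g
    unfolding clinear_o_tensor_ext[OF lin(2)] bilinD(4)[OF assms]
    by (simp add: convolution_def clinear_o_tensor_ext[OF lin(1)] bilinD(2)[OF assms] scaleC_complex_def mult.left_commute mult.commute[of "G _ _"] tensor_ext_mult_fun)
  then show "convolution GL4 G (\<lambda>h g. counit GL4 h * counit GL4 g) = G"
    by (simp add: fun_eq_iff counit_GL4_sweedler)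
qed

lemma clinear_mult_fun:
  "clinear f \<Longrightarrow> clinear (\<lambda>x. f x * c :: complex)" "clinear f \<Longrightarrow> clinear (\<lambda>x. c * f x :: complex)"
  by (rule clinearI; simp add: clinearD ring_distribs scaleC_complex_def)+

text \<open>With the counit laws this makes bilinear forms a monoid under convolution. Inverses
  there are unique, which resolves the definite description in \<open>conv_inverse\<close>.\<close>

lemma convolution_assoc:
  assumes "bilin F" "bilin G" "bilin H"
  shows "convolution GL4 (convolution GL4 F G) H = convolution GL4 F (convolution GL4 G H)"
proof (intro ext)
  fix h g
  let ?D = "comult GL4"
  have lin: "clinear (F h)" "clinear (\<lambda>h. F h g)" "clinear (G h)" "clinear (\<lambda>h. G h g)"
    "clinear (H h)" "clinear (\<lambda>h. H h g)" for h g
    using assms by (auto simp: bilin_def)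
  define T where "T h1 h2 h3 g1 g2 g3 = F h1 g1 * G h2 g2 * H h3 g3" for h1 h2 h3 g1 g2 g3
  have Tg: "bilin (T h1 h2 h3 g1)" "clinear (\<lambda>g1. T h1 h2 h3 g1 g2 g3)" for h1 h2 h3 g1 g2 g3
    unfolding T_def bilin_def by (auto intro!: clinear_mult_fun lin)
  have Th: "clinear (\<lambda>h1. T h1 h2 h3 g1 g2 g3)" "clinear (\<lambda>h2. T h1 h2 h3 g1 g2 g3)"
    "clinear (\<lambda>h3. T h1 h2 h3 g1 g2 g3)" for h1 h2 h3 g1 g2 g3
    unfolding T_def by (auto intro!: clinear_mult_fun lin)
  \<comment> \<open>\<open>X\<close> gathers all sums over legs of \<open>g\<close>, so that
    coassociativity is applied first in \<open>g\<close> and then, with \<open>X\<close> as the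
    trilinear map, in \<open>h\<close>.\<close>
  define X where "X h1 h2 h3 = tensor_ext (\<lambda>g1 g'. tensor_ext (\<lambda>g2 g3. T h1 h2 h3 g1 g2 g3) (?D g')) (?D g)" for h1 h2 h3
  have X: "bilin (X h1)" "clinear (\<lambda>h1. X h1 h2 h3)" for h1 h2 h3
    unfolding X_def bilin_def by (auto intro!: clinear_tensor_ext_fun Th)
  have "convolution GL4 (convolution GL4 F G) H h g =
     tensor_ext (\<lambda>h' h3. tensor_ext (\<lambda>g' g3. tensor_ext (\<lambda>h1 h2. tensor_ext (\<lambda>g1 g2. T h1 h2 h3 g1 g2 g3) (?D g')) (?D h')) (?D g)) (?D h)"
    by (simp add: convolution_def T_def tensor_ext_mult_fun)
  also have "\<dots> = tensor_ext (\<lambda>h' h3. tensor_ext (\<lambda>h1 h2. X h1 h2 h3) (?D h')) (?D h)"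
    by (subst tensor_ext_fubini) (simp add: X_def coassoc_GL4_sweedler[OF Tg])
  also have "\<dots> = tensor_ext (\<lambda>h1 h'. tensor_ext (\<lambda>h2 h3. X h1 h2 h3) (?D h')) (?D h)"
    by (rule coassoc_GL4_sweedler[OF X])
  also have "\<dots> = tensor_ext (\<lambda>h1 h'. tensor_ext (\<lambda>g1 g'. tensor_ext (\<lambda>h2 h3. tensor_ext (\<lambda>g2 g3. T h1 h2 h3 g1 g2 g3) (?D g')) (?D h')) (?D g)) (?D h)"
    unfolding X_def by (subst tensor_ext_fubini) (rule refl)
  also have "\<dots> = convolution GL4 F (convolution GL4 G H) h g"
    by (simp add: convolution_def T_def tensor_ext_mult_fun mult.assoc)
  finally show "convolution GL4 (convolution GL4 F G) H h g = convolution GL4 F (convolution GL4 G H) h g" .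
qed

lemma conv_inverse_F_GL: "conv_inverse GL4 (F_GL \<theta>) = F_inv \<theta>"
  unfolding conv_inverse_def
proof (rule the_equality)
  show "bilin (F_inv \<theta>) \<and> convolution GL4 (F_GL \<theta>) (F_inv \<theta>) = (\<lambda>h g. counit GL4 h * counit GL4 g) \<and>
      convolution GL4 (F_inv \<theta>) (F_GL \<theta>) = (\<lambda>h g. counit GL4 h * counit GL4 g)"
    by (simp add: bilin_F_inv convolution_F_inv)
next
  fix G
  assume G: "bilin G \<and> convolution GL4 (F_GL \<theta>) G = (\<lambda>h g. counit GL4 h * counit GL4 g) \<and>
      convolution GL4 G (F_GL \<theta>) = (\<lambda>h g. counit GL4 h * counit GL4 g)"
  have "G = convolution GL4 G (convolution GL4 (F_GL \<theta>) (F_inv \<theta>))"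
    using G by (simp add: convolution_F_inv convolution_counit)
  also have "\<dots> = convolution GL4 (convolution GL4 G (F_GL \<theta>)) (F_inv \<theta>)"
    using G by (intro convolution_assoc[symmetric] bilin_F_GL bilin_F_inv) simp
  also have "\<dots> = F_inv \<theta>"
    using G by (simp add: convolution_counit bilin_F_inv)
  finally show "G = F_inv \<theta>" .
qed

text \<open>\<open>comult2\<close> applies the coproduct to the first leg of
  \<open>comult GL4 h\<close>. Invariance turns the other leg into 1 after projection and restores
  \<open>h\<close> itself in the first.\<close>

lemma comult2_invariant:
  assumes h: "map_tensor id proj_H (comult GL4 h) = h \<otimes> 1"
    and B: "bilin (B :: (GL_gen presented, GL_gen presented) tensor \<Rightarrow> H_gen presented \<Rightarrow> 'c::cvec)"
  shows "tensor_ext (\<lambda>u h3. B u (proj_H h3)) (comult2 GL4 h) = B (comult GL4 h) 1"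
proof -
  note D = calg_hom_clinear[OF calg_hom_comult_GL4] and pr = calg_hom_clinear[OF calg_hom_proj_H]
  have B': "bilin (\<lambda>u h3. B u (proj_H h3))" "bilin (\<lambda>a y. B (comult GL4 a) y)"
    by (rule bilinI; simp add: bilinD[OF B] clinearD[OF pr] clinearD[OF D])+
  have "tensor_ext (\<lambda>u h3. B u (proj_H h3)) (comult2 GL4 h) =
      tensor_ext (\<lambda>a b. B (comult GL4 a) (proj_H b)) (comult GL4 h)"
    by (simp add: comult2_def tensor_ext_map_tensor[OF B'(1) D clinear_id])
  also have "\<dots> = tensor_ext (\<lambda>a y. B (comult GL4 a) y) (map_tensor id proj_H (comult GL4 h))"
    by (simp add: tensor_ext_map_tensor[OF B'(2) clinear_id pr])
  also have "\<dots> = B (comult GL4 h) 1"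
    by (simp only: h tensor_ext_tens[OF B'(2)])
  finally show ?thesis .
qed

lemma clinear_scale_vec: "clinear f \<Longrightarrow> clinear (\<lambda>x. f x *\<^sub>C v)"
  by (rule clinearI) (simp_all add: clinearD scaleC_add_left scaleC_scaleC scaleC_complex_def)

lemma bilin_twist_term:
  fixes h2 g2 :: "GL_gen presented"
  shows "bilin (\<lambda>h1 h2. (F_GL \<theta> h1 g1 * c) *\<^sub>C (h2 * g2))" "bilin (\<lambda>g1 g2. (F_GL \<theta> h1 g1 * c) *\<^sub>C (h2 * g2))"
  by (rule bilinI; simp add: bilinD[OF bilin_F_GL] ring_distribs scaleC_add_left scaleC_add_right scaleC_scaleC
      scaleC_mult_left scaleC_mult_right scaleC_complex_def mult_ac)+

lemma twist_on_invariants: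
  assumes h: "map_tensor id proj_H (comult GL4 h) = h \<otimes> 1"
    and g: "map_tensor id proj_H (comult GL4 g) = g \<otimes> 1"
  shows "amult (GL4_F \<theta>) h g =
    tensor_ext (\<lambda>h1 h2. tensor_ext (\<lambda>g1 g2. F_GL \<theta> h1 g1 *\<^sub>C (h2 * g2)) (comult GL4 g)) (comult GL4 h)"
proof -
  let ?S = "\<lambda>x. antipode_C4 (transl_H x)"
  have anti: "clinear ?S"
    by (rule calg_hom_clinear[OF calg_hom_comp[OF calg_hom_antipode_C4 calg_hom_transl_H]])
  have F1: "clinear (\<lambda>y. F_C4 \<theta> p (transl_H y))" for p
    by (rule clinear_comp[OF F_C4_clinear(1) calg_hom_clinear[OF calg_hom_transl_H]])
  have F2: "clinear (\<lambda>x. F_C4 \<theta> (?S x) q)" for q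
    by (rule clinear_comp[OF F_C4_clinear(2) anti])
  have Finv: "F_inv \<theta> x y = F_C4 \<theta> (?S (proj_H x)) (transl_H (proj_H y))" for x y
    by (simp add: F_inv_def transl_H_proj_H)
  \<comment> \<open>The third leg of \<open>g\<close> is replaced by 1 while that of
    \<open>h\<close> is still present. Doing the same for \<open>h\<close> leaves
    \<open>F_C4 \<theta> 1 1\<close> from the inverse cocycle, which is 1.\<close>
  have inner: "tensor_ext (\<lambda>g12 g3. tensor_ext (\<lambda>g1 g2. (F_GL \<theta> h1 g1 * F_inv \<theta> h3 g3) *\<^sub>C (h2 * g2)) g12) (comult2 GL4 g) =
     tensor_ext (\<lambda>g1 g2. (F_GL \<theta> h1 g1 * F_C4 \<theta> (?S (proj_H h3)) 1) *\<^sub>C (h2 * g2)) (comult GL4 g)" for h1 h2 h3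
  proof -
    have "bilin (\<lambda>u y. tensor_ext (\<lambda>g1 g2. (F_GL \<theta> h1 g1 * F_C4 \<theta> (?S (proj_H h3)) (transl_H y)) *\<^sub>C (h2 * g2)) u)"
      by (rule tensor_ext_tensor_ext_bilin(2)[OF bilin_twist_term(2)])
        (intro clinear_scale_vec clinear_mult_fun(2) F1)
    from comult2_invariant[OF g this] show ?thesis
      by (simp add: Finv calg_homD[OF calg_hom_transl_H])
  qed
  have "bilin (\<lambda>u x. tensor_ext (\<lambda>h1 h2.
      tensor_ext (\<lambda>g1 g2. (F_GL \<theta> h1 g1 * F_C4 \<theta> (?S x) 1) *\<^sub>C (h2 * g2)) (comult GL4 g)) u)"
  proof (rule tensor_ext_tensor_ext_bilin(2))
    show "bilin (\<lambda>h1 h2. tensor_ext (\<lambda>g1 g2. (F_GL \<theta> h1 g1 * F_C4 \<theta> (?S x) 1) *\<^sub>C (h2 * g2)) (comult GL4 g))" for x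
      unfolding bilin_def
    proof (intro conjI allI)
      show "clinear (\<lambda>h2. tensor_ext (\<lambda>g1 g2. (F_GL \<theta> h1 g1 * F_C4 \<theta> (?S x) 1) *\<^sub>C (h2 * g2)) (comult GL4 g))" for h1
        by (rule clinear_tensor_ext_fun) (use bilin_twist_term(1) in \<open>simp add: bilin_def\<close>)
      show "clinear (\<lambda>h1. tensor_ext (\<lambda>g1 g2. (F_GL \<theta> h1 g1 * F_C4 \<theta> (?S x) 1) *\<^sub>C (h2 * g2)) (comult GL4 g))" for h2
        by (rule clinear_tensor_ext_fun) (use bilin_twist_term(1) in \<open>simp add: bilin_def\<close>)
    qed
    show "clinear (\<lambda>x. tensor_ext (\<lambda>g1 g2. (F_GL \<theta> h1 g1 * F_C4 \<theta> (?S x) 1) *\<^sub>C (h2 * g2)) (comult GL4 g))" for h1 h2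
      by (rule clinear_tensor_ext_fun) (intro clinear_scale_vec clinear_mult_fun(2) F2)
  qed
  from comult2_invariant[OF h this]
  have "tensor_ext (\<lambda>u h3. tensor_ext (\<lambda>h1 h2.
      tensor_ext (\<lambda>g1 g2. (F_GL \<theta> h1 g1 * F_C4 \<theta> (?S (proj_H h3)) 1) *\<^sub>C (h2 * g2)) (comult GL4 g)) u) (comult2 GL4 h) =
    tensor_ext (\<lambda>h1 h2. tensor_ext (\<lambda>g1 g2. F_GL \<theta> h1 g1 *\<^sub>C (h2 * g2)) (comult GL4 g)) (comult GL4 h)"
    by (simp add: calg_homD[OF calg_hom_transl_H] calg_homD[OF calg_hom_antipode_C4] F_C4_1 calg_homD[OF calg_hom_eval_zero])
  moreover have "amult GL4 = (*)" by (simp add: GL4_def)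
  ultimately show ?thesis
    by (simp add: GL4_F_def twist_def conv_inverse_F_GL inner)
qed

text \<open>Once \<open>comult_minors\<close> rewrites the coproducts of minors as coactions, both
  products are the same double Sweedler sum weighted by \<open>F_GL\<close>.\<close>

lemma minors_CM_F:
  "minors (amult (CM_F \<theta>) a b) = amult (GL4_F \<theta>) (minors a) (minors b)"
proof -
  note m = calg_hom_clinear[OF calg_hom_minors]
  have B1: "bilin (\<lambda>h1 h2. F_GL \<theta> x h1 *\<^sub>C (y * h2))" for x and y :: "GL_gen presented"
    using bilin_twist_term(2)[of \<theta> x 1 y] by simp
  have lin: "clinear (\<lambda>h2. F_GL \<theta> h1 g1 *\<^sub>C (h2 * g2))" "clinear (\<lambda>h1. F_GL \<theta> h1 g1 *\<^sub>C (h2 * g2))"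
    for h1 g1 and h2 g2 :: "GL_gen presented"
    using bilin_twist_term(1)[of \<theta> g1 1 g2] by (simp_all add: bilin_def)
  have B2: "bilin (\<lambda>h1 h2. tensor_ext (\<lambda>g1 g2. F_GL \<theta> h1 g1 *\<^sub>C (h2 * g2)) t)" for t :: "(GL_gen presented, GL_gen presented) tensor"
    unfolding bilin_def by (intro conjI allI clinear_tensor_ext_fun lin)
  have "minors (amult (CM_F \<theta>) a b) =
      tensor_ext (\<lambda>a1 a2. tensor_ext (\<lambda>b1 b2. F_GL \<theta> a1 b1 *\<^sub>C (minors a2 * minors b2)) (coact_CM b)) (coact_CM a)"
    by (simp add: CM_F_def twist_comodule_algebra_def CM_def clinear_o_tensor_ext[OF m] calg_homD[OF calg_hom_minors])
  also have "\<dots> = amult (GL4_F \<theta>) (minors a) (minors b)"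
    unfolding twist_on_invariants[OF minors_invariant minors_invariant] comult_minors
    unfolding tensor_ext_map_tensor[OF B2 clinear_id m]
    unfolding tensor_ext_map_tensor[OF B1 clinear_id m] by simp
  finally show ?thesis .
qed

lemma CM_F_isomorphic:
  "isomorphic_to_subalgebra (CM_F \<theta>) (GL4_F \<theta>) (right_invariants (GL4_F \<theta>) (H4_F \<theta>) proj_H)"
proof -
  have inv: "right_invariants (GL4_F \<theta>) (H4_F \<theta>) proj_H = range minors"
    using right_invariants_eq_range_minors
    by (simp add: right_invariants_def GL4_F_def H4_F_def twist_def H4_def)
  have unit: "aunit (GL4_F \<theta>) = 1" "aunit (CM_F \<theta>) = 1"
    by (simp_all add: GL4_F_def twist_def GL4_def CM_F_def twist_comodule_algebra_def CM_def)
  note m = calg_homD[OF calg_hom_minors]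
  have "cvec.subspace (range minors)"
    unfolding cvec.subspace_def by (auto simp: m(5,3,4)[symmetric])
  then have "is_subalgebra (GL4_F \<theta>) (range minors)"
    by (auto simp: is_subalgebra_def unit m(1)[symmetric] minors_CM_F[symmetric])
  moreover have "bij_betw minors UNIV (range minors)"
  proof (rule inj_on_imp_bij_betw, rule injI)
    fix x y assume "minors x = minors y"
    then have "minors (x - y) = 0" by (simp add: m)
    then show "x = y" using minors_eq_0 by fastforce
  qed
  ultimately show ?thesis
    unfolding isomorphic_to_subalgebra_def inv
    using calg_hom_clinear[OF calg_hom_minors] minors_CM_F m(1) by (auto simp: unit)
qed


section \<open>The deformed product of generators\<close>

definition offdiag :: "4 \<Rightarrow> 4 \<Rightarrow> C4_gen mpoly" where
  "offdiag \<mu> \<alpha> = (if \<mu> \<in> {1, 2} \<and> \<alpha> \<in> {3, 4} then var (t_gen \<mu> \<alpha>) else 0)"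

lemma translation_part_eq: "translation_part \<mu> \<alpha> = (if \<mu> = \<alpha> then 1 else 0) + offdiag \<mu> \<alpha>"
  using exhaust_4[of \<mu>] exhaust_4[of \<alpha>] by (elim disjE) (simp_all add: translation_part_def offdiag_def)

text \<open>\<open>theta_deriv \<theta> \<mu> \<alpha>\<close> is adjoint to multiplication by \<open>offdiag \<mu> \<alpha>\<close> under the cocycle.\<close>

definition theta_deriv :: "(4 \<Rightarrow> 4 \<Rightarrow> 4 \<Rightarrow> 4 \<Rightarrow> complex) \<Rightarrow> 4 \<Rightarrow> 4 \<Rightarrow> C4_gen mpoly \<Rightarrow> C4_gen mpoly" where
  "theta_deriv \<theta> \<mu> \<alpha> q = (if \<mu> \<in> {1, 2} \<and> \<alpha> \<in> {3, 4}
     then \<Sum>j\<in>UNIV. theta_coeff \<theta> (t_gen \<mu> \<alpha>) j *\<^sub>C partial_deriv j q else 0)"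

lemma F_C4_offdiag_mult: "F_C4 \<theta> (offdiag \<mu> \<alpha> * p) q = F_C4 \<theta> p (theta_deriv \<theta> \<mu> \<alpha> q)"
  by (simp add: offdiag_def theta_deriv_def F_C4_var_mult clinear_sum[OF F_C4_clinear(1)]
      clinearD[OF F_C4_clinear(1)] clinear_0[OF F_C4_clinear(1)] clinear_0[OF F_C4_clinear(2)] scaleC_complex_def)

lemma clinear_theta_deriv: "clinear (theta_deriv \<theta> \<mu> \<alpha>)"
  unfolding theta_deriv_def
  by (rule clinearI) (simp_all add: clinearD[OF clinear_partial_deriv] scaleC_add_right sum.distrib
      cvec.scale_sum_right scaleC_scaleC mult.commute)

lemma theta_deriv_mult:
  "theta_deriv \<theta> \<mu> \<alpha> (p * q) = theta_deriv \<theta> \<mu> \<alpha> p * q + p * theta_deriv \<theta> \<mu> \<alpha> q"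
  by (simp add: theta_deriv_def partial_deriv_mult scaleC_add_right sum.distrib sum_distrib_left
      sum_distrib_right scaleC_mult_left scaleC_mult_right)

lemma theta_deriv_1: "theta_deriv \<theta> \<mu> \<alpha> 1 = 0"
  by (simp add: theta_deriv_def partial_deriv_1)

lemma eval_zero_offdiag: "eval_zero (offdiag \<kappa> \<gamma>) = 0"
  by (simp add: offdiag_def eval_zero_def aeval_var aeval_0)

definition block_supported :: "(4 \<Rightarrow> 4 \<Rightarrow> 4 \<Rightarrow> 4 \<Rightarrow> complex) \<Rightarrow> bool" where
  "block_supported \<theta> \<longleftrightarrow> (\<forall>\<mu> \<alpha> \<nu> \<beta>.
     \<not> (\<mu> \<in> {1, 2} \<and> \<alpha> \<in> {1, 2} \<and> \<nu> \<in> {3, 4} \<and> \<beta> \<in> {3, 4}) \<longrightarrow> \<theta> \<mu> \<alpha> \<nu> \<beta> = 0)"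

text \<open>Outside the block range the left side is zero by definition and the right side by the
  support condition. The formula thus holds for all indices, and case distinctions disappear from
  what follows.\<close>

lemma theta_deriv_offdiag:
  assumes \<theta>: "block_supported \<theta>"
  shows "theta_deriv \<theta> \<mu> \<alpha> (offdiag \<kappa> \<gamma>) = (\<i> / 2 * \<theta> \<mu> \<kappa> \<alpha> \<gamma>) *\<^sub>C 1"
proof (cases "\<mu> \<in> {1, 2} \<and> \<alpha> \<in> {3, 4} \<and> \<kappa> \<in> {1, 2} \<and> \<gamma> \<in> {3, 4}")
  case True
  have "theta_deriv \<theta> \<mu> \<alpha> (offdiag \<kappa> \<gamma>) =
      (\<Sum>j\<in>UNIV. if j = t_gen \<kappa> \<gamma> then theta_coeff \<theta> (t_gen \<mu> \<alpha>) j *\<^sub>C 1 else 0)"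
    using True unfolding theta_deriv_def offdiag_def
    by (simp add: partial_deriv_var if_distrib[of "scaleC _"] cong: if_cong)
  also have "\<dots> = theta_coeff \<theta> (t_gen \<mu> \<alpha>) (t_gen \<kappa> \<gamma>) *\<^sub>C 1"
    by (simp add: sum.delta[OF finite_C4_gen])
  also have "theta_coeff \<theta> (t_gen \<mu> \<alpha>) (t_gen \<kappa> \<gamma>) = \<i> / 2 * \<theta> \<mu> \<kappa> \<alpha> \<gamma>"
    by (rule theta_coeff_t_gen) (use True in auto)
  finally show ?thesis .
next
  case False
  then have "\<theta> \<mu> \<kappa> \<alpha> \<gamma> = 0" using \<theta> unfolding block_supported_def by blast
  moreover have "theta_deriv \<theta> \<mu> \<alpha> (offdiag \<kappa> \<gamma>) = 0"
    using False by (auto simp: theta_deriv_def offdiag_def clinear_0[OF clinear_partial_deriv])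
  ultimately show ?thesis by simp
qed

text \<open>Each factor is a Kronecker delta plus an off-diagonal part. By adjointness the
  off-diagonal parts of the first product act as derivations on the second, where the Leibniz rule
  yields four terms of first order and two of second order.\<close>

lemma F_GL_products:
  assumes \<theta>: "block_supported \<theta>"
  defines "d \<equiv> \<lambda>\<mu> \<alpha> :: 4. if \<mu> = \<alpha> then 1 else 0 :: complex"
  defines "t \<equiv> \<lambda>\<mu> \<kappa> \<alpha> \<gamma>. \<i> / 2 * \<theta> \<mu> \<kappa> \<alpha> \<gamma>"
  shows "F_GL \<theta> (a_GL \<mu> \<alpha> * a_GL \<nu> \<beta>) (a_GL \<kappa> \<gamma> * a_GL \<rho> \<delta>) =
    d \<mu> \<alpha> * (d \<nu> \<beta> * (d \<kappa> \<gamma> * d \<rho> \<delta>))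
    + (d \<nu> \<beta> * (d \<kappa> \<gamma> * t \<mu> \<rho> \<alpha> \<delta>) + d \<nu> \<beta> * (d \<rho> \<delta> * t \<mu> \<kappa> \<alpha> \<gamma>)
      + d \<mu> \<alpha> * (d \<kappa> \<gamma> * t \<nu> \<rho> \<beta> \<delta>) + d \<mu> \<alpha> * (d \<rho> \<delta> * t \<nu> \<kappa> \<beta> \<gamma>))
    + (t \<nu> \<kappa> \<beta> \<gamma> * t \<mu> \<rho> \<alpha> \<delta> + t \<nu> \<rho> \<beta> \<delta> * t \<mu> \<kappa> \<alpha> \<gamma>)"
proof -
  have T: "translation_part \<mu> \<alpha> = d \<mu> \<alpha> *\<^sub>C 1 + offdiag \<mu> \<alpha>" for \<mu> \<alpha>
    by (simp add: translation_part_eq d_def scaleC_one)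
  let ?Q = "translation_part \<kappa> \<gamma> * translation_part \<rho> \<delta>"
  have D: "theta_deriv \<theta> \<mu> \<alpha> (translation_part \<kappa> \<gamma>) = t \<mu> \<kappa> \<alpha> \<gamma> *\<^sub>C 1" for \<mu> \<alpha> \<kappa> \<gamma>
    by (simp add: T clinearD[OF clinear_theta_deriv] theta_deriv_1 theta_deriv_offdiag[OF \<theta>] t_def)
  have e: "eval_zero (translation_part \<kappa> \<gamma>) = d \<kappa> \<gamma>" for \<kappa> \<gamma>
    by (simp add: T calg_homD[OF calg_hom_eval_zero] eval_zero_offdiag scaleC_complex_def)
  have "translation_part \<mu> \<alpha> * translation_part \<nu> \<beta> = (d \<mu> \<alpha> * d \<nu> \<beta>) *\<^sub>C 1 + d \<mu> \<alpha> *\<^sub>C (offdiag \<nu> \<beta> * 1)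
      + d \<nu> \<beta> *\<^sub>C (offdiag \<mu> \<alpha> * 1) + offdiag \<mu> \<alpha> * (offdiag \<nu> \<beta> * 1)"
    by (simp add: T ring_distribs scaleC_mult_left scaleC_mult_right scaleC_scaleC ac_simps)
  then have "F_GL \<theta> (a_GL \<mu> \<alpha> * a_GL \<nu> \<beta>) (a_GL \<kappa> \<gamma> * a_GL \<rho> \<delta>) =
      (d \<mu> \<alpha> * d \<nu> \<beta>) * eval_zero ?Q + d \<mu> \<alpha> * eval_zero (theta_deriv \<theta> \<nu> \<beta> ?Q)
      + d \<nu> \<beta> * eval_zero (theta_deriv \<theta> \<mu> \<alpha> ?Q)
      + eval_zero (theta_deriv \<theta> \<nu> \<beta> (theta_deriv \<theta> \<mu> \<alpha> ?Q))"
    by (simp only: F_GL_eq calg_homD[OF calg_hom_transl] transl_gen clinearD[OF F_C4_clinear(2)]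
        F_C4_offdiag_mult F_C4_1 scaleC_complex_def)
  then show ?thesis
    by (simp add: theta_deriv_mult D calg_homD[OF calg_hom_eval_zero] e clinearD[OF clinear_theta_deriv]
        theta_deriv_1 scaleC_mult_left scaleC_mult_right scaleC_complex_def algebra_simps)
qed

lemma CM_F_product:
  "amult (CM_F \<theta>) (x_CM \<mu> \<nu>) (x_CM \<kappa> \<rho>) = (\<Sum>\<alpha>\<in>UNIV. \<Sum>\<beta>\<in>UNIV. \<Sum>\<gamma>\<in>UNIV. \<Sum>\<delta>\<in>UNIV.
     F_GL \<theta> (a_GL \<mu> \<alpha> * a_GL \<nu> \<beta>) (a_GL \<kappa> \<gamma> * a_GL \<rho> \<delta>) *\<^sub>C (x_CM \<alpha> \<beta> * x_CM \<gamma> \<delta>))"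
proof -
  have B1: "bilin (\<lambda>b1 b2. F_GL \<theta> a1 b1 *\<^sub>C (a2 * b2))" and B0: "bilin (\<lambda>a1 a2. F_GL \<theta> a1 b1 *\<^sub>C (a2 * b2))"
    for a1 b1 and a2 b2 :: "CM_gen presented"
    by (rule bilinI; simp add: bilinD[OF bilin_F_GL] ring_distribs scaleC_add_left scaleC_add_right scaleC_scaleC
        scaleC_mult_left scaleC_mult_right scaleC_complex_def mult_ac)+
  have B2: "bilin (\<lambda>a1 a2. tensor_ext (\<lambda>b1 b2. F_GL \<theta> a1 b1 *\<^sub>C (a2 * b2)) u)"
    for u :: "(GL_gen presented, CM_gen presented) tensor"
    using B0 unfolding bilin_def by (intro conjI allI clinear_tensor_ext_fun) blast+
  note lin1 = clinear_sum[OF clinear_tensor_ext[OF B1]] and lin2 = clinear_sum[OF clinear_tensor_ext[OF B2]]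
  show ?thesis
    by (simp add: CM_F_def twist_comodule_algebra_def CM_def coact_CM_x lin1 lin2 tensor_ext_tens[OF B1]
        tensor_ext_tens[OF B2])
qed

text \<open>Each Kronecker delta in \<open>F_GL_products\<close> contracts one of the four sums: all
  four in the undeformed term, two in the linear terms, none in the quadratic one.\<close>

lemma CM_F_product_formula:
  assumes \<theta>: "block_supported \<theta>"
  shows "amult (CM_F \<theta>) (x_CM \<mu> \<nu>) (x_CM \<alpha> \<beta>) =
        x_CM \<mu> \<nu> * x_CM \<alpha> \<beta>
        + (\<i> / 2) *\<^sub>C
          ((\<Sum>a\<in>UNIV. \<Sum>d\<in>UNIV. \<theta> \<mu> \<beta> a d *\<^sub>C (x_CM a \<nu> * x_CM \<alpha> d))
           + (\<Sum>a\<in>UNIV. \<Sum>c\<in>UNIV. \<theta> \<mu> \<alpha> a c *\<^sub>C (x_CM a \<nu> * x_CM c \<beta>))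
           + (\<Sum>b\<in>UNIV. \<Sum>d\<in>UNIV. \<theta> \<nu> \<beta> b d *\<^sub>C (x_CM \<mu> b * x_CM \<alpha> d))
           + (\<Sum>b\<in>UNIV. \<Sum>c\<in>UNIV. \<theta> \<nu> \<alpha> b c *\<^sub>C (x_CM \<mu> b * x_CM c \<beta>)))
        - (1 / 4) *\<^sub>C
          (\<Sum>a\<in>UNIV. \<Sum>b\<in>UNIV. \<Sum>c\<in>UNIV. \<Sum>d\<in>UNIV.
            (\<theta> \<nu> \<alpha> b c * \<theta> \<mu> \<beta> a d + \<theta> \<nu> \<beta> b d * \<theta> \<mu> \<alpha> a c) *\<^sub>C (x_CM a b * x_CM c d))"
proof -
  let ?d = "\<lambda>\<mu> \<alpha> :: 4. if \<mu> = \<alpha> then 1 else 0 :: complex"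
  let ?t = "\<lambda>\<mu> \<kappa> \<alpha> \<gamma>. \<i> / 2 * \<theta> \<mu> \<kappa> \<alpha> \<gamma>"
  let ?S = "\<lambda>f. \<Sum>a\<in>UNIV. \<Sum>b\<in>UNIV. \<Sum>c\<in>UNIV. \<Sum>d\<in>UNIV. f a b c d *\<^sub>C (x_CM a b * x_CM c d)"
  have add: "?S (\<lambda>a b c d. f a b c d + g a b c d) = ?S f + ?S g" for f g
    by (simp add: scaleC_add_left sum.distrib)
  have delta: "((if p = q then 1 else 0 :: complex) * z) *\<^sub>C y = (if p = q then z *\<^sub>C y else 0)"
      "(if p = q then 1 else 0 :: complex) *\<^sub>C y = (if p = q then y else 0)"
    for p q :: 4 and z and y :: "CM_gen presented"
    by (simp_all add: scaleC_one)
  have out: "(\<Sum>x\<in>UNIV. if p = q then f x else 0) = (if p = q then \<Sum>x\<in>UNIV. f x else 0)"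
    for p q :: 4 and f :: "4 \<Rightarrow> CM_gen presented"
    by simp
  note pick = delta out sum.delta sum.delta' finite UNIV_I if_True
  have scale: "(\<i> / 2 * z) *\<^sub>C y = (\<i> / 2) *\<^sub>C z *\<^sub>C y" for z and y :: "CM_gen presented"
    by (simp only: scaleC_scaleC)
  have 1: "?S (\<lambda>a b c d. ?d \<mu> a * (?d \<nu> b * (?d \<alpha> c * ?d \<beta> d))) = x_CM \<mu> \<nu> * x_CM \<alpha> \<beta>"
    by (simp only: pick)
  have 2: "?S (\<lambda>a b c d. ?d \<nu> b * (?d \<alpha> c * ?t \<mu> \<beta> a d)) =
      (\<i> / 2) *\<^sub>C (\<Sum>a\<in>UNIV. \<Sum>d\<in>UNIV. \<theta> \<mu> \<beta> a d *\<^sub>C (x_CM a \<nu> * x_CM \<alpha> d))"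
    by (simp only: pick scale cvec.scale_sum_right)
  have 3: "?S (\<lambda>a b c d. ?d \<nu> b * (?d \<beta> d * ?t \<mu> \<alpha> a c)) =
      (\<i> / 2) *\<^sub>C (\<Sum>a\<in>UNIV. \<Sum>c\<in>UNIV. \<theta> \<mu> \<alpha> a c *\<^sub>C (x_CM a \<nu> * x_CM c \<beta>))"
    by (simp only: pick scale cvec.scale_sum_right)
  have 4: "?S (\<lambda>a b c d. ?d \<mu> a * (?d \<alpha> c * ?t \<nu> \<beta> b d)) =
      (\<i> / 2) *\<^sub>C (\<Sum>b\<in>UNIV. \<Sum>d\<in>UNIV. \<theta> \<nu> \<beta> b d *\<^sub>C (x_CM \<mu> b * x_CM \<alpha> d))"
    by (simp only: pick scale cvec.scale_sum_right)
  have 5: "?S (\<lambda>a b c d. ?d \<mu> a * (?d \<beta> d * ?t \<nu> \<alpha> b c)) =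
      (\<i> / 2) *\<^sub>C (\<Sum>b\<in>UNIV. \<Sum>c\<in>UNIV. \<theta> \<nu> \<alpha> b c *\<^sub>C (x_CM \<mu> b * x_CM c \<beta>))"
    by (simp only: pick scale cvec.scale_sum_right)
  \<comment> \<open>The square of \<i> / 2 is the source of the coefficient -1/4.\<close>
  have 6: "?S (\<lambda>a b c d. (\<i> / 2 * f a b c d) * (\<i> / 2 * g a b c d)) = - ((1 / 4) *\<^sub>C ?S (\<lambda>a b c d. f a b c d * g a b c d))"
    for f g
  proof -
    have "(\<i> / 2 * f a b c d) * (\<i> / 2 * g a b c d) = - (1 / 4) * (f a b c d * g a b c d)" for a b c d
      by (simp add: algebra_simps)
    then show ?thesis
      by (simp only: scaleC_scaleC[symmetric] cvec.scale_sum_right[symmetric] cvec.scale_minus_left sum_negf)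
  qed
  show ?thesis
    unfolding CM_F_product F_GL_products[OF \<theta>] add 1 2 3 4 5 6
    by (simp add: scaleC_add_right)
qed

text \<open>Every \<theta> in the product formula takes one upper index from each factor. For x34
  this index is 3 or 4, where \<theta> vanishes by the support condition.\<close>

lemma CM_F_x34_undeformed:
  assumes \<theta>: "block_supported \<theta>"
  shows "amult (CM_F \<theta>) (x_CM 3 4) (x_CM \<mu> \<nu>) = x_CM 3 4 * x_CM \<mu> \<nu>"
    "amult (CM_F \<theta>) (x_CM \<mu> \<nu>) (x_CM 3 4) = x_CM \<mu> \<nu> * x_CM 3 4"
proof -
  have "\<theta> 3 \<alpha> \<beta> \<gamma> = 0" "\<theta> 4 \<alpha> \<beta> \<gamma> = 0" "\<theta> \<alpha> 3 \<beta> \<gamma> = 0" "\<theta> \<alpha> 4 \<beta> \<gamma> = 0" for \<alpha> \<beta> \<gamma>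
    using \<theta> unfolding block_supported_def by auto
  note zero = this
  show "amult (CM_F \<theta>) (x_CM 3 4) (x_CM \<mu> \<nu>) = x_CM 3 4 * x_CM \<mu> \<nu>"
    "amult (CM_F \<theta>) (x_CM \<mu> \<nu>) (x_CM 3 4) = x_CM \<mu> \<nu> * x_CM 3 4"
    by (simp_all add: CM_F_product_formula[OF \<theta>] zero)
qed

theorem proposition4p2:
  fixes \<theta> :: "4 \<Rightarrow> 4 \<Rightarrow> 4 \<Rightarrow> 4 \<Rightarrow> complex"
  assumes theta_zero: "\<And>\<mu> \<alpha> \<nu> \<beta>.
    \<not> (\<mu> \<in> {1, 2} \<and> \<alpha> \<in> {1, 2} \<and> \<nu> \<in> {3, 4} \<and> \<beta> \<in> {3, 4}) \<Longrightarrow> \<theta> \<mu> \<alpha> \<nu> \<beta> = 0"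
  shows
    "(\<forall>\<mu> \<nu> \<alpha> \<beta>. amult (CM_F \<theta>) (x_CM \<mu> \<nu>) (x_CM \<alpha> \<beta>) =
        x_CM \<mu> \<nu> * x_CM \<alpha> \<beta>
        + (\<i> / 2) *\<^sub>C
          ((\<Sum>a\<in>UNIV. \<Sum>d\<in>UNIV. \<theta> \<mu> \<beta> a d *\<^sub>C (x_CM a \<nu> * x_CM \<alpha> d))
           + (\<Sum>a\<in>UNIV. \<Sum>c\<in>UNIV. \<theta> \<mu> \<alpha> a c *\<^sub>C (x_CM a \<nu> * x_CM c \<beta>))
           + (\<Sum>b\<in>UNIV. \<Sum>d\<in>UNIV. \<theta> \<nu> \<beta> b d *\<^sub>C (x_CM \<mu> b * x_CM \<alpha> d))
           + (\<Sum>b\<in>UNIV. \<Sum>c\<in>UNIV. \<theta> \<nu> \<alpha> b c *\<^sub>C (x_CM \<mu> b * x_CM c \<beta>)))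
        - (1 / 4) *\<^sub>C
          (\<Sum>a\<in>UNIV. \<Sum>b\<in>UNIV. \<Sum>c\<in>UNIV. \<Sum>d\<in>UNIV.
            (\<theta> \<nu> \<alpha> b c * \<theta> \<mu> \<beta> a d + \<theta> \<nu> \<beta> b d * \<theta> \<mu> \<alpha> a c) *\<^sub>C (x_CM a b * x_CM c d)))
     \<and> isomorphic_to_subalgebra (CM_F \<theta>) (GL4_F \<theta>)
         (right_invariants (GL4_F \<theta>) (H4_F \<theta>) proj_H)
     \<and> (\<forall>\<mu> \<nu>. amult (CM_F \<theta>) (x_CM 3 4) (x_CM \<mu> \<nu>) = x_CM 3 4 * x_CM \<mu> \<nu>
            \<and> amult (CM_F \<theta>) (x_CM \<mu> \<nu>) (x_CM 3 4) = x_CM \<mu> \<nu> * x_CM 3 4)"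
proof -
  have \<theta>: "block_supported \<theta>"
    unfolding block_supported_def using theta_zero by blast
  show ?thesis
    by (intro conjI allI CM_F_product_formula[OF \<theta>] CM_F_isomorphic CM_F_x34_undeformed[OF \<theta>])
qed

end
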